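(* Let $a=\int_0^{\pi/2}\sqrt{\cos t}\,dt$. For every $\Omega\in\mathcal{K}$, $$E(\Omega)\,r(\Omega)\;\geq\; 2\left(\int_0^{\pi/2}\sqrt{\cos t}\,dt\right)^2 = 2a^2 .$$ Moreover, equality holds for the convex domain $\Omega^*$ defined as follows. Let $\theta:[0,L_0]\to[0,\pi]$ be the solution of $\theta'(s)=a\sqrt{\sin\theta(s)}$, $\theta(0)=0$, which is increasing with $\theta(L_0)=\pi$, where $L_0=\frac{2}{a}\int_0^{\pi/2}\frac{dt}{\sqrt{\cos t}}$. Let $\Omega^*$ be the convex domain that is symmetric with respect to the line $\{x=0\}$ and whose boundary in the half-plane $\{x\ge 0\}$ is the curve $$x(s)=\frac{2}{a}\sqrt{\sin\theta(s)},\qquad y(s)=-1+\frac1a\int_0^{\theta(s)}\sqrt{\sin u}\,du,\qquad s\in[0,L_0],$$ which joins $(0,-1)$ to $(0,1)$. Then $\Omega^*\in\mathcal{K}$, $r(\Omega^* )=1$ and $E(\Omega^* )=2a^2$.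
   Context: $\mathcal{K}$ denotes the class of bounded planar convex bodies (compact convex sets with nonempty interior in $\mathbb{R}^2$) whose boundary is of class $C^{1,1}$. For $\Omega\in\mathcal{K}$, the elastic energy is $E(\Omega)=\frac12\int_{\partial\Omega}k(s)^2\,ds$, where $s$ is arc length on $\partial\Omega$ and $k$ the curvature. $r(\Omega)$ denotes the inradius of $\Omega$ (the radius of the largest disk contained in $\Omega$). *)

theory Defs
  imports "HOL-Analysis.Analysis"
begin

type_synonym pt = "real \<times> real"

definition c11_boundary_param :: "pt set \<Rightarrow> (real \<Rightarrow> pt) \<Rightarrow> real \<Rightarrow> bool" where
  "c11_boundary_param \<Omega> \<gamma> L \<longleftrightarrow>
     L > 0 \<and>
     (\<forall>s. \<gamma> (s + L) = \<gamma> s) \<and>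
     inj_on \<gamma> {0..<L} \<and>
     \<gamma> ` {0..L} = frontier \<Omega> \<and>
     (\<forall>s. \<gamma> differentiable (at s)) \<and>
     (\<forall>s. norm (vector_derivative \<gamma> (at s)) = 1) \<and>
     (\<exists>M. M-lipschitz_on UNIV (\<lambda>s. vector_derivative \<gamma> (at s)))"

definition classK :: "pt set \<Rightarrow> bool" where
  "classK \<Omega> \<longleftrightarrow> compact \<Omega> \<and> convex \<Omega> \<and> interior \<Omega> \<noteq> {} \<and>
     (\<exists>\<gamma> L. c11_boundary_param \<Omega> \<gamma> L)"

text \<open>Elastic energy computed along an arc-length parametrization:
  \<open>1/2 \<int>_0^L k(s)^2 ds\<close> with \<open>|k(s)| = |\<gamma>''(s)|\<close> (defined a.e.).\<close>
definition elastic_energy :: "(real \<Rightarrow> pt) \<Rightarrow> real \<Rightarrow> real" where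
  "elastic_energy \<gamma> L =
     1/2 * integral {0..L}
       (\<lambda>s. (norm (vector_derivative (\<lambda>t. vector_derivative \<gamma> (at t)) (at s)))\<^sup>2)"

definition inradius :: "pt set \<Rightarrow> real" where
  "inradius \<Omega> = Sup {r. r \<ge> 0 \<and> (\<exists>c. cball c r \<subseteq> \<Omega>)}"

definition a_const :: real where
  "a_const = integral {0..pi/2} (\<lambda>t. sqrt (cos t))"

definition L0_const :: real where
  "L0_const = 2 / a_const * integral {0..pi/2} (\<lambda>t. 1 / sqrt (cos t))"

definition theta_sol :: "(real \<Rightarrow> real) \<Rightarrow> bool" where
  "theta_sol \<theta> \<longleftrightarrow>
     (\<forall>s\<in>{0..L0_const}.
        (\<theta> has_real_derivative (a_const * sqrt (sin (\<theta> s)))) (at s within {0..L0_const})) \<and>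
     \<theta> 0 = 0 \<and> \<theta> L0_const = pi \<and> mono_on {0..L0_const} \<theta> \<and>
     \<theta> ` {0..L0_const} \<subseteq> {0..pi}"

definition xcurve :: "(real \<Rightarrow> real) \<Rightarrow> real \<Rightarrow> real" where
  "xcurve \<theta> s = 2 / a_const * sqrt (sin (\<theta> s))"

definition ycurve :: "(real \<Rightarrow> real) \<Rightarrow> real \<Rightarrow> real" where
  "ycurve \<theta> s = -1 + 1 / a_const * integral {0..\<theta> s} (\<lambda>u. sqrt (sin u))"

text \<open>\<open>\<Omega>*\<close>: the convex domain symmetric w.r.t. \<open>{x=0}\<close> whose boundary in \<open>{x\<ge>0}\<close> is the
  curve \<open>(x(s),y(s))\<close>; it is the convex hull of that curve and its mirror image.\<close>
definition Omega_star :: "(real \<Rightarrow> real) \<Rightarrow> pt set" where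
  "Omega_star \<theta> = convex hull
     ((\<lambda>s. (xcurve \<theta> s, ycurve \<theta> s)) ` {0..L0_const} \<union>
      (\<lambda>s. (- xcurve \<theta> s, ycurve \<theta> s)) ` {0..L0_const})"

end

theory Submission
  imports Defs
begin

text \<open>
  The boundary of a convex body is described by a monotone Lipschitz tangent angle \<open>\<Theta>\<close> of total
  variation \<open>2 \<pi>\<close>, and the energy is \<open>1/2 \<integral> \<Theta>'\<^sup>2\<close>. A largest inscribed disk, of radius \<open>r\<close>, touches the
  boundary at points whose normals leave no gap larger than \<open>\<pi>\<close>, so three contact points cut
  the boundary into arcs on which \<open>\<Theta>\<close> grows by \<open>2 \<beta>\<close> with \<open>\<beta> \<le> \<pi>/2\<close>. On such an arc with
  middle angle \<open>m\<close> the chord gives \<open>\<integral> cos (\<Theta> - m) = 2 r sin \<beta>\<close>, and integrating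
  \<open>\<Theta>'\<^sup>2 + (a/r)\<^sup>2 cos (\<Theta> - m) \<ge> 2 (a/r) \<Theta>' sqrt (cos (\<Theta> - m))\<close> bounds the energy from below by a
  function of \<open>\<beta>\<close> that lies above the linear function through its values at \<open>0\<close> and \<open>\<pi>/2\<close>;
  the half-angles of the arcs add up to \<open>\<pi>\<close>.

  On the extremal domain \<open>x \<bar>x\<bar> = 4/a\<^sup>2 sin \<Theta>\<close> holds at every boundary point; differentiating it
  along an arbitrary parametrization gives \<open>\<Theta>' = a sqrt \<bar>sin \<Theta>\<bar>\<close> almost everywhere, the equality case.
\<close>

section \<open>Signed primitives\<close>

text \<open>The weight \<open>a/r\<close> is the same on every arc although the best one depends on
  the turning: with S(\<beta>) the integral of sqrt(cos) from 0 to \<beta>, it is S(\<beta>) / (r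
  sin \<beta>), which equals \<open>a/r\<close> at \<beta> = pi/2. With the fixed weight an arc
  contributes at least 2/r (2 a S(\<beta>) - a^2 sin \<beta>) to the integral of the squared
  curvature. Comparison with a linear function makes the estimate additive and insensitive to the
  position of the contacts; it is sharp for two half-turns, the contacts (0,-1) and (0,1) of the
  extremal body. Near \<beta> = 0 the comparison demands a (pi + 2) \<le> 2 pi, a numerical fact
  about a. Half-angles beyond pi/2 must be excluded because cos (\<Theta> - m) would become
  negative; the maximality of the disk serves this purpose. The curvature of a C^{1,1} boundary
  exists only almost everywhere, so increments of Lipschitz functions have to be recovered from
  their a.e. derivatives before any energy can be estimated. Both the inequality and the equality
  concern every arc-length parametrization; the sign \<sigma> absorbs its orientation.\<close>

definition signed_integral :: "(real \<Rightarrow> real) \<Rightarrow> real \<Rightarrow> real" where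
  "signed_integral f x = (if 0 \<le> x then integral {0..x} f else - integral {x..0} f)"

lemma signed_integral_0 [simp]: "signed_integral f 0 = 0"
  by (simp add: signed_integral_def)

lemma has_integral_signed_integral:
  assumes int: "\<And>a b. f integrable_on {a..b}" and ab: "a \<le> b"
  shows "(f has_integral (signed_integral f b - signed_integral f a)) {a..b}"
proof -
  have split: "integral {u..v} f + integral {v..w} f = integral {u..w} f" if "u \<le> v" "v \<le> w" for u v w
    using that int by (rule Henstock_Kurzweil_Integration.integral_combine)
  have "integral {a..b} f = signed_integral f b - signed_integral f a"
    using ab split[of 0 a b] split[of a 0 b] split[of a b 0] by (auto simp: signed_integral_def)
  then show ?thesis using integrable_integral[OF int] by metis
qed

lemma signed_integral_has_real_derivative:
  assumes int: "\<And>a b. f integrable_on {a..b}" and cont: "isCont f x"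
  shows "(signed_integral f has_real_derivative f x) (at x)"
proof -
  let ?I = "\<lambda>u. signed_integral f (x - 1) + integral {x - 1..u} f"
  have "((\<lambda>u. integral {x - 1..u} f) has_vector_derivative f x) (at x within ({x - 1..x + 1} - {}))"
    by (rule integral_has_vector_derivative_continuous_at[OF int])
       (use cont in \<open>auto intro: continuous_at_imp_continuous_at_within\<close>)
  then have "((\<lambda>u. integral {x - 1..u} f) has_real_derivative f x) (at x)"
    using at_within_Icc_at[of "x - 1" x "x + 1"]
    by (simp add: has_real_derivative_iff_has_vector_derivative)
  then have "(?I has_real_derivative f x) (at x)"
    by (auto intro!: derivative_eq_intros)
  then show ?thesis
  proof (rule has_field_derivative_transform_within_open[of _ _ _ "{x - 1<..<x + 1}"])
    fix u assume "u \<in> {x - 1<..<x + 1}"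
    then show "?I u = signed_integral f u"
      using integral_unique[OF has_integral_signed_integral[OF int, of "x - 1" u]] by simp
  qed auto
qed

lemma continuous_signed_integral:
  assumes "continuous_on UNIV f"
  shows "(signed_integral f has_real_derivative f x) (at x)"
  using assms
  by (intro signed_integral_has_real_derivative integrable_continuous_interval)
     (auto simp: continuous_on_eq_continuous_at intro!: continuous_at_imp_continuous_on)

lemma signed_integral_continuous:
  assumes int: "\<And>a b. f integrable_on {a..b}"
  shows "continuous_on {a..b} (signed_integral f)"
proof -
  have "continuous_on {a..b} (\<lambda>u. signed_integral f a + integral {a..u} f)"
    by (intro continuous_intros indefinite_integral_continuous_1 int)
  then show ?thesis
    by (rule continuous_on_eq)
       (use integral_unique[OF has_integral_signed_integral[OF int]] in auto)
qed

lemma has_integral_shift_real: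
  fixes f :: "real \<Rightarrow> real"
  shows "((\<lambda>x. f (x + c)) has_integral I) {a..b} \<longleftrightarrow> (f has_integral I) {a + c..b + c}"
  using has_integral_shift_cbox_iff[of f c I a b] by (simp add: o_def add.commute)

text \<open>The integrals over \<open>{a..b}\<close> and over its translate by \<open>L\<close>
  agree, so increments of the primitive are \<open>L\<close>-periodic; taking 0 as one end gives the
  formula.\<close>

lemma signed_integral_periodic:
  assumes int: "\<And>a b. f integrable_on {a..b}" and per: "\<And>x. f (x + L) = f x"
  shows "signed_integral f (x + L) = signed_integral f x + signed_integral f L"
proof -
  let ?P = "signed_integral f"
  have "?P (b + L) - ?P (a + L) = ?P b - ?P a" if "a \<le> b" for a b
  proof (rule has_integral_unique)
    show "(f has_integral (?P b - ?P a)) {a..b}" by (rule has_integral_signed_integral[OF int that])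
    show "(f has_integral (?P (b + L) - ?P (a + L))) {a..b}"
      using has_integral_signed_integral[OF int, of "a + L" "b + L"] that
        has_integral_shift_real[of f L _ a b] by (simp add: per)
  qed
  from this[of 0 x] this[of x 0] show ?thesis by (cases "0 \<le> x") auto
qed

lemma antiderivative_diff:
  fixes F f :: "real \<Rightarrow> real"
  assumes "\<And>t. (F has_real_derivative f t) (at t)" "a \<le> b"
  shows "(f has_integral (F b - F a)) {a..b}"
  by (rule fundamental_theorem_of_calculus)
     (use assms in \<open>auto simp flip: has_real_derivative_iff_has_vector_derivative
        intro: has_field_derivative_at_within\<close>)

section \<open>Lipschitz functions of one variable\<close>

lemma lipschitz_bounds:
  fixes F :: "real \<Rightarrow> real"
  assumes "M-lipschitz_on UNIV F"
  shows "\<bar>F y - F x\<bar> \<le> M * \<bar>y - x\<bar>"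
  using lipschitz_onD[OF assms, of y x] by (simp add: dist_real_def)

text \<open>Averages over \<open>{x..x + h}\<close> with \<open>h > 0\<close> see only the right
  difference quotient. The left one comes from the same a.e. convergence for the reflected function,
  whose null set is reflected back.\<close>

lemma Lebesgue_differentiation_real:
  fixes g P :: "real \<Rightarrow> real"
  assumes int: "\<And>a b. a \<le> b \<Longrightarrow> (g has_integral (P b - P a)) {a..b}"
  obtains N where "negligible N" "\<And>x. x \<notin> N \<Longrightarrow> (P has_real_derivative g x) (at x)"
proof -
  have g1: "g integrable_on cbox a b" for a b
    using int[of a b] by (cases "a \<le> b") (auto simp: integrable_on_def)
  have int2: "((\<lambda>x. g (- x)) has_integral (P (-a) - P (-b))) {a..b}" if "a \<le> b" for a b
    using int[of "-b" "-a"] that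
      has_integral_reflect_real[where a="-b" and b="-a" and f=g] by simp
  have g2: "(\<lambda>x. g (- x)) integrable_on cbox a b" for a b
    using int2[of a b] by (cases "a \<le> b") (auto simp: integrable_on_def)
  obtain N1 where N1: "negligible N1"
    "\<And>x e. \<lbrakk>x \<notin> N1; 0 < e\<rbrakk> \<Longrightarrow> \<exists>d>0. \<forall>h. 0 < h \<and> h < d \<longrightarrow>
        norm (integral (cbox x (x + h *\<^sub>R One)) g /\<^sub>R h ^ DIM(real) - g x) < e"
    using integrable_ccontinuous_explicit[OF g1] by metis
  obtain N2 where N2: "negligible N2"
    "\<And>x e. \<lbrakk>x \<notin> N2; 0 < e\<rbrakk> \<Longrightarrow> \<exists>d>0. \<forall>h. 0 < h \<and> h < d \<longrightarrow>
        norm (integral (cbox x (x + h *\<^sub>R One)) (\<lambda>x. g (- x)) /\<^sub>R h ^ DIM(real) - g (- x)) < e"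
    using integrable_ccontinuous_explicit[OF g2] by metis
  have "negligible (uminus ` N2)"
    using N2(1) by (intro negligible_differentiable_image_negligible)
      (auto simp: differentiable_on_def intro!: derivative_intros)
  then have "negligible (N1 \<union> uminus ` N2)"
    using N1(1) by simp
  moreover have "(P has_real_derivative g x) (at x)" if x: "x \<notin> N1 \<union> uminus ` N2" for x
  proof -
    have x1: "x \<notin> N1" and x2: "- x \<notin> N2"
      using x by (auto simp: image_iff)
    have "(\<lambda>h. (P (x + h) - P x) / h) \<midarrow>0\<rightarrow> g x"
    proof (rule LIM_I)
      fix e :: real assume e: "0 < e"
      obtain d1 where d1: "d1 > 0" "\<And>h. 0 < h \<Longrightarrow> h < d1 \<Longrightarrow>
          \<bar>integral {x..x+h} g / h - g x\<bar> < e"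
        using N1(2)[OF x1 e] by (auto simp: divide_inverse_commute)
      obtain d2 where d2: "d2 > 0" "\<And>h. 0 < h \<Longrightarrow> h < d2 \<Longrightarrow>
          \<bar>integral {-x..-x+h} (\<lambda>x. g (- x)) / h - g x\<bar> < e"
        using N2(2)[OF x2 e] by (auto simp: divide_inverse_commute)
      show "\<exists>s>0. \<forall>h. h \<noteq> 0 \<and> norm (h - 0) < s \<longrightarrow> norm ((P (x + h) - P x) / h - g x) < e"
      proof (intro exI[of _ "min d1 d2"] conjI allI impI)
        fix h :: real assume h: "h \<noteq> 0 \<and> norm (h - 0) < min d1 d2"
        show "norm ((P (x + h) - P x) / h - g x) < e"
        proof (cases "h > 0")
          case True
          have "integral {x..x+h} g = P (x + h) - P x"
            using int[of x "x+h"] True by (simp add: integral_unique)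
          then show ?thesis using d1(2)[of h] True h by simp
        next
          case False
          then have k: "0 < - h" "- h < d2" using h by auto
          have "integral {-x..-x+(-h)} (\<lambda>x. g (- x)) = P x - P (x + h)"
            using int2[of "-x" "-x + (-h)"] k by (simp add: integral_unique add.commute)
          then have "\<bar>(P x - P (x + h)) / (- h) - g x\<bar> < e"
            using d2(2)[OF k] by simp
          moreover have "(P x - P (x + h)) / (- h) = (P (x + h) - P x) / h"
            using h by (simp add: field_simps)
          ultimately show ?thesis by simp
        qed
      qed (use d1 d2 in auto)
    qed
    then show ?thesis
      by (simp add: DERIV_def)
  qed
  ultimately show thesis using that by blast
qed

text \<open>Tilting \<open>F\<close> by a linear function gives a homeomorphism \<open>G\<close> whose inverse pushes Lebesgue
  measure to an absolutely continuous measure; its Radon--Nikodym density is the derivative.\<close>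
lemma lipschitz_imp_indefinite_integral:
  fixes F :: "real \<Rightarrow> real"
  assumes lip: "M-lipschitz_on UNIV F"
  obtains g where "\<And>a b. a \<le> b \<Longrightarrow> (g has_integral (F b - F a)) {a..b}"
proof -
  \<comment> \<open>The slope \<open>M + 1\<close> outweighs any descent of \<open>F\<close>:
    increments of \<open>G\<close> are at least those of the identity, so \<open>G\<close> is a
    bijection with a 1-Lipschitz inverse.\<close>
  define G where "G x = F x + (M + 1) * x" for x
  have M0: "M \<ge> 0" by (rule lipschitz_on_nonneg[OF lip])
  have Gdiff: "G y - G x \<ge> y - x" if "x \<le> y" for x y
    using lipschitz_bounds[OF lip, of y x] that by (simp add: G_def algebra_simps abs_le_iff)
  have Gmono: "x < y \<longleftrightarrow> G x < G y" for x y
    using Gdiff[of x y] Gdiff[of y x] by linarith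
  have Gle: "x \<le> y \<longleftrightarrow> G x \<le> G y" for x y
    using Gmono[of y x] by linarith
  have Gcont: "continuous_on UNIV G"
    unfolding G_def using lipschitz_on_continuous_on[OF lip] by (intro continuous_intros)
  have Gsurj: "\<exists>x. G x = y" for y
  proof -
    define A where "A = \<bar>y - G 0\<bar>"
    have "G (- A) \<le> y" "y \<le> G A"
      using Gdiff[of 0 A] Gdiff[of "-A" 0] by (auto simp: A_def)
    then show ?thesis
      using IVT'[of G "-A" y A] continuous_on_subset[OF Gcont] by (force simp: A_def)
  qed
  define H where "H = inv G"
  have inj: "inj G" using Gmono by (metis injI linorder_neqE_linordered_idom order_less_irrefl)
  have GH: "G (H y) = y" for y
    unfolding H_def using Gsurj[of y] f_inv_into_f[of y G UNIV] by blast
  have HG: "H (G x) = x" for x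
    unfolding H_def using inj by simp
  have "1-lipschitz_on UNIV H"
  proof (rule lipschitz_onI)
    fix x y
    show "dist (H x) (H y) \<le> 1 * dist x y"
      using Gdiff[of "H x" "H y"] Gdiff[of "H y" "H x"]
      by (auto simp: GH dist_real_def abs_le_iff) (smt (verit) GH Gle)+
  qed simp
  then have Hcont: "continuous_on UNIV H" by (rule lipschitz_on_continuous_on)
  then have Hm[measurable]: "H \<in> borel_measurable borel"
    by (rule borel_measurable_continuous_onI)
  \<comment> \<open>\<open>N\<close> is the Stieltjes measure of \<open>G\<close>: it gives
    \<open>{a..b}\<close> the mass \<open>G b - G a\<close>.\<close>
  define N where "N = distr lborel borel H"
  have emN: "emeasure N A = emeasure lborel (H -` A)" if "A \<in> sets borel" for A
    using that by (simp add: N_def emeasure_distr)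
  have ac: "absolutely_continuous lborel N"
    unfolding absolutely_continuous_def
  proof
    fix A :: "real set" assume A: "A \<in> null_sets lborel"
    then have As: "A \<in> sets borel" and "emeasure lborel A = 0" by auto
    then have "A \<in> null_sets lebesgue" using A by (simp add: null_sets_completionI)
    then have nA: "negligible A" by (simp add: negligible_iff_null_sets)
    \<comment> \<open>Preimages under \<open>H\<close> are images under the Lipschitz map
      \<open>G\<close>, which preserves negligible sets.\<close>
    have im: "H -` A = G ` A"
      using GH HG by (auto simp: image_iff) metis
    have "negligible (G ` A)"
    proof (rule negligible_locally_Lipschitz_image[OF _ nA])
      fix x
      have "norm (G y - G x) \<le> (2 * M + 1) * norm (y - x)" for y
      proof -
        have "G y - G x = (F y - F x) + (M + 1) * (y - x)"
          by (simp add: G_def algebra_simps)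
        then have "\<bar>G y - G x\<bar> \<le> \<bar>F y - F x\<bar> + \<bar>(M+1) * (y - x)\<bar>"
          by (metis abs_triangle_ineq)
        also have "\<dots> \<le> M * \<bar>y - x\<bar> + (M + 1) * \<bar>y - x\<bar>"
          using lipschitz_bounds[OF lip, of y x] M0 by (simp add: abs_mult)
        finally show ?thesis by (simp add: algebra_simps)
      qed
      then show "\<exists>T B. open T \<and> x \<in> T \<and> (\<forall>y\<in>A \<inter> T. norm (G y - G x) \<le> B * norm (y - x))"
        by (intro exI[of _ UNIV] exI[of _ "2*M+1"]) auto
    qed simp
    then have "H -` A \<in> null_sets lebesgue"
      by (simp add: im negligible_iff_null_sets)
    moreover have HA: "H -` A \<in> sets borel"
      using measurable_sets[OF Hm As] by simp
    ultimately have "emeasure lborel (H -` A) = 0"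
      using null_sets_completion_iff[of "H -` A" lborel] by auto
    then show "A \<in> null_sets N"
      using As emN by (simp add: null_sets_def N_def)
  qed
  obtain f where fm[measurable]: "f \<in> borel_measurable lborel" and f: "density lborel f = N"
    using sigma_finite_measure.Radon_Nikodym[OF sigma_finite_lborel ac] by (auto simp: N_def)
  define g where "g x = enn2real (f x)" for x
  have gm[measurable]: "g \<in> borel_measurable borel"
    unfolding g_def using fm by measurable
  have "(g has_integral (G b - G a)) {a..b}" if ab: "a \<le> b" for a b
  proof -
    have "H -` {a..b} = {G a..G b}"
      using Gle[of a "H _"] Gle[of "H _" b] by (auto simp: GH)
    then have "emeasure N {a..b} = ennreal (G b - G a)"
      using emN[of "{a..b}"] Gle[of a b] ab by (simp add: emeasure_lborel_Icc)
    then have nn: "(\<integral>\<^sup>+ x. f x * indicator {a..b} x \<partial>lborel) = ennreal (G b - G a)"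
      using emeasure_density[OF fm, of "{a..b}"] by (simp add: f)
    have "AE x in lborel. f x * indicator {a..b} x \<noteq> \<infinity>"
      by (rule nn_integral_PInf_AE) (use nn in auto)
    then have "AE x in lborel. f x * indicator {a..b} x = ennreal (g x * indicator {a..b} x)"
      by eventually_elim (auto simp: g_def indicator_def less_top)
    then have "(\<integral>\<^sup>+ x. ennreal (g x * indicator {a..b} x) \<partial>lborel) = ennreal (G b - G a)"
      using nn nn_integral_cong_AE by metis
    then have "((\<lambda>x. g x * indicator {a..b} x) has_integral (G b - G a)) UNIV"
      using Gle[of a b] ab by (intro nn_integral_has_integral) (auto simp: g_def)
    moreover have "(\<lambda>x. g x * indicator {a..b} x) = (\<lambda>x. if x \<in> {a..b} then g x else 0)"
      by auto
    ultimately show ?thesis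
      using has_integral_restrict_UNIV[of "{a..b}" g "G b - G a"] by metis
  qed
  then have "((\<lambda>x. g x - (M + 1)) has_integral (G b - G a - (b - a) * (M + 1))) {a..b}" if "a \<le> b" for a b
    using has_integral_diff[OF _ has_integral_const_real[of "M+1" a b], of g "G b - G a"] that
    by simp
  moreover have "G b - G a - (b - a) * (M + 1) = F b - F a" for a b
    by (simp add: G_def algebra_simps)
  ultimately have "((\<lambda>x. g x - (M + 1)) has_integral (F b - F a)) {a..b}" if "a \<le> b" for a b
    using that by metis
  then show thesis using that by blast
qed

text \<open>Rademacher's theorem on the line together with the fundamental theorem of calculus. The
  density is replaced by \<open>deriv F\<close>, so that separate later arguments speak about one
  and the same integrand.\<close>

lemma lipschitz_ae_derivative:
  fixes F :: "real \<Rightarrow> real"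
  assumes lip: "M-lipschitz_on UNIV F"
  obtains N where "negligible N"
    "\<And>x. x \<notin> N \<Longrightarrow> (F has_real_derivative deriv F x) (at x)"
    "\<And>x. x \<notin> N \<Longrightarrow> \<bar>deriv F x\<bar> \<le> M"
    "\<And>a b. a \<le> b \<Longrightarrow> (deriv F has_integral (F b - F a)) {a..b}"
proof -
  obtain g where g: "\<And>a b. a \<le> b \<Longrightarrow> (g has_integral (F b - F a)) {a..b}"
    using lipschitz_imp_indefinite_integral[OF lip] by metis
  then obtain N where N: "negligible N" "\<And>x. x \<notin> N \<Longrightarrow> (F has_real_derivative g x) (at x)"
    using Lebesgue_differentiation_real by metis
  have d: "deriv F x = g x" if "x \<notin> N" for x
    using N(2)[OF that] by (rule DERIV_imp_deriv)
  have "\<bar>deriv F x\<bar> \<le> M" if "x \<notin> N" for x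
  proof -
    have "(\<lambda>h. (F (x + h) - F x) / h) \<midarrow>0\<rightarrow> g x"
      using N(2)[OF that] by (simp add: DERIV_def)
    then have "(\<lambda>h. \<bar>(F (x + h) - F x) / h\<bar>) \<midarrow>0\<rightarrow> \<bar>g x\<bar>"
      by (rule tendsto_rabs)
    moreover have "\<forall>\<^sub>F h in at 0. \<bar>(F (x + h) - F x) / h\<bar> \<le> M"
      using lipschitz_bounds[OF lip, of "x + _" x]
      by (intro eventually_at_leftI[THEN eventually_mono] always_eventually)
         (auto simp: eventually_at_filter abs_divide divide_le_eq lipschitz_on_nonneg[OF lip])
    ultimately show ?thesis
      using d[OF that] by (metis tendsto_upperbound trivial_limit_at)
  qed
  moreover have "(deriv F has_integral (F b - F a)) {a..b}" if "a \<le> b" for a b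
    by (rule has_integral_spike[OF N(1) _ g[OF that]]) (use d in auto)
  ultimately show thesis
    using that[of N] N d by auto
qed

text \<open>\<open>Q\<close> composed with \<Theta> is again Lipschitz and hence the integral of its
  derivative, which the chain rule identifies off a null set.\<close>

lemma has_integral_lipschitz_chain:
  fixes \<Theta> Q q :: "real \<Rightarrow> real"
  assumes lip: "K-lipschitz_on UNIV \<Theta>"
    and Q: "\<And>t. (Q has_real_derivative q t) (at t)" and q: "\<And>t. \<bar>q t\<bar> \<le> C"
    and ab: "a \<le> b"
  shows "((\<lambda>u. q (\<Theta> u) * deriv \<Theta> u) has_integral (Q (\<Theta> b) - Q (\<Theta> a))) {a..b}"
proof -
  have C0: "C \<ge> 0" using q[of 0] by linarith
  have lipQ: "C-lipschitz_on UNIV Q"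
  proof (rule lipschitz_onI)
    fix x y
    show "dist (Q x) (Q y) \<le> C * dist x y"
      using field_differentiable_bound[of UNIV Q q C x y] Q q
      by (simp add: dist_norm)
  qed (rule C0)
  have "(C * K)-lipschitz_on UNIV (\<lambda>u. Q (\<Theta> u))"
    by (rule lipschitz_on_compose2[OF lip lipschitz_on_subset[OF lipQ]]) auto
  then obtain N1 where N1: "negligible N1"
    "((deriv (\<lambda>u. Q (\<Theta> u))) has_integral (Q (\<Theta> b) - Q (\<Theta> a))) {a..b}"
    by (rule lipschitz_ae_derivative) (use ab in blast)
  obtain N where N: "negligible N" "\<And>x. x \<notin> N \<Longrightarrow> (\<Theta> has_real_derivative deriv \<Theta> x) (at x)"
    using lipschitz_ae_derivative[OF lip] by metis
  show ?thesis
  proof (rule has_integral_spike[OF N(1) _ N1(2)])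
    fix x assume "x \<in> {a..b} - N"
    then have "((\<lambda>u. Q (\<Theta> u)) has_real_derivative q (\<Theta> x) * deriv \<Theta> x) (at x)"
      using DERIV_chain2[OF Q N(2)] by simp
    then show "q (\<Theta> x) * deriv \<Theta> x = deriv (\<lambda>u. Q (\<Theta> u)) x"
      by (simp add: DERIV_imp_deriv)
  qed
qed

lemma lipschitz_deriv_square_integrable:
  fixes \<Theta> :: "real \<Rightarrow> real"
  assumes lip: "K-lipschitz_on UNIV \<Theta>"
  shows "(\<lambda>s. (deriv \<Theta> s)\<^sup>2) integrable_on {a..b}"
proof (cases "a \<le> b")
  case True
  obtain N where N: "negligible N" "\<And>x. x \<notin> N \<Longrightarrow> \<bar>deriv \<Theta> x\<bar> \<le> K"
    "(deriv \<Theta> has_integral (\<Theta> b - \<Theta> a)) {a..b}"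
    using lipschitz_ae_derivative[OF lip] True by metis
  \<comment> \<open>The bound \<open>K\<close> on \<open>deriv \<Theta>\<close> is known only off
    \<open>N\<close>; zeroing the values on \<open>N\<close> gives a function bounded
    everywhere.\<close>
  define g where "g x = (if x \<in> N then 0 else deriv \<Theta> x)" for x
  have g: "(g has_integral (\<Theta> b - \<Theta> a)) {a..b}"
    by (rule has_integral_spike[OF N(1) _ N(3)]) (auto simp: g_def)
  have gK: "\<bar>g x\<bar> \<le> K" for x
    using N(2)[of x] lipschitz_on_nonneg[OF lip] by (auto simp: g_def)
  have "g absolutely_integrable_on {a..b}"
    by (rule absolutely_integrable_integrable_bound[where g="\<lambda>_. K"])
       (use g gK in \<open>auto simp: integrable_on_def\<close>)
  moreover have "g \<in> borel_measurable (lebesgue_on {a..b})"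
    using g by (auto intro!: integrable_imp_measurable simp: integrable_on_def)
  ultimately have "(\<lambda>x. g x * g x) absolutely_integrable_on {a..b}"
    by (intro absolutely_integrable_bounded_measurable_product_real)
       (use gK in \<open>auto simp: bounded_iff intro!: exI[of _ K]\<close>)
  then have "(\<lambda>x. g x * g x) integrable_on {a..b}"
    by (rule set_lebesgue_integral_eq_integral(1))
  then show ?thesis
    by (rule integrable_spike[OF _ N(1)]) (auto simp: g_def power2_eq_square)
qed auto

section \<open>Boundary parametrizations of convex bodies\<close>

lemma half_le_sin:
  fixes t :: real
  assumes "0 \<le> t" "t \<le> 1"
  shows "t / 2 \<le> sin t"
proof (cases "t = 0")
  case False
  have "\<exists>z. 0 < z \<and> z < t \<and> sin t - sin 0 = (t - 0) * cos z"
    by (rule MVT2) (use assms False in \<open>auto intro!: derivative_eq_intros\<close>)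
  then obtain z where z: "0 < z" "z < t" "sin t = t * cos z" by auto
  have "cos (pi / 3) \<le> cos z"
    using z assms pi_gt3 by (intro cos_monotone_0_pi_le) auto
  then show ?thesis
    using mult_left_mono[of "1/2" "cos z" t] assms z(3) by (simp add: cos_60)
qed auto

text \<open>A continuous logarithm of the unit curve p + i q provides \<Theta>. The Lipschitz bound
  is local first: an increment d with |d| \<le> 1 satisfies |d| / 2 \<le> |sin d|, and sin d is a
  combination of the increments of p and q, so |d| \<le> 4 M |z - x|. Continuity makes d small on
  short steps, and such local bounds add up.\<close>

lemma lipschitz_angle_lift:
  fixes p q :: "real \<Rightarrow> real"
  assumes p: "M-lipschitz_on UNIV p" and q: "M-lipschitz_on UNIV q"
    and pq: "\<And>s. (p s)\<^sup>2 + (q s)\<^sup>2 = 1"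
  obtains \<Theta> K where "K-lipschitz_on UNIV \<Theta>"
    "\<And>s. p s = cos (\<Theta> s)" "\<And>s. q s = sin (\<Theta> s)"
proof -
  have M0: "M \<ge> 0" by (rule lipschitz_on_nonneg[OF p])
  define f where "f s = Complex (p s) (q s)" for s
  have nf: "norm (f s) = 1" for s
    by (simp add: f_def complex_norm pq)
  have f_eq: "f = (\<lambda>s. of_real (p s) + \<i> * of_real (q s))"
    by (auto simp: f_def complex_eq_iff)
  have "continuous_on UNIV f"
    unfolding f_eq using lipschitz_on_continuous_on[OF p] lipschitz_on_continuous_on[OF q]
    by (intro continuous_intros)
  moreover have "f s \<noteq> 0" for s
    using nf[of s] by auto
  ultimately obtain g where g: "continuous_on UNIV g" "\<And>s. f s = exp (g s)"
    using continuous_logarithm_on_contractible[of UNIV f] by auto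
  define \<Theta> where "\<Theta> s = Im (g s)" for s
  have "Re (g s) = 0" for s
    using nf[of s] g(2)[of s] by simp
  then have gs: "g s = \<i> * of_real (\<Theta> s)" for s
    by (simp add: complex_eq_iff \<Theta>_def)
  have cis: "f s = cis (\<Theta> s)" for s
    using g(2)[of s] gs[of s] by (simp add: cis_conv_exp)
  have ps: "p s = cos (\<Theta> s)" and qs: "q s = sin (\<Theta> s)" for s
    using arg_cong[OF cis[of s], of Re] arg_cong[OF cis[of s], of Im] by (auto simp: f_def)
  have cont: "continuous_on UNIV \<Theta>"
    unfolding \<Theta>_def using g(1) by (intro continuous_intros)
  have step: "\<bar>\<Theta> z - \<Theta> x\<bar> \<le> 4 * M * \<bar>z - x\<bar>" if "\<bar>\<Theta> z - \<Theta> x\<bar> \<le> 1" for x z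
  proof -
    define d where "d = \<Theta> z - \<Theta> x"
    have "\<bar>d\<bar> / 2 \<le> \<bar>sin d\<bar>"
      using half_le_sin[of "\<bar>d\<bar>"] that by (cases "d \<ge> 0") (auto simp: d_def[symmetric])
    moreover have "sin d = (q z - q x) * cos (\<Theta> x) - (p z - p x) * sin (\<Theta> x)"
      by (simp add: d_def sin_diff ps qs algebra_simps)
    then have "\<bar>sin d\<bar> \<le> \<bar>q z - q x\<bar> * \<bar>cos (\<Theta> x)\<bar> + \<bar>p z - p x\<bar> * \<bar>sin (\<Theta> x)\<bar>"
      by (metis abs_mult abs_triangle_ineq4)
    moreover have "\<bar>q z - q x\<bar> * \<bar>cos (\<Theta> x)\<bar> \<le> (M * \<bar>z - x\<bar>) * 1"
      using lipschitz_bounds[OF q, of z x] M0 by (intro mult_mono) auto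
    moreover have "\<bar>p z - p x\<bar> * \<bar>sin (\<Theta> x)\<bar> \<le> (M * \<bar>z - x\<bar>) * 1"
      using lipschitz_bounds[OF p, of z x] M0 by (intro mult_mono) auto
    ultimately show ?thesis by (simp add: d_def)
  qed
  have lip: "(4 * M)-lipschitz_on {a..b} \<Theta>" for a b
  proof (rule locally_lipschitz_imp_lipschitz)
    show "continuous_on {a..b} \<Theta>" using cont continuous_on_subset by blast
    fix x y :: real assume xy: "x \<in> {a..<b}" "y > x"
    have "isCont \<Theta> x" using cont by (simp add: continuous_on_eq_continuous_at)
    then obtain e where e: "e > 0" "\<And>z. dist z x < e \<Longrightarrow> dist (\<Theta> z) (\<Theta> x) < 1"
      unfolding continuous_at_eps_delta by (meson zero_less_one)
    define z where "z = min y (x + e / 2)"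
    have "x < z" "z - x < e" using e(1) xy by (auto simp: z_def min_def)
    then have "\<bar>\<Theta> z - \<Theta> x\<bar> < 1"
      using e(2)[of z] by (simp add: dist_real_def)
    then have "\<bar>\<Theta> z - \<Theta> x\<bar> \<le> 4 * M * \<bar>z - x\<bar>"
      by (intro step) simp
    then show "\<exists>z\<in>{x<..y}. dist (\<Theta> z) (\<Theta> x) \<le> 4 * M * (z - x)"
      using xy e(1) by (intro bexI[of _ z]) (auto simp: z_def dist_real_def)
  qed (use M0 in auto)
  have "(4 * M)-lipschitz_on UNIV \<Theta>"
  proof (rule lipschitz_onI)
    fix x y
    show "dist (\<Theta> x) (\<Theta> y) \<le> 4 * M * dist x y"
      by (rule lipschitz_onD[OF lip[of "min x y" "max x y"]]) auto
  qed (use M0 in auto)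
  then show thesis using ps qs that by blast
qed

lemma c11_tangent:
  assumes "c11_boundary_param \<Omega> \<gamma> L"
  obtains p q M where
    "\<And>s. (\<gamma> has_vector_derivative (p s, q s)) (at s)"
    "\<And>s. (p s)\<^sup>2 + (q s)\<^sup>2 = 1" "M-lipschitz_on UNIV p" "M-lipschitz_on UNIV q"
proof -
  define \<tau> where "\<tau> s = vector_derivative \<gamma> (at s)" for s
  obtain M where lip: "M-lipschitz_on UNIV \<tau>"
    using assms by (auto simp: c11_boundary_param_def \<tau>_def)
  have d: "(\<gamma> has_vector_derivative \<tau> s) (at s)" for s
    using assms by (simp add: c11_boundary_param_def \<tau>_def vector_derivative_works)
  have n: "norm (\<tau> s) = 1" for s
    using assms by (simp add: c11_boundary_param_def \<tau>_def)
  show thesis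
  proof (rule that[of "\<lambda>s. fst (\<tau> s)" "\<lambda>s. snd (\<tau> s)" M])
    show "(\<gamma> has_vector_derivative (fst (\<tau> s), snd (\<tau> s))) (at s)" for s
      using d by simp
    show "(fst (\<tau> s))\<^sup>2 + (snd (\<tau> s))\<^sup>2 = 1" for s
      using n[of s] by (simp add: norm_prod_def)
    show "M-lipschitz_on UNIV (\<lambda>s. fst (\<tau> s))"
      by (rule lipschitz_onI[OF _ lipschitz_on_nonneg[OF lip]])
         (meson dist_fst_le lipschitz_onD[OF lip] order_trans UNIV_I)
    show "M-lipschitz_on UNIV (\<lambda>s. snd (\<tau> s))"
      by (rule lipschitz_onI[OF _ lipschitz_on_nonneg[OF lip]])
         (meson dist_snd_le lipschitz_onD[OF lip] order_trans UNIV_I)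
  qed
qed

lemma has_vector_derivative_components:
  assumes "(\<gamma> has_vector_derivative (p, q)) (at s)"
  shows "((\<lambda>s. fst (\<gamma> s)) has_real_derivative p) (at s)"
    and "((\<lambda>s. snd (\<gamma> s)) has_real_derivative q) (at s)"
  using bounded_linear.has_vector_derivative[OF bounded_linear_fst assms]
    bounded_linear.has_vector_derivative[OF bounded_linear_snd assms]
  by (simp_all add: has_real_derivative_iff_has_vector_derivative)

section \<open>Periodic parametrizations of the frontier\<close>

lemma periodic_int:
  fixes f :: "real \<Rightarrow> 'a"
  assumes "\<And>s. f (s + L) = f s"
  shows "f (s + of_int k * L) = f s"
proof (induction k rule: int_induct[where k=0])
  case (step1 i)
  have "f (s + of_int (i + 1) * L) = f ((s + of_int i * L) + L)" by (simp add: algebra_simps)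
  then show ?case using step1 assms by simp
next
  case (step2 i)
  have "f (s + of_int (i - 1) * L) = f ((s + of_int (i - 1) * L) + L)" using assms by simp
  also have "\<dots> = f (s + of_int i * L)" by (simp add: algebra_simps)
  finally show ?case using step2 by simp
qed simp

lemma shift_into_period:
  fixes s t L :: real
  assumes "L > 0"
  obtains k :: int where "t \<le> s + of_int k * L" "s + of_int k * L < t + L"
proof
  define k where "k = \<lceil>(t - s) / L\<rceil>"
  have "(t - s) / L \<le> of_int k" "of_int k < (t - s) / L + 1"
    unfolding k_def by linarith+
  then show "t \<le> s + of_int k * L" "s + of_int k * L < t + L"
    using assms by (simp_all add: field_simps)
qed

lemma c11_range:
  assumes "c11_boundary_param \<Omega> \<gamma> L"
  shows "range \<gamma> = frontier \<Omega>"
proof -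
  have L: "L > 0" and per: "\<And>s. \<gamma> (s + L) = \<gamma> s" and im: "\<gamma> ` {0..L} = frontier \<Omega>"
    using assms by (auto simp: c11_boundary_param_def)
  have "\<gamma> s \<in> \<gamma> ` {0..L}" for s
  proof -
    obtain k where "0 \<le> s + of_int k * L" "s + of_int k * L < 0 + L"
      using shift_into_period[OF L] by metis
    then show ?thesis
      using periodic_int[of \<gamma> L s k, OF per] by (intro image_eqI[of _ _ "s + of_int k * L"]) auto
  qed
  then show ?thesis using im by blast
qed

text \<open>Both parameters are moved into the fundamental interval, where injectivity makes them
  equal; then t - s would be an integer multiple of \<open>L\<close> strictly between 0 and
  \<open>L\<close>.\<close>

lemma c11_inj:
  assumes "c11_boundary_param \<Omega> \<gamma> L" and "\<gamma> s = \<gamma> t" "s < t" "t < s + L"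
  shows False
proof -
  have L: "L > 0" and per: "\<And>s. \<gamma> (s + L) = \<gamma> s" and inj: "inj_on \<gamma> {0..<L}"
    using assms by (auto simp: c11_boundary_param_def)
  obtain k where k: "0 \<le> s + of_int k * L" "s + of_int k * L < 0 + L"
    using shift_into_period[OF L] by metis
  obtain j where j: "0 \<le> t + of_int j * L" "t + of_int j * L < 0 + L"
    using shift_into_period[OF L] by metis
  have "\<gamma> (s + of_int k * L) = \<gamma> (t + of_int j * L)"
    using assms(2) periodic_int[of \<gamma> L, OF per] by simp
  then have eq: "s + of_int k * L = t + of_int j * L"
    using inj k j by (auto simp: inj_on_def)
  then have "t - s = of_int (k - j) * L" by (simp add: algebra_simps)
  then have "0 < of_int (k - j) * L" "of_int (k - j) * L < 1 * L"
    using assms(3,4) by linarith+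
  then have "(0::real) < of_int (k - j)" "of_int (k - j) < (1::real)"
    using L zero_less_mult_pos2 mult_less_cancel_right_pos[OF L] by blast+
  then have "0 < k - j" "k - j < 1"
    using of_int_0_less_iff of_int_less_1_iff by blast+
  then show False by linarith
qed

text \<open>A supporting functional at a frontier point is minimal along the curve there, so its
  derivative vanishes and its normal is a multiple c of the rotated tangent (-q, p). The sign of c
  is that of \<open>w s z0\<close>, which is continuous in s and never zero for an interior point
  \<open>z0\<close>; this constant sign is the orientation \<sigma>.\<close>

lemma c11_support:
  assumes conv: "convex \<Omega>" and comp: "compact \<Omega>" and z0: "z0 \<in> interior \<Omega>"
    and c11: "c11_boundary_param \<Omega> \<gamma> L"
    and d: "\<And>s. (\<gamma> has_vector_derivative (p s, q s)) (at s)"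
    and pq: "\<And>s. (p s)\<^sup>2 + (q s)\<^sup>2 = 1"
    and contp: "continuous_on UNIV p" and contq: "continuous_on UNIV q"
  obtains \<sigma> where "\<sigma> \<in> {1, -1}"
    "\<And>s z. z \<in> \<Omega> \<Longrightarrow> \<sigma> * (p s * (snd z - snd (\<gamma> s)) - q s * (fst z - fst (\<gamma> s))) \<ge> 0"
proof -
  define w where "w s z = p s * (snd z - snd (\<gamma> s)) - q s * (fst z - fst (\<gamma> s))" for s and z :: pt
  have cl: "closure \<Omega> = \<Omega>" using comp by (simp add: compact_imp_closed)
  have ri: "z0 \<in> rel_interior \<Omega>" and rii: "rel_interior \<Omega> = interior \<Omega>"
    using z0 rel_interior_nonempty_interior[of \<Omega>] by auto
  have key: "\<exists>c. (\<forall>z\<in>\<Omega>. c * w s z \<ge> 0) \<and> c * w s z0 > 0" for s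
  proof -
    have fr: "range \<gamma> = frontier \<Omega>" by (rule c11_range[OF c11])
    then have "\<gamma> s \<in> closure \<Omega>" "\<gamma> s \<notin> rel_interior \<Omega>"
      by (auto simp: rii frontier_def)
    then obtain n where n: "n \<noteq> 0" "\<And>y. y \<in> closure \<Omega> \<Longrightarrow> n \<bullet> \<gamma> s \<le> n \<bullet> y"
      "\<And>y. y \<in> rel_interior \<Omega> \<Longrightarrow> n \<bullet> \<gamma> s < n \<bullet> y"
      using supporting_hyperplane_relative_frontier[OF conv] by metis
    obtain n1 n2 where nn: "n = (n1, n2)" by (cases n)
    have "((\<lambda>u. n1 * fst (\<gamma> u) + n2 * snd (\<gamma> u)) has_real_derivative (n1 * p s + n2 * q s)) (at s)"
      using has_vector_derivative_components[OF d[of s]] by (auto intro!: derivative_eq_intros)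
    moreover have "n1 * fst (\<gamma> s) + n2 * snd (\<gamma> s) \<le> n1 * fst (\<gamma> u) + n2 * snd (\<gamma> u)" for u
    proof -
      have "\<gamma> u \<in> closure \<Omega>" using fr by (auto simp: frontier_def)
      then show ?thesis using n(2)[of "\<gamma> u"] by (cases "\<gamma> s"; cases "\<gamma> u") (simp add: nn)
    qed
    ultimately have orth: "n1 * p s + n2 * q s = 0"
      using DERIV_local_min[of "\<lambda>u. n1 * fst (\<gamma> u) + n2 * snd (\<gamma> u)" _ s 1] by auto
    define c where "c = n2 * p s - n1 * q s"
    have "n1 * ((p s)\<^sup>2 + (q s)\<^sup>2) = - q s * c + p s * (n1 * p s + n2 * q s)"
         "n2 * ((p s)\<^sup>2 + (q s)\<^sup>2) = p s * c + q s * (n1 * p s + n2 * q s)"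
      by (simp_all add: c_def algebra_simps power2_eq_square)
    then have n12: "n1 = - q s * c" "n2 = p s * c" using pq orth by auto
    have nw: "n \<bullet> z - n \<bullet> \<gamma> s = c * w s z" for z
      by (cases z; cases "\<gamma> s") (simp add: nn n12 w_def algebra_simps)
    have "c * w s z \<ge> 0" if "z \<in> \<Omega>" for z
      using n(2)[of z] that nw[of z] cl by auto
    moreover have "c * w s z0 > 0"
      using n(3)[OF ri] nw[of z0] by simp
    ultimately show ?thesis by blast
  qed
  have w0: "w s z0 \<noteq> 0" for s using key[of s] by auto
  have "continuous_on UNIV \<gamma>"
    using d by (auto simp: continuous_on_eq_continuous_at intro: has_vector_derivative_continuous)
  then have "continuous_on UNIV (\<lambda>s. w s z0)"
    unfolding w_def using contp contq by (intro continuous_intros)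
  then have conn: "connected ((\<lambda>s. w s z0) ` UNIV)"
    by (rule connected_continuous_image) simp
  have same: "w s z0 > 0 \<longleftrightarrow> w t z0 > 0" for s t
  proof (rule ccontr)
    assume "\<not> ?thesis"
    then have "\<exists>s t. w s z0 < 0 \<and> w t z0 > 0"
      using w0 by (metis linorder_neqE_linordered_idom)
    then obtain s t where "w s z0 < 0" "w t z0 > 0" by blast
    then have "0 \<in> (\<lambda>s. w s z0) ` UNIV"
      using connectedD_interval[OF conn, of "w s z0" "w t z0" 0] by auto
    then show False using w0 by auto
  qed
  define \<sigma> :: real where "\<sigma> = (if w 0 z0 > 0 then 1 else -1)"
  have "\<sigma> * w s z \<ge> 0" if "z \<in> \<Omega>" for s z
  proof -
    obtain c where c: "\<forall>z\<in>\<Omega>. c * w s z \<ge> 0" "c * w s z0 > 0" using key by blast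
    have "\<sigma> * w s z0 > 0"
      using same[of 0 s] w0[of s] by (auto simp: \<sigma>_def)
    then have "\<sigma> * c > 0"
      using c(2) by (auto simp: zero_less_mult_iff)
    moreover have "c * w s z \<ge> 0" using c that by blast
    ultimately show ?thesis
      by (auto simp: zero_less_mult_iff zero_le_mult_iff)
  qed
  then show thesis using that[of \<sigma>] by (auto simp: w_def \<sigma>_def)
qed

text \<open>For \<sigma> = 1 the body lies to the left of the tangent, for \<sigma> = -1 to the
  right. In the second case \<Theta> is the tangent angle of the mirror image in the x-axis, so that
  \<Theta> increases for both orientations.\<close>

lemma tangent_angle:
  assumes conv: "convex \<Omega>" and comp: "compact \<Omega>" and ne: "interior \<Omega> \<noteq> {}"
    and c11: "c11_boundary_param \<Omega> \<gamma> L"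
  obtains \<Theta> \<sigma> K where "\<sigma> \<in> {1, -1 :: real}" "K-lipschitz_on UNIV \<Theta>" "mono \<Theta>"
    "\<And>s. \<Theta> (s + L) = \<Theta> s + 2 * pi"
    "\<And>s. (\<gamma> has_vector_derivative (cos (\<Theta> s), \<sigma> * sin (\<Theta> s))) (at s)"
    "\<And>s z. z \<in> \<Omega> \<Longrightarrow>
       \<sigma> * cos (\<Theta> s) * (snd z - snd (\<gamma> s)) - sin (\<Theta> s) * (fst z - fst (\<gamma> s)) \<ge> 0"
proof -
  have L: "L > 0" and per: "\<And>s. \<gamma> (s + L) = \<gamma> s"
    using c11 by (auto simp: c11_boundary_param_def)
  obtain p q M where d: "\<And>s. (\<gamma> has_vector_derivative (p s, q s)) (at s)"
    and pq: "\<And>s. (p s)\<^sup>2 + (q s)\<^sup>2 = 1"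
    and lp: "M-lipschitz_on UNIV p" and lq: "M-lipschitz_on UNIV q"
    using c11_tangent[OF c11] by metis
  obtain z0 where z0: "z0 \<in> interior \<Omega>" using ne by blast
  obtain \<sigma> where \<sigma>: "\<sigma> \<in> {1, -1::real}"
    and sup0: "\<And>s z. z \<in> \<Omega> \<Longrightarrow> \<sigma> * (p s * (snd z - snd (\<gamma> s)) - q s * (fst z - fst (\<gamma> s))) \<ge> 0"
    using c11_support[OF conv comp z0 c11 d pq lipschitz_on_continuous_on[OF lp]
        lipschitz_on_continuous_on[OF lq]] by metis
  have \<sigma>2: "\<sigma> * \<sigma> = 1" using \<sigma> by auto
  have lq': "M-lipschitz_on UNIV (\<lambda>s. \<sigma> * q s)"
    using \<sigma> lq by auto
  have pq': "(p s)\<^sup>2 + (\<sigma> * q s)\<^sup>2 = 1" for s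
    using pq[of s] \<sigma> by auto
  obtain \<Theta> K where lip: "K-lipschitz_on UNIV \<Theta>"
    and pc: "\<And>s. p s = cos (\<Theta> s)" and qs': "\<And>s. \<sigma> * q s = sin (\<Theta> s)"
    using lipschitz_angle_lift[OF lp lq' pq'] by metis
  have qs: "q s = \<sigma> * sin (\<Theta> s)" for s
    using qs'[of s, symmetric] \<sigma> by auto
  have dg: "(\<gamma> has_vector_derivative (cos (\<Theta> s), \<sigma> * sin (\<Theta> s))) (at s)" for s
    using d[of s] by (simp add: pc qs)
  define X where "X s = fst (\<gamma> s)" for s
  define Y where "Y s = snd (\<gamma> s)" for s
  have dX: "(X has_real_derivative cos (\<Theta> s)) (at s)" for s
    unfolding X_def by (rule has_vector_derivative_components(1)[OF dg])
  have dY: "(Y has_real_derivative \<sigma> * sin (\<Theta> s)) (at s)" for s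
    unfolding Y_def by (rule has_vector_derivative_components(2)[OF dg])
  have sup: "\<sigma> * cos (\<Theta> s) * (snd z - Y s) - sin (\<Theta> s) * (fst z - X s) \<ge> 0" if "z \<in> \<Omega>" for s z
  proof -
    have "\<sigma> * (p s * (snd z - Y s) - q s * (fst z - X s)) =
      \<sigma> * cos (\<Theta> s) * (snd z - Y s) - (\<sigma> * \<sigma>) * sin (\<Theta> s) * (fst z - X s)"
      by (simp add: pc qs algebra_simps)
    then show ?thesis using sup0[OF that, of s] by (simp add: \<sigma>2 X_def Y_def)
  qed
  have "\<gamma> u \<in> \<Omega>" for u
    using c11_range[OF c11] comp by (metis compact_imp_closed frontier_subset_closed rangeI subsetD)
  then have supg: "\<sigma> * cos (\<Theta> s) * (Y u - Y s) - sin (\<Theta> s) * (X u - X s) \<ge> 0" for s u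
    using sup[of "\<gamma> u" s] by (simp add: X_def Y_def)
  have contT: "continuous_on A \<Theta>" for A
    using lipschitz_on_continuous_on[OF lip] continuous_on_subset by blast
  obtain N where N: "negligible N"
    "\<And>x. x \<notin> N \<Longrightarrow> (\<Theta> has_real_derivative deriv \<Theta> x) (at x)"
    "\<And>a b. a \<le> b \<Longrightarrow> (deriv \<Theta> has_integral (\<Theta> b - \<Theta> a)) {a..b}"
    using lipschitz_ae_derivative[OF lip] by metis
  have nonneg: "deriv \<Theta> s \<ge> 0" if s: "s \<notin> N" for s
  proof (rule ccontr)
    assume "\<not> deriv \<Theta> s \<ge> 0"
    then obtain d1 where d1: "d1 > 0" "\<And>h. 0 < h \<Longrightarrow> h < d1 \<Longrightarrow> \<Theta> (s + h) < \<Theta> s"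
      using DERIV_neg_dec_right[OF N(2)[OF s]] by auto
    have "isCont \<Theta> s" using contT[of UNIV] by (simp add: continuous_on_eq_continuous_at)
    then obtain d2 where d2: "d2 > 0" "\<And>z. dist z s < d2 \<Longrightarrow> dist (\<Theta> z) (\<Theta> s) < pi"
      unfolding continuous_at_eps_delta by (meson pi_gt_zero)
    define h where "h = min d1 d2 / 2"
    have h: "0 < h" "h < d1" "h < d2" using d1 d2 by (auto simp: h_def)
    \<comment> \<open>\<open>W\<close> is the signed distance from the tangent line at
      \<open>s\<close>, with derivative sin (\<Theta> u - \<Theta> s). A decrease of \<Theta> right
      after \<open>s\<close> would carry the curve to the wrong side.\<close>
    define W where "W u = \<sigma> * cos (\<Theta> s) * (Y u - Y s) - sin (\<Theta> s) * (X u - X s)" for u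
    have "(W has_real_derivative sin (\<Theta> u - \<Theta> s)) (at u)" for u
    proof -
      have "(W has_real_derivative (\<sigma> * cos (\<Theta> s) * (\<sigma> * sin (\<Theta> u)) - sin (\<Theta> s) * cos (\<Theta> u))) (at u)"
        unfolding W_def by (auto intro!: derivative_eq_intros dX dY)
      moreover have "\<sigma> * cos (\<Theta> s) * (\<sigma> * sin (\<Theta> u)) = (\<sigma> * \<sigma>) * cos (\<Theta> s) * sin (\<Theta> u)"
        by (simp add: mult_ac)
      ultimately show ?thesis by (simp add: \<sigma>2 sin_diff mult.commute)
    qed
    then obtain z where z: "s < z" "z < s + h" "W (s + h) - W s = (s + h - s) * sin (\<Theta> z - \<Theta> s)"
      using MVT2[of s "s + h" W "\<lambda>u. sin (\<Theta> u - \<Theta> s)"] h by auto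
    have "\<Theta> z < \<Theta> s" using d1(2)[of "z - s"] z h by simp
    moreover have "\<bar>\<Theta> z - \<Theta> s\<bar> < pi" using d2(2)[of z] z h by (simp add: dist_real_def)
    ultimately have "sin (\<Theta> s - \<Theta> z) > 0"
      by (intro sin_gt_zero) auto
    then have "sin (\<Theta> z - \<Theta> s) < 0"
      using sin_minus[of "\<Theta> s - \<Theta> z"] by simp
    then have "W (s + h) < 0"
      using z h by (simp add: W_def mult_pos_neg)
    then show False using supg[of s "s + h"] by (simp add: W_def)
  qed
  have mono: "mono \<Theta>"
  proof (rule monoI)
    fix a b :: real assume ab: "a \<le> b"
    have "((\<lambda>s. if s \<in> N then 0 else deriv \<Theta> s) has_integral (\<Theta> b - \<Theta> a)) {a..b}"
      by (rule has_integral_spike[OF N(1) _ N(3)[OF ab]]) auto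
    then have "0 \<le> \<Theta> b - \<Theta> a"
      by (rule has_integral_nonneg) (use nonneg in auto)
    then show "\<Theta> a \<le> \<Theta> b" by simp
  qed
  have perX: "X (s + L) = X s" "Y (s + L) = Y s" for s by (simp_all add: X_def Y_def per)
  have cosp: "cos (\<Theta> (s + L)) = cos (\<Theta> s)" for s
  proof (rule DERIV_unique)
    show "(X has_real_derivative cos (\<Theta> (s + L))) (at s)"
      using dX[of "s + L"] by (simp add: DERIV_shift perX)
  qed (rule dX)
  have "\<sigma> * sin (\<Theta> (s + L)) = \<sigma> * sin (\<Theta> s)" for s
  proof (rule DERIV_unique)
    show "(Y has_real_derivative \<sigma> * sin (\<Theta> (s + L))) (at s)"
      using dY[of "s + L"] by (simp add: DERIV_shift perX)
  qed (rule dY)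
  then have sinp: "sin (\<Theta> (s + L)) = sin (\<Theta> s)" for s using \<sigma> by auto
  \<comment> \<open>After one period the tangent recurs, so \<open>D\<close> takes values in the
    multiples of 2 pi; being continuous it is constant.\<close>
  define D where "D s = \<Theta> (s + L) - \<Theta> s" for s
  have "cos (D s) = 1" for s
    by (simp add: D_def cos_diff cosp sinp flip: power2_eq_square)
  then have "\<forall>s. \<exists>k::int. D s = of_int k * (2 * pi)"
    by (simp add: cos_one_2pi_int mult.assoc)
  then obtain n :: "real \<Rightarrow> int" where n: "\<And>s. D s = of_int (n s) * (2 * pi)"
    by metis
  have "D constant_on UNIV"
  proof (rule continuous_discrete_range_constant)
    show "continuous_on UNIV D"
      unfolding D_def by (intro continuous_intros continuous_on_compose2[OF contT]) auto
    fix x :: real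
    have "2 * pi \<le> norm (D y - D x)" if "D y \<noteq> D x" for y
    proof -
      have "n y \<noteq> n x" using that n by auto
      then have "1 \<le> \<bar>n y - n x\<bar>" by linarith
      then have "1 \<le> \<bar>real_of_int (n y - n x)\<bar>" by linarith
      then have "1 * (2 * pi) \<le> \<bar>real_of_int (n y - n x)\<bar> * (2 * pi)"
        by (intro mult_right_mono) auto
      also have "\<dots> = norm (D y - D x)"
        by (simp add: n abs_mult flip: left_diff_distrib)
      finally show ?thesis by simp
    qed
    then show "\<exists>e>0. \<forall>y. y \<in> UNIV \<and> D y \<noteq> D x \<longrightarrow> e \<le> norm (D y - D x)"
      by (intro exI[of _ "2 * pi"]) auto
  qed auto
  then obtain D0 where "\<And>s. D s = D0" by (auto simp: constant_on_def)
  then obtain m where m: "\<And>s. D s = of_int m * (2 * pi)"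
    using n by metis
  have "\<Theta> 0 \<le> \<Theta> L" using mono L by (simp add: monoD)
  then have "of_int m * (2 * pi) \<ge> 0" using m[of 0] unfolding D_def add_0 by linarith
  then have "real_of_int m \<ge> 0" using pi_gt_zero by (simp add: zero_le_mult_iff)
  then have m0: "m \<ge> 0" by simp
  have "m \<noteq> 0"
  proof
    assume "m = 0"
    then have eq: "\<Theta> L = \<Theta> 0" using m[of 0] by (simp add: D_def)
    have const: "\<Theta> z = \<Theta> 0" if "0 < z" "z < L" for z
      using monoD[OF mono, of 0 z] monoD[OF mono, of z L] that eq by simp
    obtain z where z: "0 < z" "z < L" "X L - X 0 = (L - 0) * cos (\<Theta> z)"
      using MVT2[of 0 L X "\<lambda>u. cos (\<Theta> u)"] L dX by auto
    obtain y where y: "0 < y" "y < L" "Y L - Y 0 = (L - 0) * (\<sigma> * sin (\<Theta> y))"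
      using MVT2[of 0 L Y "\<lambda>u. \<sigma> * sin (\<Theta> u)"] L dY by auto
    have "cos (\<Theta> 0) = 0" using z const[of z] L perX[of 0] by simp
    moreover have "sin (\<Theta> 0) = 0" using y const[of y] L perX[of 0] \<sigma> by auto
    ultimately show False using sin_cos_squared_add[of "\<Theta> 0"] by simp
  qed
  \<comment> \<open>The support line at a boundary point farthest from the origin meets the body only there,
    which excludes a second full turn.\<close>
  moreover have "m < 2"
  proof (rule ccontr)
    assume "\<not> m < 2"
    then have m2: "(2::real) \<le> of_int m" by linarith
    define f where "f s = (X s)\<^sup>2 + (Y s)\<^sup>2" for s
    have df: "(f has_real_derivative (2 * (X s * cos (\<Theta> s) + \<sigma> * Y s * sin (\<Theta> s)))) (at s)" for s
      unfolding f_def by (auto intro!: derivative_eq_intros dX dY simp: algebra_simps)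
    have "continuous_on {0..L} f"
      by (rule DERIV_continuous_on[OF has_field_derivative_at_within[OF df]])
    then obtain sp where sp: "\<And>s. s \<in> {0..L} \<Longrightarrow> f s \<le> f sp"
      using continuous_attains_sup[of "{0..L}" f] L
      by (metis atLeastAtMost_iff compact_Icc empty_iff less_eq_real_def)
    have perf: "f (s + L) = f s" for s by (simp add: f_def perX)
    have max: "f s \<le> f sp" for s
    proof -
      obtain k where k: "0 \<le> s + of_int k * L" "s + of_int k * L < 0 + L"
        using shift_into_period[OF L] by metis
      then show ?thesis
        using sp[of "s + of_int k * L"] periodic_int[of f L s k, OF perf] by simp
    qed
    have crit: "X sp * cos (\<Theta> sp) + \<sigma> * Y sp * sin (\<Theta> sp) = 0"
      using DERIV_local_max[OF df[of sp], of 1] max by auto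
    have "of_int m * (2 * pi) \<ge> 2 * (2 * pi)" using m2 by (intro mult_right_mono) auto
    then have "\<Theta> sp + 2 * pi \<le> \<Theta> (sp + L)"
      using m[of sp] pi_gt_zero unfolding D_def by linarith
    then obtain t where t: "sp \<le> t" "t \<le> sp + L" "\<Theta> t = \<Theta> sp + 2 * pi"
      using IVT'[of \<Theta> sp "\<Theta> sp + 2 * pi" "sp + L"] contT L by auto
    have "t \<noteq> sp" using t(3) by auto
    moreover have "t \<noteq> sp + L"
      using t(3) m[of sp] \<open>of_int m * (2 * pi) \<ge> 2 * (2 * pi)\<close> pi_gt_zero unfolding D_def by auto
    ultimately have t': "sp < t" "t < sp + L" using t by auto
    define dx where "dx = X t - X sp"
    define dy where "dy = Y t - Y sp"
    \<comment> \<open>The support lines at \<open>sp\<close> and \<open>t\<close> are parallel with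
      the body on the same side, so the two inequalities are opposite and the chord lies along the
      tangent.\<close>
    have "\<sigma> * cos (\<Theta> sp) * dy - sin (\<Theta> sp) * dx \<ge> 0"
      using supg[of sp t] by (simp add: dx_def dy_def)
    moreover have "cos (\<Theta> t) = cos (\<Theta> sp)" "sin (\<Theta> t) = sin (\<Theta> sp)"
      by (simp_all add: t(3))
    then have "- (\<sigma> * cos (\<Theta> sp) * dy - sin (\<Theta> sp) * dx) \<ge> 0"
      using supg[of t sp] by (simp add: dx_def dy_def algebra_simps)
    ultimately have par: "\<sigma> * cos (\<Theta> sp) * dy = sin (\<Theta> sp) * dx" by linarith
    define r where "r = dx * cos (\<Theta> sp) + \<sigma> * dy * sin (\<Theta> sp)"
    have "r * cos (\<Theta> sp) = dx * (cos (\<Theta> sp))\<^sup>2 + (\<sigma> * cos (\<Theta> sp) * dy) * sin (\<Theta> sp)"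
      by (simp add: r_def algebra_simps power2_eq_square)
    also have "\<dots> = dx * ((cos (\<Theta> sp))\<^sup>2 + (sin (\<Theta> sp))\<^sup>2)"
      unfolding par by algebra
    finally have rx: "dx = r * cos (\<Theta> sp)" by (simp only: sin_cos_squared_add2 mult_1_right)
    have "r * (\<sigma> * sin (\<Theta> sp)) = \<sigma> * cos (\<Theta> sp) * (sin (\<Theta> sp) * dx) + (\<sigma> * \<sigma>) * dy * (sin (\<Theta> sp))\<^sup>2"
      by (simp add: r_def algebra_simps power2_eq_square)
    also have "\<dots> = (\<sigma> * \<sigma>) * dy * ((cos (\<Theta> sp))\<^sup>2 + (sin (\<Theta> sp))\<^sup>2)"
      unfolding par[symmetric] by algebra
    finally have ry: "dy = r * (\<sigma> * sin (\<Theta> sp))"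
      by (simp only: sin_cos_squared_add2 \<sigma>2 mult_1_right mult_1_left)
    \<comment> \<open>\<open>crit\<close> makes the tangent orthogonal to the position vector at
      \<open>sp\<close>, so Pythagoras puts the point at \<open>t\<close> farther from the origin
      unless the chord vanishes.\<close>
    have "X sp * dx + Y sp * dy = r * (X sp * cos (\<Theta> sp) + \<sigma> * Y sp * sin (\<Theta> sp))"
      by (simp add: rx ry algebra_simps)
    then have "X sp * dx + Y sp * dy = 0" by (simp add: crit)
    moreover have "f t = f sp + 2 * (X sp * dx + Y sp * dy) + (dx\<^sup>2 + dy\<^sup>2)"
      by (simp add: f_def dx_def dy_def power2_eq_square algebra_simps)
    ultimately have "dx\<^sup>2 + dy\<^sup>2 \<le> 0" using max[of t] by simp
    then have "dx = 0" "dy = 0" by (simp_all add: sum_power2_le_zero_iff)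
    then have "\<gamma> sp = \<gamma> t" by (simp add: dx_def dy_def X_def Y_def prod_eq_iff)
    then show False using c11_inj[OF c11 _ t'] by blast
  qed
  ultimately have "m = 1" using m0 by linarith
  then have "\<Theta> (s + L) = \<Theta> s + 2 * pi" for s using m[of s] by (simp add: D_def)
  then show thesis
    using that[OF \<sigma> lip mono _ dg] sup by (simp add: X_def Y_def)
qed

text \<open>Where \<Theta> is differentiable, the second derivative of the curve is
  \<open>deriv \<Theta>\<close> times a unit normal; the remaining parameters form a null
  set.\<close>

lemma elastic_energy_angle:
  assumes lip: "K-lipschitz_on UNIV \<Theta>" and \<sigma>: "\<sigma> \<in> {1, -1 :: real}"
    and dg: "\<And>s. (\<gamma> has_vector_derivative (cos (\<Theta> s), \<sigma> * sin (\<Theta> s))) (at s)"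
  shows "elastic_energy \<gamma> L = 1/2 * integral {0..L} (\<lambda>s. (deriv \<Theta> s)\<^sup>2)"
proof -
  have \<tau>: "(\<lambda>t. vector_derivative \<gamma> (at t)) = (\<lambda>t. (cos (\<Theta> t), \<sigma> * sin (\<Theta> t)))"
    using dg by (auto intro: vector_derivative_at)
  obtain N where N: "negligible N"
    "\<And>x. x \<notin> N \<Longrightarrow> (\<Theta> has_real_derivative deriv \<Theta> x) (at x)"
    using lipschitz_ae_derivative[OF lip] by metis
  have "integral {0..L} (\<lambda>s. (norm (vector_derivative (\<lambda>t. vector_derivative \<gamma> (at t)) (at s)))\<^sup>2)
      = integral {0..L} (\<lambda>s. (deriv \<Theta> s)\<^sup>2)"
  proof (rule integral_spike[OF N(1)])
    fix s assume "s \<in> {0..L} - N"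
    then have d: "(\<Theta> has_real_derivative deriv \<Theta> s) (at s)" using N(2) by blast
    have "((\<lambda>t. cos (\<Theta> t)) has_real_derivative - sin (\<Theta> s) * deriv \<Theta> s) (at s)"
      "((\<lambda>t. \<sigma> * sin (\<Theta> t)) has_real_derivative \<sigma> * (cos (\<Theta> s) * deriv \<Theta> s)) (at s)"
      by (auto intro!: derivative_eq_intros d)
    then have "((\<lambda>t. (cos (\<Theta> t), \<sigma> * sin (\<Theta> t))) has_vector_derivative
        (- sin (\<Theta> s) * deriv \<Theta> s, \<sigma> * (cos (\<Theta> s) * deriv \<Theta> s))) (at s)"
      by (intro has_vector_derivative_Pair) (simp_all add: has_real_derivative_iff_has_vector_derivative)
    then have "vector_derivative (\<lambda>t. vector_derivative \<gamma> (at t)) (at s) =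
        (- sin (\<Theta> s) * deriv \<Theta> s, \<sigma> * (cos (\<Theta> s) * deriv \<Theta> s))"
      unfolding \<tau> by (rule vector_derivative_at)
    then have "(norm (vector_derivative (\<lambda>t. vector_derivative \<gamma> (at t)) (at s)))\<^sup>2 =
        (sin (\<Theta> s))\<^sup>2 * (deriv \<Theta> s)\<^sup>2 + \<sigma>\<^sup>2 * ((cos (\<Theta> s))\<^sup>2 * (deriv \<Theta> s)\<^sup>2)"
      by (simp add: norm_prod_def power_mult_distrib)
    also have "\<dots> = (deriv \<Theta> s)\<^sup>2 * ((sin (\<Theta> s))\<^sup>2 + (cos (\<Theta> s))\<^sup>2)"
      using \<sigma> by (auto simp: distrib_left mult.commute simp del: sin_cos_squared_add)
    finally show "(deriv \<Theta> s)\<^sup>2 = (norm (vector_derivative (\<lambda>t. vector_derivative \<gamma> (at t)) (at s)))\<^sup>2"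
      by simp
  qed
  then show ?thesis by (simp add: elastic_energy_def)
qed

section \<open>The one-variable inequality\<close>

lemma a_const_pos: "a_const > 0"
proof -
  have "integral {0..pi/2} (\<lambda>t. cos t) \<le> a_const"
    unfolding a_const_def
  proof (rule integral_le)
    fix t :: real assume "t \<in> {0..pi/2}"
    then have c: "0 \<le> cos t" by (intro cos_ge_zero) auto
    then have "(cos t)\<^sup>2 \<le> cos t * 1"
      unfolding power2_eq_square by (intro mult_left_mono) auto
    then show "cos t \<le> sqrt (cos t)" by (simp add: real_le_rsqrt)
  qed (auto intro!: integrable_continuous_interval continuous_intros)
  moreover have "(cos has_integral (sin (pi/2) - sin 0)) {0..pi/2}"
    by (rule fundamental_theorem_of_calculus)
       (auto intro!: derivative_eq_intros simp flip: has_real_derivative_iff_has_vector_derivative)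
  ultimately show ?thesis by (simp add: integral_unique)
qed

text \<open>The split at \<open>pi/3\<close> and the weights \<open>10/11\<close>, \<open>1/2\<close> keep the two AM--GM bounds
  \<open>2 * sqrt x \<le> x / w + w\<close> just sharp enough; the true values are about \<open>1.1981\<close> and \<open>1.2220\<close>.\<close>
lemma a_const_upper: "a_const \<le> 2 * pi / (pi + 2)"
proof -
  have cont: "(\<lambda>t. sqrt (cos t)) integrable_on {u..v}" for u v
    by (intro integrable_continuous_interval continuous_intros)
  have bound: "integral {u..v} (\<lambda>t. sqrt (cos t)) \<le> ((sin v - sin u) / w + w * (v - u)) / 2"
    if uv: "u \<le> v" "0 \<le> u" "v \<le> pi/2" and w: "w > 0" for u v w
  proof -
    have "(cos has_integral (sin v - sin u)) {u..v}"
      by (rule fundamental_theorem_of_calculus)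
         (auto intro!: derivative_eq_intros uv simp flip: has_real_derivative_iff_has_vector_derivative)
    then have int: "((\<lambda>t. (cos t / w + w) / 2) has_integral ((sin v - sin u) / w + (v - u) * w) / 2) {u..v}"
      using has_integral_const_real[of w u v] uv(1)
      by (intro has_integral_divide has_integral_add) auto
    have le: "sqrt (cos t) \<le> (cos t / w + w) / 2" if "t \<in> {u..v}" for t
    proof -
      have c: "0 \<le> cos t" using that uv by (intro cos_ge_zero) auto
      have "0 \<le> (sqrt (cos t) - w)\<^sup>2 / w" using w by simp
      also have "\<dots> = cos t / w + w - 2 * sqrt (cos t)"
        unfolding power2_diff using w c by (simp add: field_simps power2_eq_square)
      finally show ?thesis by simp
    qed
    show ?thesis
      using has_integral_le[OF integrable_integral[OF cont] int le] by (simp add: mult.commute)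
  qed
  have "a_const = integral {0..pi/3} (\<lambda>t. sqrt (cos t)) + integral {pi/3..pi/2} (\<lambda>t. sqrt (cos t))"
    unfolding a_const_def by (rule Henstock_Kurzweil_Integration.integral_combine[symmetric]) (auto intro: cont)
  also have "\<dots> \<le> (sqrt 3 / 2 / (10/11) + 10/11 * (pi/3)) / 2 + ((1 - sqrt 3 / 2) / (1/2) + 1/2 * (pi/2 - pi/3)) / 2"
    using bound[of 0 "pi/3" "10/11"] bound[of "pi/3" "pi/2" "1/2"]
    by (intro add_mono) (simp_all add: sin_60)
  also have "\<dots> = 1 - (9/40) * sqrt 3 + pi * (17/88)"
    by (simp add: field_simps)
  also have "\<dots> \<le> 1 - (9/40) * 1.732 + pi * (17/88)"
    using real_le_rsqrt[of "1.732" 3] by (simp add: power2_eq_square)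
  also have "\<dots> \<le> 1 - (9/40) * 1.732 + 3.142 * (17/88)"
    using pi_approx by simp
  \<comment> \<open>In the form 2 - 4 / (pi + 2) the target is visibly increasing in pi, so the
    lower bound 3.141 may replace pi.\<close>
  also have "\<dots> \<le> 2 - 4 / (3.141 + 2)" by simp
  also have "\<dots> \<le> 2 - 4 / (pi + 2)"
    using pi_approx by (intro diff_left_mono divide_left_mono) auto
  also have "\<dots> = 2 * pi / (pi + 2)"
  proof -
    have "pi + 2 \<noteq> 0" using pi_gt_zero by linarith
    then show ?thesis by (simp add: field_simps)
  qed
  finally show ?thesis .
qed

text \<open>With the absolute value the integrand is nonnegative and pi-periodic, so one primitive,
  differentiable everywhere, serves the arcs up to a half-turn as well as the full turn of the
  extremal body.\<close>

definition sqrt_cos_int :: "real \<Rightarrow> real" where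
  "sqrt_cos_int = signed_integral (\<lambda>t. sqrt \<bar>cos t\<bar>)"

lemma sqrt_cos_int:
  shows "sqrt_cos_int 0 = 0" "(sqrt_cos_int has_real_derivative sqrt \<bar>cos t\<bar>) (at t)"
  unfolding sqrt_cos_int_def by (auto intro!: continuous_signed_integral continuous_intros)

lemma sqrt_cos_int_minus: "sqrt_cos_int (- t) = - sqrt_cos_int t"
proof -
  have "((\<lambda>t. sqrt_cos_int t + sqrt_cos_int (- t)) has_real_derivative 0) (at t)" for t
  proof -
    have "((\<lambda>t. sqrt_cos_int (- t)) has_real_derivative sqrt \<bar>cos (- t)\<bar> * (- 1)) (at t)"
      by (rule DERIV_chain2[where f=sqrt_cos_int and g=uminus, OF sqrt_cos_int(2)])
         (auto intro!: derivative_eq_intros)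
    then show ?thesis
      using DERIV_add[OF sqrt_cos_int(2)[of t]] by fastforce
  qed
  then have "sqrt_cos_int t + sqrt_cos_int (- t) = sqrt_cos_int 0 + sqrt_cos_int (- 0)"
    by (rule DERIV_isconst_all[rule_format])
  then show ?thesis by (simp add: sqrt_cos_int)
qed

lemma sqrt_cos_int_half_pi: "sqrt_cos_int (pi/2) = a_const"
proof -
  have "((\<lambda>t. sqrt \<bar>cos t\<bar>) has_integral sqrt_cos_int (pi/2)) {0..pi/2}"
    using antiderivative_diff[OF sqrt_cos_int(2), of 0 "pi/2"] by (simp add: sqrt_cos_int)
  moreover have "sqrt \<bar>cos t\<bar> = sqrt (cos t)" if "t \<in> {0..pi/2}" for t
    using that by (simp add: cos_ge_zero)
  ultimately show ?thesis
    unfolding a_const_def by (metis (mono_tags, lifting) Henstock_Kurzweil_Integration.integral_cong integral_unique)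
qed

text \<open>In the variable \<open>u = sqrt (cos \<beta>)\<close> the derivative of the difference is the concave quadratic
  \<open>2 a u - a\<^sup>2 u\<^sup>2 - 2 a\<^sup>2 / \<pi>\<close>, which is nonnegative at \<open>u = 1\<close> by the bound on \<open>a\<close>. So the difference
  first increases and then decreases, and it vanishes at both ends.\<close>
lemma arc_function_bound:
  assumes \<beta>: "0 \<le> \<beta>" "\<beta> \<le> pi/2"
  shows "2 * a_const * sqrt_cos_int \<beta> - a_const\<^sup>2 * sin \<beta> \<ge> 2 * a_const\<^sup>2 / pi * \<beta>"
proof -
  define a where "a = a_const"
  have a0: "a > 0" using a_const_pos by (simp add: a_def)
  define c where "c = 2 * a\<^sup>2 / pi"
  define k where "k b = 2 * a * sqrt_cos_int b - a\<^sup>2 * sin b - c * b" for b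
  define P where "P u = 2 * a * u - a\<^sup>2 * u\<^sup>2" for u
  define v where "v b = sqrt \<bar>cos b\<bar>" for b
  have v2: "(v b)\<^sup>2 = cos b" if "0 \<le> b" "b \<le> pi/2" for b
    using that by (simp add: v_def cos_ge_zero)
  have dk: "(k has_real_derivative (2 * a * sqrt \<bar>cos b\<bar> - a\<^sup>2 * cos b - c)) (at b)" for b
    unfolding k_def by (auto intro!: derivative_eq_intros sqrt_cos_int(2))
  have dk': "(k has_real_derivative (P (v b) - c)) (at b)" if "0 \<le> b" "b \<le> pi/2" for b
    using dk[of b] v2[OF that] by (simp add: P_def v_def)
  have k0: "k 0 = 0" by (simp add: k_def sqrt_cos_int)
  have k1: "k (pi/2) = 0"
    by (simp add: k_def sqrt_cos_int_half_pi a_def c_def power2_eq_square)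
  \<comment> \<open>This is the condition \<open>P 1 \<ge> c\<close>, that is 2 a - a^2 \<ge> 2 a^2
    / pi, divided by a / pi: the origin of the bound required of \<open>a_const\<close>.\<close>
  have "a * (pi + 2) \<le> 2 * pi"
    using a_const_upper pi_gt_zero by (simp add: a_def pos_le_divide_eq add_pos_pos)
  then have "a * (a * (pi + 2)) \<le> a * (2 * pi)" using a0 by (intro mult_left_mono) auto
  then have P1: "P 1 \<ge> c"
    by (simp add: P_def c_def field_simps power2_eq_square)
  have mono: "P y \<ge> c" if xy: "x \<le> y" "y \<le> 1" and Px: "P x \<ge> c" for x y
  proof (cases "y = 1 \<or> x = 1")
    case True then show ?thesis using P1 Px xy by auto
  next
    case False
    then have x1: "x < 1" "y < 1" using xy by auto
    \<comment> \<open>The weight of \<open>x\<close> when \<open>y\<close> is written as a convex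
      combination of \<open>x\<close> and 1; concavity of \<open>P\<close> then keeps its value
      above \<open>c\<close>.\<close>
    define l where "l = (1 - y) / (1 - x)"
    have l: "0 \<le> l" "l \<le> 1" using x1 xy by (auto simp: l_def field_simps)
    have "l * (1 - x) = 1 - y" using x1 by (simp add: l_def)
    then have y: "y = l * x + (1 - l)" by (simp add: algebra_simps)
    have "P y - (l * P x + (1 - l) * P 1) = a\<^sup>2 * (l * (1 - l) * (1 - x)\<^sup>2)"
      unfolding y P_def by (simp add: algebra_simps power2_eq_square)
    moreover have "\<dots> \<ge> 0" using l by simp
    moreover have "l * P x + (1 - l) * P 1 \<ge> l * c + (1 - l) * c"
      using l P1 Px by (intro add_mono mult_left_mono) auto
    ultimately show ?thesis by (simp add: algebra_simps)
  qed
  have v_le1: "v b \<le> 1" for b by (simp add: v_def)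
  have v_anti: "v y \<le> v x" if "0 \<le> x" "x \<le> y" "y \<le> pi/2" for x y
  proof -
    have "cos y \<le> cos x" using that by (intro cos_monotone_0_pi_le) auto
    moreover have "0 \<le> cos y" using that by (intro cos_ge_zero) auto
    ultimately show ?thesis by (simp add: v_def)
  qed
  have "k \<beta> \<ge> 0"
  proof (cases "P (v \<beta>) \<ge> c")
    case True
    have "k 0 \<le> k \<beta>"
    proof (rule DERIV_nonneg_imp_nondecreasing[OF \<beta>(1)])
      fix x assume x: "0 \<le> x" "x \<le> \<beta>"
      then show "\<exists>y. DERIV k x :> y \<and> 0 \<le> y"
        using dk'[of x] mono[OF v_anti[of x \<beta>] v_le1 True] \<beta> by (intro exI[of _ "P (v x) - c"]) auto
    qed
    then show ?thesis using k0 by simp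
  next
    case False
    have "k (pi/2) \<le> k \<beta>"
    proof (rule DERIV_nonpos_imp_nonincreasing[OF \<beta>(2)])
      fix x assume x: "\<beta> \<le> x" "x \<le> pi/2"
      have "\<not> P (v x) \<ge> c"
        using mono[OF v_anti[of \<beta> x] v_le1] x \<beta> False by auto
      then show "\<exists>y. DERIV k x :> y \<and> y \<le> 0"
        using dk'[of x] x \<beta> by (intro exI[of _ "P (v x) - c"]) auto
    qed
    then show ?thesis using k1 by simp
  qed
  then show ?thesis by (simp add: k_def a_def c_def)
qed

text \<open>The disk enters through \<open>r\<close> and \<open>chord\<close>, which says how far
  the curve advances in the middle direction. A bound linear in \<Theta> t - \<Theta> s lets
  consecutive arcs be added.\<close>

lemma arc_energy:
  fixes \<Theta> :: "real \<Rightarrow> real"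
  assumes lip: "K-lipschitz_on UNIV \<Theta>" and mono: "mono \<Theta>" and st: "s \<le> t"
    and gap: "\<Theta> t - \<Theta> s \<le> pi" and r: "r > 0"
    and chord: "((\<lambda>u. cos (\<Theta> u - (\<Theta> s + \<Theta> t) / 2)) has_integral 2 * r * sin ((\<Theta> t - \<Theta> s) / 2)) {s..t}"
  shows "integral {s..t} (\<lambda>u. (deriv \<Theta> u)\<^sup>2) \<ge> 2 / r * (a_const\<^sup>2 / pi * (\<Theta> t - \<Theta> s))"
proof -
  define a where "a = a_const"
  define m where "m = (\<Theta> s + \<Theta> t) / 2"
  define \<beta> where "\<beta> = (\<Theta> t - \<Theta> s) / 2"
  have \<beta>: "0 \<le> \<beta>" "\<beta> \<le> pi/2" using monoD[OF mono st] gap by (auto simp: \<beta>_def)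
  have dQ: "((\<lambda>x. sqrt_cos_int (x - m)) has_real_derivative sqrt \<bar>cos (x - m)\<bar>) (at x)" for x
    using DERIV_shift[of sqrt_cos_int _ x "- m"] sqrt_cos_int(2)[of "x - m"] by simp
  have "((\<lambda>u. sqrt \<bar>cos (\<Theta> u - m)\<bar> * deriv \<Theta> u) has_integral
      (sqrt_cos_int (\<Theta> t - m) - sqrt_cos_int (\<Theta> s - m))) {s..t}"
    by (rule has_integral_lipschitz_chain[OF lip dQ _ st, of 1]) simp
  moreover have "\<Theta> t - m = \<beta>" "\<Theta> s - m = - \<beta>" by (simp_all add: m_def \<beta>_def field_simps)
  ultimately have I1: "((\<lambda>u. sqrt \<bar>cos (\<Theta> u - m)\<bar> * deriv \<Theta> u) has_integral 2 * sqrt_cos_int \<beta>) {s..t}"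
    by (simp add: sqrt_cos_int_minus)
  have I2: "((\<lambda>u. cos (\<Theta> u - m)) has_integral 2 * r * sin \<beta>) {s..t}"
    using chord by (simp add: m_def \<beta>_def)
  have I3: "((\<lambda>u. 2 * a / r * (sqrt \<bar>cos (\<Theta> u - m)\<bar> * deriv \<Theta> u) - (a / r)\<^sup>2 * cos (\<Theta> u - m))
     has_integral (2 * a / r * (2 * sqrt_cos_int \<beta>) - (a / r)\<^sup>2 * (2 * r * sin \<beta>))) {s..t}"
    by (intro has_integral_diff has_integral_mult_right I1 I2)
  have "2 * a / r * (2 * sqrt_cos_int \<beta>) - (a / r)\<^sup>2 * (2 * r * sin \<beta>) =
      2 / r * (2 * a * sqrt_cos_int \<beta> - a\<^sup>2 * sin \<beta>)"
    using r by (simp add: field_simps power2_eq_square)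
  moreover have "2 / r * (2 * a * sqrt_cos_int \<beta> - a\<^sup>2 * sin \<beta>) \<ge> 2 / r * (2 * a\<^sup>2 / pi * \<beta>)"
    using arc_function_bound[OF \<beta>] r by (intro mult_left_mono) (auto simp: a_def)
  moreover have "2 / r * (2 * a\<^sup>2 / pi * \<beta>) = 2 / r * (a\<^sup>2 / pi * (\<Theta> t - \<Theta> s))"
    by (simp add: \<beta>_def)
  moreover have "2 * a / r * (2 * sqrt_cos_int \<beta>) - (a / r)\<^sup>2 * (2 * r * sin \<beta>)
      \<le> integral {s..t} (\<lambda>u. (deriv \<Theta> u)\<^sup>2)"
  proof (rule has_integral_le[OF I3 integrable_integral])
    show "(\<lambda>u. (deriv \<Theta> u)\<^sup>2) integrable_on {s..t}"
      by (rule lipschitz_deriv_square_integrable[OF lip])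
    fix u assume u: "u \<in> {s..t}"
    then have "\<bar>\<Theta> u - m\<bar> \<le> \<beta>"
      using monoD[OF mono, of s u] monoD[OF mono, of u t] by (auto simp: m_def \<beta>_def abs_le_iff field_simps)
    then have c: "cos (\<Theta> u - m) \<ge> 0" using \<beta> by (intro cos_ge_zero) auto
    have "0 \<le> (deriv \<Theta> u - a / r * sqrt \<bar>cos (\<Theta> u - m)\<bar>)\<^sup>2" by simp
    also have "\<dots> = (deriv \<Theta> u)\<^sup>2 - 2 * a / r * (sqrt \<bar>cos (\<Theta> u - m)\<bar> * deriv \<Theta> u)
        + (a / r)\<^sup>2 * (sqrt \<bar>cos (\<Theta> u - m)\<bar>)\<^sup>2"
      by (simp add: power2_diff power_mult_distrib power_divide mult_ac)
    finally show "2 * a / r * (sqrt \<bar>cos (\<Theta> u - m)\<bar> * deriv \<Theta> u) - (a / r)\<^sup>2 * cos (\<Theta> u - m)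
        \<le> (deriv \<Theta> u)\<^sup>2"
      using c by simp
  qed
  ultimately show ?thesis unfolding a_def by linarith
qed

text \<open>Greedy choice: starting from any \<open>s1\<close> in \<open>T\<close>, the next point
  is the last one of \<open>T\<close> up to \<open>s1 + L\<close> that keeps the turning at most pi.
  If the closing arc still turned by more than pi, the second step could not have advanced, and
  \<open>T\<close> would leave a gap of more than pi, contradicting \<open>half\<close>. The points
  may coincide.\<close>

lemma three_points:
  fixes \<Theta> :: "real \<Rightarrow> real"
  assumes L: "L > 0" and mono: "mono \<Theta>" and cont: "continuous_on UNIV \<Theta>"
    and per: "\<And>s. \<Theta> (s + L) = \<Theta> s + 2 * pi"
    and T: "closed T" "\<And>s. s \<in> T \<longleftrightarrow> s + L \<in> T"
    and half: "\<And>\<alpha>. \<exists>s\<in>T. cos (\<Theta> s - \<alpha>) \<le> 0"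
  obtains s1 s2 s3 where "s1 \<in> T" "s2 \<in> T" "s3 \<in> T" "s1 \<le> s2" "s2 \<le> s3" "s3 \<le> s1 + L"
    "\<Theta> s2 - \<Theta> s1 \<le> pi" "\<Theta> s3 - \<Theta> s2 \<le> pi" "\<Theta> (s1 + L) - \<Theta> s3 \<le> pi"
proof -
  have pi0: "pi > 0" by simp
  have perk: "(s + of_int k * L \<in> T) = (s \<in> T)" for s k
    using periodic_int[of "\<lambda>s. s \<in> T" L] T(2) by blast
  have compA: "compact (T \<inter> {u..v} \<inter> {s. \<Theta> s \<le> c})" "compact (T \<inter> {u..v} \<inter> {s. c \<le> \<Theta> s})" for u v c
  proof -
    have "closed (T \<inter> {s. \<Theta> s \<le> c})" "closed (T \<inter> {s. c \<le> \<Theta> s})"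
      using T(1) cont by (auto intro!: closed_Collect_le continuous_intros)
    then have "compact ({u..v} \<inter> (T \<inter> {s. \<Theta> s \<le> c}))" "compact ({u..v} \<inter> (T \<inter> {s. c \<le> \<Theta> s}))"
      by (auto intro: compact_Int_closed)
    then show "compact (T \<inter> {u..v} \<inter> {s. \<Theta> s \<le> c})" "compact (T \<inter> {u..v} \<inter> {s. c \<le> \<Theta> s})"
      by (simp_all add: Int_ac)
  qed
  obtain s1 where s1: "s1 \<in> T" using half by blast
  define A2 where "A2 = T \<inter> {s1..s1 + L} \<inter> {s. \<Theta> s \<le> \<Theta> s1 + pi}"
  have "s1 \<in> A2" using s1 L by (auto simp: A2_def)
  then obtain s2 where s2: "s2 \<in> A2" "\<And>s. s \<in> A2 \<Longrightarrow> s \<le> s2"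
    using compact_attains_sup[of A2] compA(1) by (metis A2_def empty_iff)
  define A3 where "A3 = T \<inter> {s1..s1 + L} \<inter> {s. \<Theta> s \<le> \<Theta> s2 + pi}"
  have "s2 \<in> A3" using s2(1) by (auto simp: A2_def A3_def)
  then obtain s3 where s3: "s3 \<in> A3" "\<And>s. s \<in> A3 \<Longrightarrow> s \<le> s3"
    using compact_attains_sup[of A3] compA(1) by (metis A3_def empty_iff)
  have s23: "s2 \<le> s3" using s3(2) \<open>s2 \<in> A3\<close> by blast
  have s2': "s2 \<in> T" "s1 \<le> s2" "s2 \<le> s1 + L" "\<Theta> s2 \<le> \<Theta> s1 + pi" using s2(1) by (auto simp: A2_def)
  have s3': "s3 \<in> T" "s3 \<le> s1 + L" "\<Theta> s3 \<le> \<Theta> s2 + pi" using s3(1) by (auto simp: A3_def)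
  have "\<Theta> (s1 + L) - \<Theta> s3 \<le> pi"
  proof (rule ccontr)
    assume "\<not> ?thesis"
    then have lt: "\<Theta> s3 < \<Theta> s1 + pi" by (simp add: per)
    then have "s3 \<in> A2" using s3' s23 s2' by (auto simp: A2_def)
    then have "s3 = s2" using s2(2) s23 by force
    define B where "B = T \<inter> {s2..s1 + L} \<inter> {s. \<Theta> s2 + pi \<le> \<Theta> s}"
    have "s1 + L \<in> B"
      using s1 T(2) s2' lt \<open>s3 = s2\<close> pi0 unfolding B_def by (auto simp: per)
    then obtain s4 where s4: "s4 \<in> B" "\<And>s. s \<in> B \<Longrightarrow> s4 \<le> s"
      using compact_attains_inf[of B] compA(2) by (metis B_def empty_iff)
    have s4': "s4 \<in> T" "s2 \<le> s4" "s4 \<le> s1 + L" "\<Theta> s2 + pi \<le> \<Theta> s4" using s4(1) by (auto simp: B_def)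
    have "s4 \<notin> A3"
    proof
      assume "s4 \<in> A3"
      then have "s4 = s2" using s3(2) \<open>s3 = s2\<close> s4' by force
      then show False using s4' pi0 by simp
    qed
    then have s4gt: "\<Theta> s4 > \<Theta> s2 + pi"
      using s4' s2' by (auto simp: A3_def)
    have s4le: "\<Theta> s4 \<le> \<Theta> s2 + 2 * pi"
      using monoD[OF mono s4'(3)] monoD[OF mono s2'(2)] by (simp add: per)
    \<comment> \<open>Modulo 2 pi, the angles of \<open>T\<close> lie between \<Theta> s4 and
      \<Theta> s2 + 2 pi, an interval shorter than pi; relative to its midpoint \<alpha> all cosines
      are positive.\<close>
    define \<alpha> where "\<alpha> = (\<Theta> s4 + \<Theta> s2 + 2 * pi) / 2"
    have pos: "cos (x - \<alpha>) > 0" if "\<Theta> s4 \<le> x" "x \<le> \<Theta> s2 + 2 * pi" for x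
      using that s4gt by (intro cos_gt_zero_pi) (auto simp: \<alpha>_def field_simps)
    obtain s where s: "s \<in> T" "cos (\<Theta> s - \<alpha>) \<le> 0" using half by blast
    obtain k where k: "s2 \<le> s + of_int k * L" "s + of_int k * L < s2 + L"
      using shift_into_period[OF L] by metis
    define s' where "s' = s + of_int k * L"
    have "cos (\<Theta> (u + L) - \<alpha>) = cos (\<Theta> u - \<alpha>)" for u
    proof -
      have "\<Theta> (u + L) - \<alpha> = (\<Theta> u - \<alpha>) + 2 * pi" by (simp add: per)
      then show ?thesis by (simp only: cos_periodic)
    qed
    then have cs': "cos (\<Theta> s' - \<alpha>) \<le> 0"
      using periodic_int[of "\<lambda>u. cos (\<Theta> u - \<alpha>)" L s k] s(2) by (simp add: s'_def)
    have s'T: "s' \<in> T" using s(1) perk by (simp add: s'_def)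
    have s'2: "s2 \<le> s'" "s' \<le> s2 + L" using k by (auto simp: s'_def)
    have up: "\<Theta> s' \<le> \<Theta> s2 + 2 * pi" using monoD[OF mono s'2(2)] by (simp add: per)
    consider "\<Theta> s' \<ge> \<Theta> s4" | "\<Theta> s' < \<Theta> s4" by linarith
    then show False
    proof cases
      case 1 then show ?thesis using pos up cs' by force
    next
      case 2
      then have "s' < s4" using monoD[OF mono, of s4 s'] by force
      then have "s' \<notin> B" using s4(2) by force
      then have "\<Theta> s' \<le> \<Theta> s2 + pi" using s'T s'2 \<open>s' < s4\<close> s4' by (auto simp: B_def)
      then have "s' \<in> A3" using s'T s'2 s2' \<open>s' < s4\<close> s4' by (auto simp: A3_def)
      \<comment> \<open>Only \<open>s2\<close> itself remains; one turn later its angle is the right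
        end of the interval around \<alpha>.\<close>
      then have "s' = s2" using s3(2) \<open>s3 = s2\<close> s'2 by force
      then have "cos (\<Theta> s' - \<alpha>) = cos (\<Theta> s2 + 2 * pi - \<alpha>)"
        using cos_periodic[of "\<Theta> s2 - \<alpha>"] by (simp add: algebra_simps)
      then show ?thesis using pos[of "\<Theta> s2 + 2 * pi"] s4le cs' by simp
    qed
  qed
  then show thesis
    using that[of s1 s2 s3] s1 s2' s3' s23 by auto
qed

section \<open>The lower bound\<close>

lemma cball_subset_of_infdist_frontier:
  fixes \<Omega> :: "pt set"
  assumes "closed \<Omega>" "c \<in> \<Omega>" "\<rho> \<le> infdist c (frontier \<Omega>)"
  shows "cball c \<rho> \<subseteq> \<Omega>"
proof (cases "\<rho> > 0")
  case True
  have "ball c \<rho> \<subseteq> \<Omega>"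
  proof (rule ccontr)
    assume "\<not> ?thesis"
    then have "ball c \<rho> - \<Omega> \<noteq> {}" by blast
    moreover have "c \<in> ball c \<rho> \<inter> \<Omega>" using True assms(2) by simp
    ultimately have "ball c \<rho> \<inter> frontier \<Omega> \<noteq> {}"
      by (intro connected_Int_frontier) blast+
    then obtain z where "dist c z < \<rho>" "z \<in> frontier \<Omega>" by auto
    then show False using infdist_le[of z "frontier \<Omega>" c] assms(3) by simp
  qed
  then have "closure (ball c \<rho>) \<subseteq> \<Omega>" using assms(1) by (rule closure_minimal)
  then show ?thesis using True by simp
next
  case False
  then show ?thesis using assms(2) by (cases "\<rho> = 0") auto
qed

lemma cball_frontier_dist:
  fixes \<Omega> :: "pt set"
  assumes "cball c \<rho> \<subseteq> \<Omega>" "z \<in> frontier \<Omega>"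
  shows "\<rho> \<le> dist c z"
proof (rule ccontr)
  assume "\<not> ?thesis"
  then have "z \<in> ball c \<rho>" by simp
  moreover have "ball c \<rho> \<subseteq> interior \<Omega>"
    using assms(1) by (intro interior_maximal) (auto simp: subset_iff)
  ultimately show False using assms(2) by (auto simp: frontier_def)
qed

text \<open>The distance to the frontier is continuous and attains its maximum on \<Omega>. A disk
  inside \<Omega> has radius at most that distance at its centre, and a disk of exactly this radius
  still fits, so the supremum is a maximum.\<close>

lemma inradius_attained:
  fixes \<Omega> :: "pt set"
  assumes comp: "compact \<Omega>" and ne: "interior \<Omega> \<noteq> {}"
  obtains c where "cball c (inradius \<Omega>) \<subseteq> \<Omega>" "inradius \<Omega> > 0"
    "\<And>c' \<rho>. cball c' \<rho> \<subseteq> \<Omega> \<Longrightarrow> \<rho> \<le> inradius \<Omega>"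
proof -
  have cl: "closed \<Omega>" using comp by (rule compact_imp_closed)
  have neO: "\<Omega> \<noteq> {}" using ne by auto
  have "\<Omega> \<noteq> UNIV" using comp not_bounded_UNIV compact_imp_bounded by blast
  then have fne: "frontier \<Omega> \<noteq> {}" using neO frontier_not_empty by blast
  obtain c where c: "c \<in> \<Omega>" "\<And>x. x \<in> \<Omega> \<Longrightarrow> infdist x (frontier \<Omega>) \<le> infdist c (frontier \<Omega>)"
    using continuous_attains_sup[OF comp neO continuous_on_infdist[OF continuous_on_id]] by blast
  define R where "R = infdist c (frontier \<Omega>)"
  have sub: "cball c R \<subseteq> \<Omega>"
    by (rule cball_subset_of_infdist_frontier[OF cl c(1)]) (simp add: R_def)
  have R0: "R \<ge> 0" by (simp add: R_def infdist_nonneg)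
  have max: "\<rho> \<le> R" if "cball c' \<rho> \<subseteq> \<Omega>" for c' \<rho>
  proof (cases "\<rho> \<ge> 0")
    case True
    then have "c' \<in> \<Omega>" using that by auto
    have "\<rho> \<le> infdist c' (frontier \<Omega>)"
      unfolding infdist_def using fne cball_frontier_dist[OF that] by (auto intro: cINF_greatest)
    also have "\<dots> \<le> R" unfolding R_def by (rule c(2)[OF \<open>c' \<in> \<Omega>\<close>])
    finally show ?thesis .
  qed (use R0 in auto)
  have R: "inradius \<Omega> = R"
    unfolding inradius_def
  proof (rule cSup_eq_maximum)
    show "R \<in> {r. 0 \<le> r \<and> (\<exists>c. cball c r \<subseteq> \<Omega>)}" using sub R0 by blast
  qed (use max in blast)
  obtain x e where "e > 0" "cball x e \<subseteq> \<Omega>"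
    using ne by (metis ex_in_conv mem_interior_cball)
  then have "R > 0" using max by fastforce
  then show thesis using that[of c] sub max by (simp add: R)
qed

text \<open>If every contact point lay strictly on one side, moving the centre slightly away from them
  would give a larger disk.\<close>
lemma contact_point_in_halfplane:
  fixes \<Omega> :: "pt set"
  assumes comp: "compact \<Omega>" and r: "r > 0" and sub: "cball c r \<subseteq> \<Omega>"
    and max: "\<And>c' \<rho>. cball c' \<rho> \<subseteq> \<Omega> \<Longrightarrow> \<rho> \<le> r"
  obtains z where "z \<in> frontier \<Omega>" "dist c z = r" "(z - c) \<bullet> v \<le> 0"
proof -
  have cl: "closed \<Omega>" using comp by (rule compact_imp_closed)
  have neO: "\<Omega> \<noteq> {}" using sub r by auto
  have "\<Omega> \<noteq> UNIV" using comp not_bounded_UNIV compact_imp_bounded by blast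
  then have fne: "frontier \<Omega> \<noteq> {}" using neO frontier_not_empty by blast
  have fcomp: "compact (frontier \<Omega>)" using comp by (rule compact_frontier)
  \<comment> \<open>The factor \<open>r / (1 + norm v)\<close> keeps the shifted centre
    \<open>C n\<close> inside the disk, hence inside \<Omega>.\<close>
  define \<epsilon> where "\<epsilon> n = r / (1 + norm v) / real (Suc n)" for n
  have \<epsilon>: "\<epsilon> n > 0" "\<epsilon> n * norm v \<le> r" for n
  proof -
    have p: "1 + norm v > 0" by (simp add: add_pos_nonneg)
    then show "\<epsilon> n > 0" using r by (simp add: \<epsilon>_def)
    have "\<epsilon> n \<le> r / (1 + norm v) / 1"
      unfolding \<epsilon>_def using r p by (intro divide_left_mono) auto
    then have "\<epsilon> n * norm v \<le> r / (1 + norm v) * (1 + norm v)"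
      using r p \<open>\<epsilon> n > 0\<close> by (intro mult_mono) auto
    then show "\<epsilon> n * norm v \<le> r" using p by simp
  qed
  define C where "C n = c - \<epsilon> n *\<^sub>R v" for n
  have "\<exists>z\<in>frontier \<Omega>. dist (C n) z \<le> r" for n
  proof -
    have "C n \<in> cball c r" using \<epsilon>[of n] by (simp add: C_def dist_norm abs_of_pos)
    then have "C n \<in> \<Omega>" using sub by blast
    then have "infdist (C n) (frontier \<Omega>) \<le> r"
      using max cball_subset_of_infdist_frontier[OF cl] by blast
    moreover obtain z where "z \<in> frontier \<Omega>" "infdist (C n) (frontier \<Omega>) = dist (C n) z"
      using infdist_attains_inf[OF frontier_closed fne] by metis
    ultimately show ?thesis by metis
  qed
  then obtain Z where Z: "\<And>n. Z n \<in> frontier \<Omega>" "\<And>n. dist (C n) (Z n) \<le> r" by metis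
  \<comment> \<open>\<open>Z n\<close> has distance at least r from c but at most r from the shifted
    centre; comparing squares gives the sign. A limit point of \<open>Z\<close> keeps the sign and
    has distance exactly r.\<close>
  have half: "(Z n - c) \<bullet> v \<le> 0" for n
  proof -
    have "r \<le> norm (Z n - c)"
      using cball_frontier_dist[OF sub Z(1)[of n]] by (simp add: dist_norm norm_minus_commute)
    then have "r\<^sup>2 \<le> (norm (Z n - c))\<^sup>2" using r by (intro power_mono) auto
    moreover have "norm (Z n - c + \<epsilon> n *\<^sub>R v) \<le> r"
      using Z(2)[of n] by (simp add: C_def dist_norm norm_minus_commute algebra_simps)
    then have "(norm (Z n - c + \<epsilon> n *\<^sub>R v))\<^sup>2 \<le> r\<^sup>2" by (intro power_mono) auto
    moreover have "(norm (w + e *\<^sub>R v))\<^sup>2 = (norm w)\<^sup>2 + (2 * e * (w \<bullet> v) + e\<^sup>2 * (v \<bullet> v))" for w e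
      unfolding power2_norm_eq_inner
      by (simp add: inner_add_left inner_add_right inner_commute[of v w] power2_eq_square algebra_simps)
    ultimately have "2 * \<epsilon> n * ((Z n - c) \<bullet> v) + (\<epsilon> n)\<^sup>2 * (v \<bullet> v) \<le> 0"
      by simp
    moreover have "(\<epsilon> n)\<^sup>2 * (v \<bullet> v) \<ge> 0" by simp
    ultimately have "2 * \<epsilon> n * ((Z n - c) \<bullet> v) \<le> 0" by linarith
    then show ?thesis using \<epsilon>(1)[of n] by (simp add: mult_le_0_iff)
  qed
  obtain z f where z: "z \<in> frontier \<Omega>" "strict_mono f" "(Z \<circ> f) \<longlonglongrightarrow> z"
    using fcomp Z(1) unfolding compact_def by metis
  have "\<epsilon> \<longlonglongrightarrow> 0"
    unfolding \<epsilon>_def by (intro real_tendsto_divide_at_top[OF tendsto_const]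
      filterlim_compose[OF filterlim_real_sequentially filterlim_Suc])
  then have "C \<longlonglongrightarrow> c - 0 *\<^sub>R v"
    unfolding C_def by (intro tendsto_intros)
  then have "(C \<circ> f) \<longlonglongrightarrow> c" using LIMSEQ_subseq_LIMSEQ[OF _ z(2)] by simp
  then have "(\<lambda>n. dist ((C \<circ> f) n) ((Z \<circ> f) n)) \<longlonglongrightarrow> dist c z"
    using z(3) by (intro tendsto_dist)
  then have "dist c z \<le> r"
    by (rule LIMSEQ_le_const2) (use Z(2) in auto)
  moreover have "r \<le> dist c z" by (rule cball_frontier_dist[OF sub z(1)])
  moreover have "(\<lambda>n. ((Z \<circ> f) n - c) \<bullet> v) \<longlonglongrightarrow> (z - c) \<bullet> v"
    using z(3) by (intro tendsto_intros)
  then have "(z - c) \<bullet> v \<le> 0"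
    by (rule LIMSEQ_le_const2) (use half in auto)
  ultimately show thesis using that[OF z(1)] by linarith
qed

lemma energy_inradius_lower_bound:
  assumes K: "classK \<Omega>" and c11: "c11_boundary_param \<Omega> \<gamma> L"
  shows "elastic_energy \<gamma> L * inradius \<Omega> \<ge> 2 * a_const\<^sup>2"
proof -
  have comp: "compact \<Omega>" and conv: "convex \<Omega>" and ne: "interior \<Omega> \<noteq> {}"
    using K by (auto simp: classK_def)
  have L: "L > 0" and perg: "\<And>s. \<gamma> (s + L) = \<gamma> s"
    using c11 by (auto simp: c11_boundary_param_def)
  obtain \<Theta> \<sigma> K where \<sigma>: "\<sigma> \<in> {1, -1 :: real}" and lip: "K-lipschitz_on UNIV \<Theta>" and mono: "mono \<Theta>"
    and per: "\<And>s. \<Theta> (s + L) = \<Theta> s + 2 * pi"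
    and dg: "\<And>s. (\<gamma> has_vector_derivative (cos (\<Theta> s), \<sigma> * sin (\<Theta> s))) (at s)"
    and sup: "\<And>s z. z \<in> \<Omega> \<Longrightarrow>
       \<sigma> * cos (\<Theta> s) * (snd z - snd (\<gamma> s)) - sin (\<Theta> s) * (fst z - fst (\<gamma> s)) \<ge> 0"
    using tangent_angle[OF conv comp ne c11] by metis
  have \<sigma>2: "\<sigma> * \<sigma> = 1" using \<sigma> by auto
  define r where "r = inradius \<Omega>"
  obtain c where sub: "cball c r \<subseteq> \<Omega>" and r: "r > 0"
    and max: "\<And>c' \<rho>. cball c' \<rho> \<subseteq> \<Omega> \<Longrightarrow> \<rho> \<le> r"
    using inradius_attained[OF comp ne] by (metis r_def)
  have rng: "range \<gamma> = frontier \<Omega>" by (rule c11_range[OF c11])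
  define X where "X s = fst (\<gamma> s)" for s
  define Y where "Y s = snd (\<gamma> s)" for s
  have dX: "(X has_real_derivative cos (\<Theta> s)) (at s)" for s
    unfolding X_def by (rule has_vector_derivative_components(1)[OF dg])
  have dY: "(Y has_real_derivative \<sigma> * sin (\<Theta> s)) (at s)" for s
    unfolding Y_def by (rule has_vector_derivative_components(2)[OF dg])
  define T where "T = {s. dist c (\<gamma> s) = r}"
  have contg: "continuous_on UNIV \<gamma>"
    using dg by (auto simp: continuous_on_eq_continuous_at intro: has_vector_derivative_continuous)
  have T_closed: "closed T"
    unfolding T_def using contg by (intro closed_Collect_eq continuous_intros)
  \<comment> \<open>At a contact the distance from c is minimal along the frontier, so the radius is
    orthogonal to the tangent; the support inequality for c selects the outward normal (sin
    \<Theta>, -\<sigma> cos \<Theta>).\<close>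
  have contact: "X s - fst c = r * sin (\<Theta> s) \<and> Y s - snd c = - (r * (\<sigma> * cos (\<Theta> s)))" if s: "s \<in> T" for s
  proof -
    define dx where "dx = X s - fst c"
    define dy where "dy = Y s - snd c"
    define f where "f u = (X u - fst c)\<^sup>2 + (Y u - snd c)\<^sup>2" for u
    have fd: "f u = (dist c (\<gamma> u))\<^sup>2" for u
      by (simp add: f_def X_def Y_def dist_prod_def dist_real_def power2_commute)
    have fs: "f s = r\<^sup>2" using s by (simp add: fd T_def)
    have "r\<^sup>2 \<le> (dist c (\<gamma> u))\<^sup>2" for u
      using cball_frontier_dist[OF sub, of "\<gamma> u"] rng r by (intro power_mono) auto
    then have "f s \<le> f u" for u by (simp add: fs fd[of u])
    moreover have "(f has_real_derivative (2 * (dx * cos (\<Theta> s) + \<sigma> * dy * sin (\<Theta> s)))) (at s)"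
      unfolding f_def dx_def dy_def by (auto intro!: derivative_eq_intros dX dY simp: algebra_simps)
    ultimately have "2 * (dx * cos (\<Theta> s) + \<sigma> * dy * sin (\<Theta> s)) = 0"
      using DERIV_local_min[of f _ s 1] zero_less_one by blast
    then have crit: "dx * cos (\<Theta> s) + \<sigma> * dy * sin (\<Theta> s) = 0" by simp
    define w where "w = sin (\<Theta> s) * dx - \<sigma> * cos (\<Theta> s) * dy"
    have "c \<in> \<Omega>" using sub r by auto
    then have w0: "w \<ge> 0" using sup[of c s] by (simp add: w_def dx_def dy_def X_def Y_def algebra_simps)
    have cs: "(sin (\<Theta> s))\<^sup>2 + (cos (\<Theta> s))\<^sup>2 = 1" by simp
    have "dx = w * sin (\<Theta> s) + (dx * cos (\<Theta> s) + \<sigma> * dy * sin (\<Theta> s)) * cos (\<Theta> s)"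
      unfolding w_def using cs by algebra
    then have dxw: "dx = w * sin (\<Theta> s)" by (simp add: crit)
    have "dy = - (w * (\<sigma> * cos (\<Theta> s))) + (dx * cos (\<Theta> s) + \<sigma> * dy * sin (\<Theta> s)) * (\<sigma> * sin (\<Theta> s))"
      unfolding w_def using cs \<sigma>2 by algebra
    then have dyw: "dy = - (w * (\<sigma> * cos (\<Theta> s)))" by (simp add: crit)
    have "dx\<^sup>2 + dy\<^sup>2 = w\<^sup>2" unfolding dxw dyw using cs \<sigma>2 by algebra
    then have "w\<^sup>2 = r\<^sup>2" using fs by (simp add: f_def dx_def dy_def)
    then have "w = r" using w0 r by (simp add: power2_eq_iff)
    then show ?thesis using dxw dyw by (simp add: dx_def dy_def)
  qed
  have half: "\<exists>s\<in>T. cos (\<Theta> s - \<alpha>) \<le> 0" for \<alpha>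
  proof -
    \<comment> \<open>The test vector is the outward normal belonging to tangent angle \<alpha>, so
      its product with the radius is r cos (\<Theta> s - \<alpha>).\<close>
    obtain z where z: "z \<in> frontier \<Omega>" "dist c z = r" "(z - c) \<bullet> (sin \<alpha>, - \<sigma> * cos \<alpha>) \<le> 0"
      by (rule contact_point_in_halfplane[OF comp r sub, where v="(sin \<alpha>, - \<sigma> * cos \<alpha>)"])
         (use max in blast)+
    then obtain s where s: "z = \<gamma> s" using rng by blast
    have sT: "s \<in> T" using z s by (simp add: T_def)
    have "(z - c) \<bullet> (sin \<alpha>, - \<sigma> * cos \<alpha>) = (X s - fst c) * sin \<alpha> + (Y s - snd c) * (- \<sigma> * cos \<alpha>)"
      by (simp add: inner_prod_def s X_def Y_def)
    also have "\<dots> = r * cos (\<Theta> s - \<alpha>)"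
      using contact[OF sT] \<sigma>2 unfolding cos_diff by algebra
    finally have "cos (\<Theta> s - \<alpha>) \<le> 0" using z(3) r by (simp add: mult_le_0_iff)
    then show ?thesis using sT by blast
  qed
  have T_per: "s \<in> T \<longleftrightarrow> s + L \<in> T" for s by (simp add: T_def perg)
  define f where "f s = (deriv \<Theta> s)\<^sup>2" for s
  have f_int: "f integrable_on {u..v}" for u v
    unfolding f_def by (rule lipschitz_deriv_square_integrable[OF lip])
  have arc: "integral {s..t} f \<ge> 2 / r * (a_const\<^sup>2 / pi * (\<Theta> t - \<Theta> s))"
    if st: "s \<in> T" "t \<in> T" "s \<le> t" "\<Theta> t - \<Theta> s \<le> pi" for s t
    unfolding f_def
  proof (rule arc_energy[OF lip mono st(3,4) r])
    define m where "m = (\<Theta> s + \<Theta> t) / 2"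
    \<comment> \<open>\<open>F\<close> is the coordinate of the curve in the direction of tangent
      angle m; its increment is fixed because both end points lie at distance r from c along known
      normals.\<close>
    define F where "F u = cos m * X u + \<sigma> * sin m * Y u" for u
    have "(F has_real_derivative cos (\<Theta> u - m)) (at u)" for u
    proof -
      have "(F has_real_derivative (cos m * cos (\<Theta> u) + \<sigma> * sin m * (\<sigma> * sin (\<Theta> u)))) (at u)"
        unfolding F_def by (auto intro!: derivative_eq_intros dX dY)
      moreover have "cos m * cos (\<Theta> u) + \<sigma> * sin m * (\<sigma> * sin (\<Theta> u)) = cos (\<Theta> u - m)"
        unfolding cos_diff using \<sigma>2 by algebra
      ultimately show ?thesis by simp
    qed
    then have "((\<lambda>u. cos (\<Theta> u - m)) has_integral (F t - F s)) {s..t}"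
      by (rule antiderivative_diff) (rule st(3))
    moreover have "F t - F s = r * (sin (\<Theta> t - m) - sin (\<Theta> s - m))"
    proof -
      have "F t - F s = cos m * ((X t - fst c) - (X s - fst c)) + \<sigma> * sin m * ((Y t - snd c) - (Y s - snd c))"
        by (simp add: F_def algebra_simps)
      also have "\<dots> = cos m * (r * sin (\<Theta> t) - r * sin (\<Theta> s))
          + \<sigma> * sin m * (- (r * (\<sigma> * cos (\<Theta> t))) - - (r * (\<sigma> * cos (\<Theta> s))))"
        using contact[OF st(1)] contact[OF st(2)] by simp
      also have "\<dots> = r * (sin (\<Theta> t - m) - sin (\<Theta> s - m))"
        unfolding sin_diff using \<sigma>2 by algebra
      finally show ?thesis .
    qed
    moreover have "\<Theta> t - m = (\<Theta> t - \<Theta> s) / 2" "\<Theta> s - m = - ((\<Theta> t - \<Theta> s) / 2)"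
      by (simp_all add: m_def field_simps)
    then have "r * (sin (\<Theta> t - m) - sin (\<Theta> s - m)) = 2 * r * sin ((\<Theta> t - \<Theta> s) / 2)"
      by (simp only: sin_minus) (simp add: mult.assoc)
    ultimately show "((\<lambda>u. cos (\<Theta> u - (\<Theta> s + \<Theta> t) / 2)) has_integral
        2 * r * sin ((\<Theta> t - \<Theta> s) / 2)) {s..t}"
      unfolding m_def[symmetric] by metis
  qed
  obtain s1 s2 s3 where S: "s1 \<in> T" "s2 \<in> T" "s3 \<in> T" "s1 \<le> s2" "s2 \<le> s3" "s3 \<le> s1 + L"
    "\<Theta> s2 - \<Theta> s1 \<le> pi" "\<Theta> s3 - \<Theta> s2 \<le> pi" "\<Theta> (s1 + L) - \<Theta> s3 \<le> pi"
    using three_points[OF L mono lipschitz_on_continuous_on[OF lip] per T_closed T_per half] by metis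
  define P where "P = signed_integral f"
  have Pint: "integral {a..b} f = P b - P a" if "a \<le> b" for a b
    unfolding P_def by (rule integral_unique[OF has_integral_signed_integral[OF f_int that]])
  \<comment> \<open>The arcs cover \<open>{s1..s1 + L}\<close> while the energy is taken over
    \<open>{0..L}\<close>; periodicity of the integrand reconciles the two.\<close>
  have "deriv \<Theta> (s + L) = deriv \<Theta> s" for s
  proof -
    have "((\<lambda>x. \<Theta> x + 2 * pi) has_real_derivative D) (at s) \<longleftrightarrow> (\<Theta> has_real_derivative D) (at s)" for D
      using DERIV_add[of \<Theta> D s UNIV "\<lambda>_. 2 * pi" 0] DERIV_diff[of "\<lambda>x. \<Theta> x + 2 * pi" D s UNIV "\<lambda>_. 2 * pi" 0]
      by auto
    then show ?thesis by (simp add: deriv_def DERIV_shift per)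
  qed
  then have "P (s1 + L) - P s1 = P L - P 0"
    using signed_integral_periodic[OF f_int, of L s1] by (simp add: f_def P_def)
  moreover have "P (s1 + L) - P s1 \<ge> 2 / r * (a_const\<^sup>2 / pi * (\<Theta> (s1 + L) - \<Theta> s1))"
  proof -
    have "s1 + L \<in> T" using S(1) T_per by blast
    then have "P s2 - P s1 \<ge> 2 / r * (a_const\<^sup>2 / pi * (\<Theta> s2 - \<Theta> s1))"
      "P s3 - P s2 \<ge> 2 / r * (a_const\<^sup>2 / pi * (\<Theta> s3 - \<Theta> s2))"
      "P (s1 + L) - P s3 \<ge> 2 / r * (a_const\<^sup>2 / pi * (\<Theta> (s1 + L) - \<Theta> s3))"
      using arc[of s1 s2] arc[of s2 s3] arc[of s3 "s1 + L"] S Pint by auto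
    then show ?thesis unfolding right_diff_distrib by linarith
  qed
  moreover have "elastic_energy \<gamma> L = 1/2 * (P L - P 0)"
    unfolding elastic_energy_angle[OF lip \<sigma> dg] using Pint[of 0 L] L by (simp add: f_def[abs_def])
  ultimately have "elastic_energy \<gamma> L \<ge> 1/2 * (2 / r * (a_const\<^sup>2 / pi * (2 * pi)))"
    by (simp add: per)
  then have "elastic_energy \<gamma> L \<ge> 2 * a_const\<^sup>2 / r" by simp
  then show ?thesis using r by (simp add: r_def[symmetric] pos_divide_le_eq)
qed

section \<open>The differential equation for the tangent angle\<close>

text \<open>ds/d\<theta> for the equation \<theta>' = a sqrt (sin \<theta>), extended to a
  pi-periodic function on the line. At multiples of pi division by zero yields 0, although nearby
  values are unbounded.\<close>

definition inv_speed :: "real \<Rightarrow> real" where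
  "inv_speed t = 1 / (a_const * sqrt \<bar>sin t\<bar>)"

definition arclen :: "real \<Rightarrow> real" where
  "arclen = signed_integral inv_speed"

lemma inv_speed_periodic: "inv_speed (t + pi) = inv_speed t"
  by (simp add: inv_speed_def)

lemma inv_speed_even: "inv_speed (- t) = inv_speed t"
  by (simp add: inv_speed_def)

lemma inv_speed_nonneg: "inv_speed t \<ge> 0"
  using a_const_pos by (simp add: inv_speed_def)

lemma inv_speed_isCont: "sin t \<noteq> 0 \<Longrightarrow> isCont inv_speed t"
  unfolding inv_speed_def using a_const_pos by (auto intro!: continuous_intros)

lemma negligible_sin_zero: "negligible {t::real. sin t = 0}"
proof -
  have "{t::real. sin t = 0} = range (\<lambda>i::int. of_int i * pi)"
    by (auto simp: sin_zero_iff_int2)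
  then show ?thesis
    using negligible_countable_Union[of "(\<lambda>i::int. {of_int i * pi}) ` UNIV"]
    by (auto simp: UNION_singleton_eq_range)
qed

text \<open>By \<open>half_le_sin\<close> the singularity at 0 is of order t powr (-1/2), hence
  integrable. Evenness and pi-periodicity carry integrability from \<open>{0..pi/2}\<close> to one
  period and then to every interval.\<close>

lemma inv_speed_integrable: "inv_speed integrable_on {a..b}"
proof -
  have a0: "a_const > 0" by (rule a_const_pos)
  have "inv_speed integrable_on {0..1}"
  proof (rule measurable_bounded_by_integrable_imp_integrable)
    have "inv_speed \<in> borel_measurable borel"
      unfolding inv_speed_def by measurable
    then show "inv_speed \<in> borel_measurable (lebesgue_on {0..1})"
      by (intro measurable_restrict_space1 measurable_completion) simp
    have "((\<lambda>x::real. x powr (-1/2)) has_integral (1 powr (-1/2 + 1) / (-1/2 + 1))) {0..1}"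
      by (rule has_integral_powr_from_0) auto
    then show "(\<lambda>x::real. sqrt 2 / a_const * x powr (-1/2)) integrable_on {0..1}"
      by (intro integrable_on_mult_right) (auto simp: integrable_on_def)
    fix t :: real assume t: "t \<in> {0..1}"
    show "norm (inv_speed t) \<le> sqrt 2 / a_const * t powr (-1/2)"
    proof (cases "t = 0")
      case True then show ?thesis by (simp add: inv_speed_def)
    next
      case False
      then have t0: "t > 0" using t by auto
      have "t / 2 \<le> sin t" using half_le_sin t by auto
      then have "inv_speed t \<le> 1 / (a_const * sqrt (t / 2))"
        unfolding inv_speed_def using t0 a0 by (intro divide_left_mono mult_left_mono) auto
      also have "\<dots> = sqrt 2 / a_const * t powr (-1/2)"
        using t0 by (simp add: powr_minus powr_half_sqrt real_sqrt_divide field_simps)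
      finally show ?thesis using inv_speed_nonneg by simp
    qed
  qed auto
  moreover have "inv_speed integrable_on {1..pi/2}"
  proof (intro integrable_continuous_interval continuous_at_imp_continuous_on ballI inv_speed_isCont)
    fix t :: real assume "t \<in> {1..pi/2}"
    then have "sin t > 0" using pi_gt3 by (intro sin_gt_zero) auto
    then show "sin t \<noteq> 0" by simp
  qed
  ultimately have h: "inv_speed integrable_on {0..pi/2}"
    using pi_gt3 by (intro Henstock_Kurzweil_Integration.integrable_combine[of 0 1 "pi/2"]) auto
  have "(\<lambda>t. inv_speed (- t)) integrable_on {- (pi/2)..- 0}"
    using h by (simp only: Henstock_Kurzweil_Integration.integrable_reflect_real)
  then have "inv_speed integrable_on {- (pi/2)..0}" by (simp add: inv_speed_even)
  then have "inv_speed integrable_on {pi/2..pi}"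
    using has_integral_shift_real[of inv_speed pi _ "- (pi/2)" 0]
    by (auto simp: integrable_on_def inv_speed_periodic)
  then have one: "inv_speed integrable_on {0..pi}"
    using h by (intro Henstock_Kurzweil_Integration.integrable_combine[of 0 "pi/2" pi]) auto
  have shift: "inv_speed integrable_on {u..v} \<longleftrightarrow> inv_speed integrable_on {u + of_nat n * pi..v + of_nat n * pi}" for u v n
  proof -
    have "inv_speed (t + of_nat n * pi) = inv_speed t" for t
      using periodic_int[of inv_speed pi t "int n", OF inv_speed_periodic] by simp
    then show ?thesis
      using has_integral_shift_real[of inv_speed "of_nat n * pi" _ u v] by (simp add: integrable_on_def)
  qed
  have many: "inv_speed integrable_on {0..of_nat n * pi}" for n
  proof (induction n)
    case (Suc n)
    have "inv_speed integrable_on {of_nat n * pi..of_nat (Suc n) * pi}"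
      using one shift[of 0 pi n] by (simp add: algebra_simps)
    then show ?case
      using Suc by (intro Henstock_Kurzweil_Integration.integrable_combine[of 0 "of_nat n * pi" "of_nat (Suc n) * pi"])
        (auto simp: mult_right_mono)
  qed (use integrable_on_refl[of inv_speed 0] in simp)
  \<comment> \<open>A shift by \<open>n\<close> periods moves the interval to the right of 0, where
    \<open>m\<close> periods cover it.\<close>
  obtain n :: nat where n: "- a < of_nat n * pi" using reals_Archimedean3[of pi] by auto
  obtain m :: nat where m: "b + of_nat n * pi < of_nat m * pi" using reals_Archimedean3[of pi] by auto
  have "inv_speed integrable_on {a + of_nat n * pi..b + of_nat n * pi}"
    by (rule integrable_subinterval_real[OF many[of m]]) (use n m in auto)
  then show ?thesis using shift by blast
qed

lemma has_integral_inv_speed: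
  "a \<le> b \<Longrightarrow> (inv_speed has_integral (arclen b - arclen a)) {a..b}"
  unfolding arclen_def by (rule has_integral_signed_integral[OF inv_speed_integrable])

lemma arclen_0: "arclen 0 = 0"
  by (simp add: arclen_def)

lemma arclen_minus: "arclen (- t) = - arclen t"
proof -
  have "arclen (- t) = - arclen t" if "t \<ge> 0" for t
  proof -
    have "((\<lambda>x. inv_speed (- x)) has_integral (arclen t - arclen 0)) {- t..- 0}"
      using has_integral_inv_speed[OF that] by (simp only: has_integral_reflect_real)
    moreover have "(inv_speed has_integral (arclen 0 - arclen (- t))) {- t..0}"
      using that by (intro has_integral_inv_speed) simp
    ultimately show ?thesis
      using has_integral_unique[of inv_speed "arclen t" "{-t..0}" "- arclen (- t)"]
      by (simp add: inv_speed_even arclen_0)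
  qed
  from this[of t] this[of "- t"] show ?thesis by (cases "t \<ge> 0") auto
qed

text \<open>Oddness and periodicity make both halves of \<open>{0..pi}\<close> contribute equally,
  and t = x + pi/2 turns the second half into the integral in \<open>L0_const\<close>.\<close>

lemma arclen_pi: "arclen pi = L0_const"
proof -
  have eq: "inv_speed (x + pi/2) = 1 / a_const * (1 / sqrt (cos x))" if "x \<in> {0..pi/2}" for x
    using that cos_ge_zero[of x] by (simp add: inv_speed_def sin_add)
  have "((\<lambda>x. inv_speed (x + pi/2)) has_integral (arclen pi - arclen (pi/2))) {0..pi/2}"
    using has_integral_inv_speed[of "pi/2" pi] has_integral_shift_real[of inv_speed "pi/2" _ 0 "pi/2"] by simp
  then have "((\<lambda>x. 1 / a_const * (1 / sqrt (cos x))) has_integral (arclen pi - arclen (pi/2))) {0..pi/2}"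
    by (rule has_integral_eq[rotated]) (rule eq)
  then have "integral {0..pi/2} (\<lambda>x. 1 / a_const * (1 / sqrt (cos x))) = arclen pi - arclen (pi/2)"
    by (rule integral_unique)
  then have 1: "arclen pi - arclen (pi/2) = 1 / a_const * integral {0..pi/2} (\<lambda>t. 1 / sqrt (cos t))"
    by (simp only: Henstock_Kurzweil_Integration.integral_mult_right)
  have "arclen (- (pi/2) + pi) = arclen (- (pi/2)) + arclen pi"
    unfolding arclen_def by (rule signed_integral_periodic[OF inv_speed_integrable inv_speed_periodic])
  then have "arclen pi = 2 * arclen (pi/2)" by (simp add: arclen_minus)
  then show ?thesis using 1 by (simp add: L0_const_def)
qed

lemma arclen_shift: "arclen (t + pi) = arclen t + L0_const"
  unfolding arclen_def using signed_integral_periodic[OF inv_speed_integrable inv_speed_periodic, of t]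
  by (simp add: arclen_pi[unfolded arclen_def])

text \<open>Taking \<open>M = 1\<close> bounds the speed of \<open>angle\<close> globally; a small
  \<open>M\<close> near a zero of sin shows how slowly \<open>angle\<close> leaves it.\<close>

lemma arclen_growth:
  assumes bc: "b \<le> c" and M: "M > 0" "\<And>u. u \<in> {b..c} \<Longrightarrow> \<bar>sin u\<bar> \<le> M"
  shows "(c - b) / (a_const * sqrt M) \<le> arclen c - arclen b"
proof -
  have "((\<lambda>_. 1 / (a_const * sqrt M)) has_integral ((c - b) * (1 / (a_const * sqrt M)))) {b..c}"
    using has_integral_const_real[of "1 / (a_const * sqrt M)" b c] bc by simp
  \<comment> \<open>At zeros of sin the convention 1/0 = 0 breaks the pointwise bound, so the values
    on this negligible set are overwritten.\<close>
  moreover have "((\<lambda>u. if sin u = 0 then 1 / (a_const * sqrt M) else inv_speed u)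
      has_integral (arclen c - arclen b)) {b..c}"
    by (rule has_integral_spike[OF negligible_sin_zero _ has_integral_inv_speed[OF bc]]) auto
  ultimately have "(c - b) * (1 / (a_const * sqrt M)) \<le> arclen c - arclen b"
  proof (rule has_integral_le)
    fix u assume "u \<in> {b..c}"
    then show "1 / (a_const * sqrt M) \<le> (if sin u = 0 then 1 / (a_const * sqrt M) else inv_speed u)"
      unfolding inv_speed_def using M a_const_pos by (auto intro!: divide_left_mono)
  qed
  then show ?thesis by simp
qed

lemma arclen_ge: "b \<le> c \<Longrightarrow> (c - b) / a_const \<le> arclen c - arclen b"
  using arclen_growth[of b c 1] by simp

lemma arclen_strict_mono: "b < c \<Longrightarrow> arclen b < arclen c"
  using arclen_ge[of b c] divide_pos_pos[of "c - b" a_const] a_const_pos by linarith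

lemma arclen_continuous: "continuous_on {a..b} arclen"
  unfolding arclen_def by (rule signed_integral_continuous[OF inv_speed_integrable])

lemma arclen_deriv: "sin t \<noteq> 0 \<Longrightarrow> (arclen has_real_derivative inv_speed t) (at t)"
  unfolding arclen_def
  by (intro signed_integral_has_real_derivative inv_speed_integrable inv_speed_isCont)

section \<open>The inverse of arc length as solution of the differential equation\<close>

definition angle :: "real \<Rightarrow> real" where
  "angle = inv arclen"

lemma angle_arclen: "angle (arclen t) = t"
proof -
  have "inj arclen"
    using arclen_strict_mono by (metis injI linorder_neqE_linordered_idom order_less_irrefl)
  then show ?thesis by (simp add: angle_def)
qed

lemma arclen_angle: "arclen (angle s) = s"
proof -
  define A where "A = a_const * \<bar>s\<bar>"
  have "A \<ge> 0" using a_const_pos by (simp add: A_def)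
  then have "\<bar>s\<bar> \<le> arclen A" using arclen_ge[of 0 A] a_const_pos by (simp add: A_def arclen_0)
  then have "arclen (- A) \<le> s" "s \<le> arclen A" by (auto simp: arclen_minus)
  then obtain x where "arclen x = s"
    using IVT'[of arclen "- A" s A] arclen_continuous \<open>A \<ge> 0\<close> by force
  then show ?thesis using angle_arclen by metis
qed

lemma angle_le_iff: "angle s \<le> t \<longleftrightarrow> s \<le> arclen t"
  using arclen_strict_mono[of "angle s" t] arclen_strict_mono[of t "angle s"] arclen_angle[of s]
  by (metis less_eq_real_def not_le)

lemma angle_strict_mono: "s < t \<Longrightarrow> angle s < angle t"
  using angle_le_iff[of t "angle s"] by (simp add: arclen_angle flip: not_le)

lemma angle_shift: "angle (s + L0_const) = angle s + pi"
  using angle_arclen[of "angle s + pi"] by (simp add: arclen_shift arclen_angle)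

lemma angle_minus: "angle (- s) = - angle s"
  using angle_arclen[of "- angle s"] by (simp add: arclen_minus arclen_angle)

lemma angle_0: "angle 0 = 0"
  using angle_arclen[of 0] by (simp add: arclen_0)

lemma angle_L0: "angle L0_const = pi"
  using angle_shift[of 0] by (simp add: angle_0)

lemma angle_reflect: "angle (L0_const - s) = pi - angle s"
  using angle_shift[of "- s"] by (simp add: angle_minus algebra_simps)

lemma L0_pos: "L0_const > 0"
  using arclen_strict_mono[of 0 pi] by (simp add: arclen_0 arclen_pi)

lemma angle_lipschitz: "a_const-lipschitz_on UNIV angle"
proof (rule lipschitz_onI)
  have *: "angle t - angle s \<le> a_const * (t - s)" if "s \<le> t" for s t
  proof -
    have "angle s \<le> angle t" using angle_strict_mono[of s t] that by (cases "s = t") auto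
    from arclen_ge[OF this] show ?thesis
      using a_const_pos by (simp add: arclen_angle field_simps)
  qed
  fix s t
  have "angle s \<le> angle t \<longleftrightarrow> s \<le> t" using angle_le_iff[of s "angle t"] by (simp add: arclen_angle)
  then show "dist (angle s) (angle t) \<le> a_const * dist s t"
    using *[of s t] *[of t s] by (cases "s \<le> t") (auto simp: dist_real_def abs_le_iff)
qed (use a_const_pos in simp)

lemma angle_continuous: "continuous_on A angle"
  by (rule continuous_on_subset[OF lipschitz_on_continuous_on[OF angle_lipschitz]]) simp

text \<open>Away from multiples of pi this is the inverse function rule. At such a multiple
  \<open>arclen\<close> has infinite slope: if the angle moves by d, then |sin| \<le> d on the way,
  so \<open>arclen_growth\<close> gives d \<le> a sqrt d |h|, and the difference quotient is at most
  a sqrt d, which tends to 0.\<close>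

lemma angle_deriv: "(angle has_real_derivative a_const * sqrt \<bar>sin (angle s)\<bar>) (at s)"
proof (cases "sin (angle s) = 0")
  case False
  then have ne: "inv_speed (angle s) \<noteq> 0" using a_const_pos by (simp add: inv_speed_def)
  have "(angle has_real_derivative inverse (inv_speed (angle s))) (at s)"
    by (rule DERIV_inverse_function[where f=arclen and a="s - 1" and b="s + 1"])
       (use False ne arclen_deriv arclen_angle angle_continuous[of UNIV] in
         \<open>auto simp: continuous_on_eq_continuous_at\<close>)
  then show ?thesis by (simp add: inv_speed_def)
next
  case True
  have est: "\<bar>angle (s + h) - angle s\<bar> \<le> a_const * sqrt \<bar>angle (s + h) - angle s\<bar> * \<bar>h\<bar>" if "h \<noteq> 0" for h
  proof -
    define b where "b = min (angle s) (angle (s + h))"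
    define c where "c = max (angle s) (angle (s + h))"
    define d where "d = \<bar>angle (s + h) - angle s\<bar>"
    have "angle (s + h) \<noteq> angle s" using that by (metis add_cancel_left_right arclen_angle)
    then have d0: "d > 0" by (simp add: d_def)
    have bc: "b \<le> c" "c - b = d" by (auto simp: b_def c_def d_def)
    have sinb: "\<bar>sin u\<bar> \<le> d" if "u \<in> {b..c}" for u
    proof -
      have "\<bar>sin u - sin (angle s)\<bar> \<le> \<bar>u - angle s\<bar>"
        using field_differentiable_bound[of UNIV sin cos 1 "angle s" u] by (auto intro!: derivative_eq_intros)
      also have "\<dots> \<le> d" using that by (auto simp: b_def c_def d_def)
      finally show ?thesis by (simp add: True)
    qed
    have "arclen c - arclen b \<le> \<bar>h\<bar>" by (auto simp: b_def c_def min_def max_def arclen_angle)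
    then have "d / (a_const * sqrt d) \<le> \<bar>h\<bar>"
      using arclen_growth[OF bc(1) d0 sinb] bc by simp
    then have "d \<le> \<bar>h\<bar> * (a_const * sqrt d)"
      using d0 a_const_pos by (simp add: pos_divide_le_eq)
    then show ?thesis by (simp add: d_def mult_ac)
  qed
  have "isCont angle s" using angle_continuous[of UNIV] by (simp add: continuous_on_eq_continuous_at)
  then have "(\<lambda>h. angle (s + h)) \<midarrow>0\<rightarrow> angle s" by (simp add: isCont_def LIM_offset_zero_iff)
  then have "(\<lambda>h. a_const * sqrt \<bar>angle (s + h) - angle s\<bar>) \<midarrow>0\<rightarrow> a_const * sqrt \<bar>angle s - angle s\<bar>"
    by (intro tendsto_intros)
  then have "(\<lambda>h. a_const * sqrt \<bar>angle (s + h) - angle s\<bar>) \<midarrow>0\<rightarrow> 0" by simp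
  then have "(\<lambda>h. (angle (s + h) - angle s) / h) \<midarrow>0\<rightarrow> 0"
  proof (rule Lim_null_comparison[rotated])
    show "\<forall>\<^sub>F h in at 0. norm ((angle (s + h) - angle s) / h) \<le> a_const * sqrt \<bar>angle (s + h) - angle s\<bar>"
      using est by (auto simp: eventually_at_filter abs_divide divide_le_eq)
  qed
  then show ?thesis by (simp add: DERIV_def True)
qed

lemma angle_range:
  assumes "s \<in> {0..L0_const}"
  shows "angle s \<in> {0..pi}"
proof -
  have "angle s \<le> pi" using assms by (simp add: angle_le_iff arclen_pi)
  moreover have "0 \<le> angle s"
    using assms angle_strict_mono[of 0 s] by (cases "s = 0") (simp_all add: angle_0)
  ultimately show ?thesis by simp
qed

lemma theta_sol_angle: "theta_sol angle"
  unfolding theta_sol_def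
proof (intro conjI ballI)
  fix s assume s: "s \<in> {0..L0_const}"
  have "\<bar>sin (angle s)\<bar> = sin (angle s)" using angle_range[OF s] sin_ge_zero by auto
  then show "(angle has_real_derivative a_const * sqrt (sin (angle s))) (at s within {0..L0_const})"
    using has_field_derivative_at_within[OF angle_deriv[of s]] by simp
next
  show "mono_on {0..L0_const} angle"
    by (rule mono_onI) (metis angle_strict_mono order_le_less)
  show "angle ` {0..L0_const} \<subseteq> {0..pi}" using angle_range by blast
qed (rule angle_0 angle_L0)+

text \<open>The separable equation could rest at \<open>0\<close> or at \<open>\<pi>\<close>, but climbing from \<open>0\<close> to \<open>\<pi>\<close> alone takes
  the whole length \<open>L0_const\<close>.\<close>
lemma theta_sol_unique:
  assumes sol: "theta_sol \<theta>" and s: "s \<in> {0..L0_const}"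
  shows "\<theta> s = angle s"
proof -
  let ?I = "{0..L0_const}"
  note sol' = sol[unfolded theta_sol_def]
  have d: "(\<theta> has_real_derivative (a_const * sqrt (sin (\<theta> s)))) (at s within ?I)" if "s \<in> ?I" for s
    using bspec[OF conjunct1[OF sol'] that] .
  have th0: "\<theta> 0 = 0" and thL: "\<theta> L0_const = pi" and mono: "mono_on ?I \<theta>"
    and "\<theta> ` ?I \<subseteq> {0..pi}"
    using conjunct2[OF sol'] by - (elim conjE, assumption)+
  then have rng: "0 \<le> \<theta> s \<and> \<theta> s \<le> pi" if "s \<in> ?I" for s
    using imageI[OF that, of \<theta>] by auto
  have cont: "continuous_on ?I \<theta>" by (rule DERIV_continuous_on[OF d])
  have closed: "compact {s \<in> ?I. \<theta> s = c}" for c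
  proof -
    have "closed (?I \<inter> \<theta> -` {c})" by (rule continuous_closed_preimage[OF cont]) auto
    moreover have "{s \<in> ?I. \<theta> s = c} = ?I \<inter> (?I \<inter> \<theta> -` {c})" by auto
    ultimately show ?thesis using compact_Int_closed[OF compact_Icc] by metis
  qed
  have "0 \<in> {s \<in> ?I. \<theta> s = 0}" using th0 L0_pos by simp
  then obtain T0 where "T0 \<in> {s \<in> ?I. \<theta> s = 0}" "\<forall>s\<in>{s \<in> ?I. \<theta> s = 0}. s \<le> T0"
    using compact_attains_sup[OF closed[of 0]] by blast
  then have T0: "T0 \<in> ?I" "\<theta> T0 = 0" "\<And>s. s \<in> ?I \<Longrightarrow> \<theta> s = 0 \<Longrightarrow> s \<le> T0"
    by blast+
  have "L0_const \<in> {s \<in> ?I. \<theta> s = pi}" using thL L0_pos by simp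
  then obtain T1 where "T1 \<in> {s \<in> ?I. \<theta> s = pi}" "\<forall>s\<in>{s \<in> ?I. \<theta> s = pi}. T1 \<le> s"
    using compact_attains_inf[OF closed[of pi]] by blast
  then have T1: "T1 \<in> ?I" "\<theta> T1 = pi" "\<And>s. s \<in> ?I \<Longrightarrow> \<theta> s = pi \<Longrightarrow> T1 \<le> s"
    by blast+
  have lt: "T0 < T1"
  proof (rule ccontr)
    assume "\<not> T0 < T1"
    then have "\<theta> T1 \<le> \<theta> T0" using mono T0(1) T1(1) by (auto simp: mono_on_def)
    then show False using T0 T1 pi_gt_zero by linarith
  qed
  \<comment> \<open>Separation of variables: strictly between the last zero \<open>T0\<close> and
    the first arrival \<open>T1\<close> at pi, \<open>arclen\<close> of \<theta> has slope 1. Hence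
    T1 - T0 is the full length and no time is left for resting.\<close>
  define f where "f u = arclen (\<theta> u) - u" for u
  have const: "f u = f T0" if u: "T0 \<le> u" "u \<le> T1" for u
  proof (rule DERIV_isconst2[OF lt _ _ u])
    have sub: "x \<in> ?I" if "x \<in> {T0..T1}" for x using that T0(1) T1(1) by auto
    have "continuous_on {T0..T1} \<theta>"
      by (rule continuous_on_subset[OF cont]) (use sub in blast)
    moreover have "\<theta> ` {T0..T1} \<subseteq> {0..pi}" using rng[OF sub] by auto
    ultimately have "continuous_on {T0..T1} (\<lambda>u. arclen (\<theta> u))"
      using continuous_on_compose2[OF arclen_continuous] by blast
    then show "continuous_on {T0..T1} f" unfolding f_def by (intro continuous_intros)
    fix v assume v: "T0 < v" "v < T1"
    have vI: "v \<in> ?I" "0 < v" "v < L0_const" using v T0(1) T1(1) by auto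
    have "\<theta> v \<noteq> 0" "\<theta> v \<noteq> pi" using T0(3)[OF vI(1)] T1(3)[OF vI(1)] v by auto
    then have sin: "sin (\<theta> v) > 0" using rng[OF vI(1)] by (intro sin_gt_zero) auto
    have "(\<theta> has_real_derivative (a_const * sqrt (sin (\<theta> v)))) (at v)"
      using d[OF vI(1)] at_within_Icc_at[OF vI(2,3)] by simp
    then have "((\<lambda>u. arclen (\<theta> u)) has_real_derivative inv_speed (\<theta> v) * (a_const * sqrt (sin (\<theta> v)))) (at v)"
      using sin by (intro DERIV_chain2[OF arclen_deriv]) auto
    moreover have "inv_speed (\<theta> v) * (a_const * sqrt (sin (\<theta> v))) = 1"
      using sin a_const_pos by (simp add: inv_speed_def)
    ultimately show "(f has_real_derivative 0) (at v)"
      unfolding f_def by (auto intro!: derivative_eq_intros)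
  qed
  have "f T1 = f T0" using const[of T1] lt by simp
  then have L: "T1 - T0 = L0_const"
    unfolding f_def T0(2) T1(2) arclen_0 arclen_pi by linarith
  have "T0 = 0" using L T0(1) T1(1) by simp
  moreover have "T1 = L0_const" using L calculation by simp
  ultimately have "f s = f 0" using const[of s] s by simp
  then have "arclen (\<theta> s) = s" unfolding f_def th0 arclen_0 by linarith
  then show ?thesis using angle_arclen[of "\<theta> s"] by simp
qed

section \<open>The extremal domain\<close>

text \<open>Integrating the tangent yields the whole closed curve at once, with no seam at the axis
  of symmetry; the explicit formulas of the statement are recovered on
  \<open>{0..L0_const}\<close>.\<close>

definition star_x :: "real \<Rightarrow> real" where
  "star_x = signed_integral (\<lambda>u. cos (angle u))"

definition star_y :: "real \<Rightarrow> real" where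
  "star_y s = -1 + signed_integral (\<lambda>u. sin (angle u)) s"

definition star_curve :: "real \<Rightarrow> pt" where
  "star_curve s = (star_x s, star_y s)"

lemma star_x_deriv: "(star_x has_real_derivative cos (angle s)) (at s)"
  unfolding star_x_def by (intro continuous_signed_integral continuous_intros angle_continuous)

lemma star_y_deriv: "(star_y has_real_derivative sin (angle s)) (at s)"
proof -
  have "(signed_integral (\<lambda>u. sin (angle u)) has_real_derivative sin (angle s)) (at s)"
    by (intro continuous_signed_integral continuous_intros angle_continuous)
  then show ?thesis unfolding star_y_def by (auto intro!: derivative_eq_intros)
qed

lemma star_curve_deriv: "(star_curve has_vector_derivative (cos (angle s), sin (angle s))) (at s)"
  unfolding star_curve_def using star_x_deriv star_y_deriv
  by (intro has_vector_derivative_Pair) (simp_all add: has_real_derivative_iff_has_vector_derivative)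

lemma star_curve_0: "star_x 0 = 0" "star_y 0 = -1"
  by (simp_all add: star_x_def star_y_def)

lemma isCont_star: "isCont star_x s" "isCont star_y s"
  using star_x_deriv star_y_deriv DERIV_isCont by blast+

text \<open>Only interior derivatives are compared, because the radicand in sqrt (sin (angle s))
  vanishes at both ends of \<open>{0..L0_const}\<close>.\<close>

lemma eq_if_deriv_eq_interior:
  fixes f g :: "real \<Rightarrow> real"
  assumes "a < b" "f a = g a" "continuous_on {a..b} f" "continuous_on {a..b} g"
    and "\<And>x. a < x \<Longrightarrow> x < b \<Longrightarrow> (f has_real_derivative d x) (at x)"
    and "\<And>x. a < x \<Longrightarrow> x < b \<Longrightarrow> (g has_real_derivative d x) (at x)"
    and "x \<in> {a..b}"
  shows "f x = g x"
proof -
  have "(\<lambda>x. f x - g x) x = (\<lambda>x. f x - g x) a"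
  proof (rule DERIV_isconst2[OF assms(1)])
    show "continuous_on {a..b} (\<lambda>x. f x - g x)" using assms by (intro continuous_intros)
    show "((\<lambda>x. f x - g x) has_real_derivative 0) (at y)" if "a < y" "y < b" for y
      using DERIV_diff[OF assms(5)[OF that] assms(6)[OF that]] by simp
  qed (use assms(7) in auto)
  then show ?thesis using assms(2) by simp
qed

lemma sin_angle_pos:
  assumes "0 < s" "s < L0_const"
  shows "sin (angle s) > 0"
  using angle_strict_mono[OF assms(1)] angle_strict_mono[OF assms(2)]
  by (intro sin_gt_zero) (auto simp: angle_0 angle_L0)

text \<open>The factor a sqrt (sin \<theta>), which the differential equation contributes to the
  chain rule, cancels the 1 / sqrt (sin \<theta>) from the square root and leaves cos
  \<theta>.\<close>

lemma star_x_eq: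
  assumes s: "s \<in> {0..L0_const}"
  shows "star_x s = 2 / a_const * sqrt (sin (angle s))"
proof (rule eq_if_deriv_eq_interior[OF L0_pos _ _ _ _ _ s])
  show "star_x 0 = 2 / a_const * sqrt (sin (angle 0))" by (simp add: star_curve_0 angle_0)
  show "continuous_on {0..L0_const} star_x"
    using isCont_star by (simp add: continuous_at_imp_continuous_on)
  show "continuous_on {0..L0_const} (\<lambda>s. 2 / a_const * sqrt (sin (angle s)))"
    by (intro continuous_intros angle_continuous)
  fix u assume u: "0 < u" "u < L0_const"
  show "(star_x has_real_derivative cos (angle u)) (at u)" by (rule star_x_deriv)
  have sin: "sin (angle u) > 0" by (rule sin_angle_pos[OF u])
  have "((\<lambda>s. sqrt (sin (angle s))) has_real_derivative
      (inverse (sqrt (sin (angle u))) / 2) * (cos (angle u) * (a_const * sqrt \<bar>sin (angle u)\<bar>))) (at u)"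
    by (rule DERIV_chain2[where f=sqrt and g="\<lambda>s. sin (angle s)", OF DERIV_real_sqrt[OF sin]])
       (rule DERIV_chain2[where f=sin, OF DERIV_sin angle_deriv])
  from DERIV_cmult[OF this, of "2 / a_const"]
  show "((\<lambda>s. 2 / a_const * sqrt (sin (angle s))) has_real_derivative cos (angle u)) (at u)"
    using sin a_const_pos by (simp add: field_simps)
qed

lemma star_y_eq:
  assumes s: "s \<in> {0..L0_const}"
  shows "star_y s = sqrt_cos_int (angle s - pi/2) / a_const"
proof (rule eq_if_deriv_eq_interior[OF L0_pos _ _ _ _ _ s])
  have d: "((\<lambda>s. sqrt_cos_int (angle s - pi/2)) has_real_derivative
      sqrt \<bar>cos (angle u - pi/2)\<bar> * (a_const * sqrt \<bar>sin (angle u)\<bar>)) (at u)" for u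
  proof -
    have "((\<lambda>s. angle s - pi/2) has_real_derivative a_const * sqrt \<bar>sin (angle u)\<bar>) (at u)"
      using DERIV_diff[OF angle_deriv[of u] DERIV_const] by simp
    then show ?thesis by (rule DERIV_chain2[where f=sqrt_cos_int, OF sqrt_cos_int(2)])
  qed
  show "star_y 0 = sqrt_cos_int (angle 0 - pi/2) / a_const"
    using a_const_pos by (simp add: star_curve_0 angle_0 sqrt_cos_int_minus sqrt_cos_int_half_pi)
  show "continuous_on {0..L0_const} star_y"
    using isCont_star by (simp add: continuous_at_imp_continuous_on)
  show "continuous_on {0..L0_const} (\<lambda>s. sqrt_cos_int (angle s - pi/2) / a_const)"
    using DERIV_isCont[OF d] a_const_pos by (intro continuous_intros continuous_at_imp_continuous_on) auto
  fix u assume u: "0 < u" "u < L0_const"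
  show "(star_y has_real_derivative sin (angle u)) (at u)" by (rule star_y_deriv)
  have sin: "sin (angle u) > 0" by (rule sin_angle_pos[OF u])
  have "sqrt \<bar>cos (angle u - pi/2)\<bar> * (a_const * sqrt \<bar>sin (angle u)\<bar>) / a_const = sin (angle u)"
    using sin a_const_pos by (simp add: cos_diff)
  then show "((\<lambda>s. sqrt_cos_int (angle s - pi/2) / a_const) has_real_derivative sin (angle u)) (at u)"
    using DERIV_cdivide[OF d[of u], of a_const] by simp
qed

lemma sqrt_sin_integral:
  assumes "t \<in> {0..pi}"
  shows "integral {0..t} (\<lambda>u. sqrt (sin u)) = sqrt_cos_int (t - pi/2) + a_const"
proof -
  have d: "((\<lambda>t. sqrt_cos_int (t - pi/2)) has_real_derivative sqrt \<bar>cos (u - pi/2)\<bar>) (at u)" for u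
    using DERIV_shift[of sqrt_cos_int _ u "- (pi/2)"] sqrt_cos_int(2)[of "u - pi/2"] by simp
  have "((\<lambda>u. sqrt \<bar>cos (u - pi/2)\<bar>) has_integral (sqrt_cos_int (t - pi/2) - sqrt_cos_int (0 - pi/2))) {0..t}"
    by (rule antiderivative_diff[OF d]) (use assms in auto)
  then have "((\<lambda>u. sqrt (sin u)) has_integral (sqrt_cos_int (t - pi/2) - sqrt_cos_int (0 - pi/2))) {0..t}"
  proof (rule has_integral_eq[rotated])
    fix u assume "u \<in> {0..t}"
    then have "sin u \<ge> 0" using assms by (intro sin_ge_zero) auto
    then show "sqrt \<bar>cos (u - pi/2)\<bar> = sqrt (sin u)" by (simp add: cos_diff)
  qed
  then show ?thesis by (simp add: integral_unique sqrt_cos_int_minus sqrt_cos_int_half_pi)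
qed

lemma curve_eq_star:
  assumes sol: "theta_sol \<theta>" and s: "s \<in> {0..L0_const}"
  shows "xcurve \<theta> s = star_x s" "ycurve \<theta> s = star_y s"
proof -
  show "xcurve \<theta> s = star_x s"
    by (simp add: xcurve_def theta_sol_unique[OF sol s] star_x_eq[OF s])
  show "ycurve \<theta> s = star_y s"
    unfolding ycurve_def theta_sol_unique[OF sol s] sqrt_sin_integral[OF angle_range[OF s]] star_y_eq[OF s]
    using a_const_pos by (simp add: field_simps)
qed

text \<open>Over \<open>L0_const\<close> the tangent turns by pi and is reversed, so curve plus
  shifted curve is constant; the end points (0,-1) and (0,1) make the constant 0. This central
  symmetry also closes the curve after \<open>2 * L0_const\<close>.\<close>

lemma star_shift: "star_x (s + L0_const) = - star_x s" "star_y (s + L0_const) = - star_y s"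
proof -
  have L: "L0_const \<in> {0..L0_const}" using L0_pos by simp
  have "((\<lambda>s. star_x (s + L0_const) + star_x s) has_real_derivative 0) (at s)" for s
    using DERIV_add[OF iffD1[OF DERIV_shift star_x_deriv[of "s + L0_const"]] star_x_deriv[of s]]
    by (simp add: angle_shift)
  then have "star_x (s + L0_const) + star_x s = star_x (0 + L0_const) + star_x 0"
    by (rule DERIV_isconst_all[rule_format])
  then show "star_x (s + L0_const) = - star_x s"
    using star_x_eq[OF L] by (simp add: star_curve_0 angle_L0)
  have "((\<lambda>s. star_y (s + L0_const) + star_y s) has_real_derivative 0) (at s)" for s
    using DERIV_add[OF iffD1[OF DERIV_shift star_y_deriv[of "s + L0_const"]] star_y_deriv[of s]]
    by (simp add: angle_shift)
  then have "star_y (s + L0_const) + star_y s = star_y (0 + L0_const) + star_y 0"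
    by (rule DERIV_isconst_all[rule_format])
  then show "star_y (s + L0_const) = - star_y s"
    using star_y_eq[OF L] a_const_pos by (simp add: star_curve_0 angle_L0 sqrt_cos_int_half_pi)
qed

lemma star_reflect:
  assumes s: "s \<in> {0..L0_const}"
  shows "star_x (L0_const - s) = star_x s" "star_y (L0_const - s) = - star_y s"
proof -
  have s': "L0_const - s \<in> {0..L0_const}" using s by auto
  show "star_x (L0_const - s) = star_x s"
    by (simp add: star_x_eq[OF s] star_x_eq[OF s'] angle_reflect)
  have "pi - angle s - pi/2 = - (angle s - pi/2)" by (simp add: field_simps)
  then show "star_y (L0_const - s) = - star_y s"
    by (simp only: star_y_eq[OF s] star_y_eq[OF s'] angle_reflect sqrt_cos_int_minus minus_divide_left)
qed

lemma star_curve_shift: "star_curve (s + L0_const) = - star_curve s"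
  by (simp add: star_curve_def star_shift)

lemma star_curve_periodic: "star_curve (s + 2 * L0_const) = star_curve s"
  using star_curve_shift[of "s + L0_const"] star_curve_shift[of s] by (simp add: algebra_simps)

text \<open>Closed formulas are available on \<open>{0..L0_const}\<close> only; properties invariant
  under the half-period shift may be checked there.\<close>

lemma mod_L0_induct [case_names base step]:
  assumes base: "\<And>s. s \<in> {0..L0_const} \<Longrightarrow> P s" and step: "\<And>s. P (s + L0_const) \<longleftrightarrow> P s"
  shows "P s"
proof -
  obtain k where "0 \<le> s + of_int k * L0_const" "s + of_int k * L0_const < 0 + L0_const"
    using shift_into_period[OF L0_pos] by metis
  then have "P (s + of_int k * L0_const)" by (intro base) auto
  then show ?thesis using periodic_int[of P L0_const s k] step by simp
qed

lemma Omega_star_eq: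
  assumes sol: "theta_sol \<theta>"
  shows "Omega_star \<theta> = convex hull (range star_curve)"
proof -
  have im1: "(\<lambda>s. (xcurve \<theta> s, ycurve \<theta> s)) ` {0..L0_const} = star_curve ` {0..L0_const}"
    by (intro image_cong) (auto simp: star_curve_def curve_eq_star[OF sol])
  \<comment> \<open>The mirror image of the right half is the left half run backwards; the form
    \<open>L0_const - s + L0_const\<close> of the parameter lets the central symmetry act on the
    reflected point.\<close>
  have im2: "(\<lambda>s. (- xcurve \<theta> s, ycurve \<theta> s)) ` {0..L0_const} = (\<lambda>s. star_curve (L0_const - s + L0_const)) ` {0..L0_const}"
    unfolding star_curve_shift
    by (intro image_cong) (auto simp: star_curve_def curve_eq_star[OF sol] star_reflect)
  have "star_curve s \<in> star_curve ` {0..L0_const} \<union> (\<lambda>s. star_curve (L0_const - s + L0_const)) ` {0..L0_const}" for s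
  proof -
    obtain k where k: "0 \<le> s + of_int k * (2 * L0_const)" "s + of_int k * (2 * L0_const) < 0 + 2 * L0_const"
      using shift_into_period[of "2 * L0_const"] L0_pos by (metis mult_pos_pos zero_less_numeral)
    define u where "u = s + of_int k * (2 * L0_const)"
    have "star_curve s = star_curve u"
      unfolding u_def by (rule periodic_int[symmetric]) (rule star_curve_periodic)
    moreover have "u \<in> {0..L0_const} \<or> (2 * L0_const - u \<in> {0..L0_const} \<and> u = L0_const - (2 * L0_const - u) + L0_const)"
      using k by (auto simp: u_def[symmetric])
    ultimately show ?thesis by (metis UnI1 UnI2 image_eqI)
  qed
  then have "range star_curve = star_curve ` {0..L0_const} \<union> (\<lambda>s. star_curve (L0_const - s + L0_const)) ` {0..L0_const}"
    by blast
  then show ?thesis by (simp only: Omega_star_def im1 im2)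
qed

section \<open>Support lines and frontier of the extremal body\<close>

definition star_height :: "real \<Rightarrow> pt \<Rightarrow> real" where
  "star_height s z = cos (angle s) * (snd z - star_y s) - sin (angle s) * (fst z - star_x s)"

text \<open>\<open>star_height s\<close> is the signed distance from the tangent line at
  \<open>s\<close>. Along the curve its derivative is sin (angle v - angle s), positive in the first
  half-period and negative in the second, and it vanishes at both ends of the period.\<close>

lemma star_height_pos:
  assumes u: "s < u" "u < s + 2 * L0_const"
  shows "star_height s (star_curve u) > 0"
proof -
  define W where "W u = star_height s (star_curve u)" for u
  have dW: "(W has_real_derivative sin (angle v - angle s)) (at v)" for v
  proof -
    have "(W has_real_derivative (cos (angle s) * sin (angle v) - sin (angle s) * cos (angle v))) (at v)"
      unfolding W_def star_height_def star_curve_def fst_conv snd_conv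
      by (auto intro!: derivative_eq_intros star_x_deriv star_y_deriv)
    then show ?thesis by (simp add: sin_diff mult.commute)
  qed
  have W0: "W s = 0" by (simp add: W_def star_height_def star_curve_def)
  have W1: "W (s + 2 * L0_const) = 0"
    using W0 by (simp add: W_def star_curve_periodic)
  have mid: "angle (s + L0_const) = angle s + pi" by (rule angle_shift)
  have fin: "angle (s + 2 * L0_const) = angle s + 2 * pi"
  proof -
    have "s + 2 * L0_const = (s + L0_const) + L0_const" by simp
    then show ?thesis by (simp only: angle_shift)
  qed
  show ?thesis
  proof (cases "u \<le> s + L0_const")
    case True
    obtain v where v: "s < v" "v < u" "W u - W s = (u - s) * sin (angle v - angle s)"
      using MVT2[OF u(1), of W "\<lambda>v. sin (angle v - angle s)"] dW by auto
    have "angle s < angle v" "angle v < angle (s + L0_const)"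
      using v True by (auto intro: angle_strict_mono)
    then have "sin (angle v - angle s) > 0" by (intro sin_gt_zero) (auto simp: mid)
    then show ?thesis using v u W0 by (simp add: W_def[symmetric])
  next
    case False
    obtain v where v: "u < v" "v < s + 2 * L0_const"
      "W (s + 2 * L0_const) - W u = (s + 2 * L0_const - u) * sin (angle v - angle s)"
      using MVT2[OF u(2), of W "\<lambda>v. sin (angle v - angle s)"] dW by auto
    have "angle (s + L0_const) < angle v" "angle v < angle (s + 2 * L0_const)"
      using v False by (auto intro: angle_strict_mono)
    then have "sin (angle v - angle s) < 0"
      using sin_lt_zero[of "angle v - angle s"] by (simp add: mid fin)
    then have "W (s + 2 * L0_const) - W u < 0"
      using v u by (simp add: mult_pos_neg)
    then show ?thesis using W1 by (simp add: W_def[symmetric])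
  qed
qed

lemma star_height_cases: "star_curve u = star_curve s \<or> star_height s (star_curve u) > 0"
proof -
  obtain k where k: "s \<le> u + of_int k * (2 * L0_const)" "u + of_int k * (2 * L0_const) < s + 2 * L0_const"
    using shift_into_period[of "2 * L0_const"] L0_pos by (metis mult_pos_pos zero_less_numeral)
  have "star_curve (u + of_int k * (2 * L0_const)) = star_curve u"
    by (rule periodic_int) (rule star_curve_periodic)
  then show ?thesis using star_height_pos[of s "u + of_int k * (2 * L0_const)"] k
    by (cases "s = u + of_int k * (2 * L0_const)") auto
qed

lemma star_height_inner:
  "star_height s z = (- sin (angle s), cos (angle s)) \<bullet> z - (- sin (angle s), cos (angle s)) \<bullet> star_curve s"
  by (simp add: star_height_def star_curve_def inner_prod_def algebra_simps)

text \<open>An open half-plane with a single point of its boundary line added is still convex, so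
  strict positivity passes from the curve to its hull. The strictness later identifies the frontier
  points.\<close>

lemma star_height_hull:
  assumes "z \<in> convex hull (range star_curve)"
  shows "z = star_curve s \<or> star_height s z > 0"
proof -
  let ?n = "(- sin (angle s), cos (angle s))"
  let ?A = "insert (star_curve s) {z. ?n \<bullet> z > ?n \<bullet> star_curve s}"
  have "convex ?A"
    unfolding convex_alt
  proof (intro ballI allI impI)
    fix x y and t :: real assume xy: "x \<in> ?A" "y \<in> ?A" and t: "0 \<le> t \<and> t \<le> 1"
    define c where "c = ?n \<bullet> star_curve s"
    have x: "?n \<bullet> x \<ge> c" and y: "?n \<bullet> y \<ge> c" using xy by (auto simp: c_def)
    consider "t = 0" | "t = 1" | "x = star_curve s" "y = star_curve s"
      | "0 < t" "t < 1" "?n \<bullet> x > c \<or> ?n \<bullet> y > c"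
      using xy t by (force simp: c_def)
    then show "(1 - t) *\<^sub>R x + t *\<^sub>R y \<in> ?A"
    proof cases
      case 3
      then have "(1 - t) *\<^sub>R x + t *\<^sub>R y = star_curve s" by (simp flip: scaleR_left_distrib)
      then show ?thesis by simp
    next
      case 4
      have "(1 - t) * (?n \<bullet> x - c) + t * (?n \<bullet> y - c) > 0"
        using 4 x y by (auto intro: add_pos_nonneg add_nonneg_pos)
      then have "?n \<bullet> ((1 - t) *\<^sub>R x + t *\<^sub>R y) > c"
        by (simp only: inner_add_right inner_scaleR_right) (simp add: algebra_simps)
      then show ?thesis by (simp add: c_def)
    qed (use xy in auto)
  qed
  moreover have "range star_curve \<subseteq> ?A"
  proof (rule image_subsetI)
    show "star_curve u \<in> ?A" for u
      using star_height_cases[of u s] by (simp add: star_height_inner del: inner_Pair)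
  qed
  ultimately have "convex hull (range star_curve) \<subseteq> ?A" by (rule hull_minimal[rotated])
  then show ?thesis using assms by (auto simp: star_height_inner)
qed

lemma range_star_curve: "range star_curve = star_curve ` {0..2 * L0_const}"
proof -
  have "star_curve s \<in> star_curve ` {0..2 * L0_const}" for s
  proof -
    obtain k where k: "0 \<le> s + of_int k * (2 * L0_const)" "s + of_int k * (2 * L0_const) < 0 + 2 * L0_const"
      using shift_into_period[of "2 * L0_const"] L0_pos by (metis mult_pos_pos zero_less_numeral)
    have "star_curve (s + of_int k * (2 * L0_const)) = star_curve s"
      by (rule periodic_int) (rule star_curve_periodic)
    then show ?thesis using k by (metis atLeastAtMost_iff add_0 image_eqI less_imp_le)
  qed
  then show ?thesis by blast
qed

definition star_body :: "pt set" where
  "star_body = convex hull (range star_curve)"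

lemma star_curve_continuous: "continuous_on A star_curve"
  using star_curve_deriv by (auto intro!: continuous_at_imp_continuous_on has_vector_derivative_continuous)

lemma compact_star_body: "compact star_body"
  unfolding star_body_def range_star_curve
  by (intro compact_convex_hull compact_continuous_image star_curve_continuous) auto

lemma convex_star_body: "convex star_body"
  by (simp add: star_body_def)

lemma star_curve_in_body: "star_curve s \<in> star_body"
  unfolding star_body_def by (rule hull_inc) simp

lemma star_height_shift_pos: "star_height s (star_curve (s + L0_const)) > 0"
  using L0_pos by (intro star_height_pos) auto

text \<open>\<open>angle\<close> attains every real value, so each direction occurs as an inner
  normal of the curve.\<close>

lemma normal_direction:
  fixes n :: pt
  assumes "n \<noteq> 0"
  obtains \<rho> s where "\<rho> > 0" "n = \<rho> *\<^sub>R (- sin (angle s), cos (angle s))"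
proof -
  obtain n1 n2 where n: "n = (n1, n2)" by (cases n)
  define \<rho> where "\<rho> = norm n"
  have \<rho>: "\<rho> > 0" "\<rho>\<^sup>2 = n1\<^sup>2 + n2\<^sup>2"
    using assms by (simp_all add: \<rho>_def) (simp add: n norm_prod_def)
  have "(n2 / \<rho>)\<^sup>2 + (- n1 / \<rho>)\<^sup>2 = (n1\<^sup>2 + n2\<^sup>2) / \<rho>\<^sup>2"
    by (simp add: power_divide add_divide_distrib)
  also have "\<dots> = 1" using \<rho>(1) by (simp flip: \<rho>(2))
  finally have "(n2 / \<rho>)\<^sup>2 + (- n1 / \<rho>)\<^sup>2 = 1" .
  then obtain t where "n2 / \<rho> = cos t" "- n1 / \<rho> = sin t" using sincos_total_2pi by metis
  then have "n2 = \<rho> * cos t" "n1 = \<rho> * - sin t" using \<rho>(1) by (auto simp: field_simps)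
  then show thesis using that[OF \<rho>(1), of "arclen t"] by (simp add: n angle_arclen)
qed

text \<open>A line containing the body would be its tangent line at some \<open>s\<close>, yet the
  point half a period later has positive height over it.\<close>

lemma interior_star_body: "interior star_body \<noteq> {}"
proof
  assume "interior star_body = {}"
  then obtain n b where n: "n \<noteq> 0" "star_body \<subseteq> {x. n \<bullet> x = b}"
    using empty_interior_subset_hyperplane[OF convex_star_body] by metis
  obtain \<rho> s where \<rho>: "\<rho> > 0" "n = \<rho> *\<^sub>R (- sin (angle s), cos (angle s))"
    using normal_direction[OF n(1)] .
  have "n \<bullet> x = b" if "x \<in> star_body" for x using n(2) that by auto
  then have "n \<bullet> star_curve (s + L0_const) = n \<bullet> star_curve s"
    by (simp add: star_curve_in_body)
  then have "star_height s (star_curve (s + L0_const)) = 0"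
    unfolding star_height_inner \<rho>(2) inner_scaleR_left using \<rho>(1) by simp
  then show False using star_height_shift_pos[of s] by simp
qed

text \<open>Tangent lines support the body, so the curve lies in the frontier. Conversely a
  supporting functional at a frontier point z has the inner normal of some \<open>s\<close>;
  minimality at z gives \<open>star_height s z \<le> 0\<close>, and \<open>star_height_hull\<close>
  leaves only z = \<open>star_curve s\<close>.\<close>

lemma frontier_star_body: "frontier star_body = range star_curve"
proof
  have cl: "closure star_body = star_body"
    using compact_star_body by (simp add: compact_imp_closed)
  show "range star_curve \<subseteq> frontier star_body"
  proof (rule image_subsetI)
    fix s
    let ?n = "(- sin (angle s), cos (angle s))"
    have n0: "?n \<noteq> 0"
      using sin_zero_abs_cos_one[of "angle s"] by (auto simp: zero_prod_def)
    have "?n \<bullet> z \<ge> ?n \<bullet> star_curve s" if "z \<in> star_body" for z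
      using star_height_hull[of z s] that unfolding star_body_def star_height_inner by auto
    then have "star_body \<subseteq> {z. ?n \<bullet> z \<ge> ?n \<bullet> star_curve s}" by blast
    then have "interior star_body \<subseteq> {z. ?n \<bullet> z > ?n \<bullet> star_curve s}"
      using interior_mono interior_halfspace_ge[OF n0] by metis
    then show "star_curve s \<in> frontier star_body"
      using star_curve_in_body by (auto simp: frontier_def cl)
  qed
  show "frontier star_body \<subseteq> range star_curve"
  proof
    fix z assume "z \<in> frontier star_body"
    then have z: "z \<in> star_body" "z \<notin> rel_interior star_body"
      using interior_star_body rel_interior_nonempty_interior[of star_body] by (auto simp: frontier_def cl)
    then obtain n where n: "n \<noteq> 0" "\<And>y. y \<in> star_body \<Longrightarrow> n \<bullet> z \<le> n \<bullet> y"
      using supporting_hyperplane_rel_boundary[OF convex_star_body] by metis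
    obtain \<rho> s where \<rho>: "\<rho> > 0" "n = \<rho> *\<^sub>R (- sin (angle s), cos (angle s))"
      using normal_direction[OF n(1)] .
    have "star_height s z \<le> 0"
      using n(2)[OF star_curve_in_body[of s]] \<rho>(1) unfolding star_height_inner \<rho>(2) inner_scaleR_left
      by simp
    then have "z = star_curve s" using star_height_hull[of z s] z(1) by (auto simp: star_body_def)
    then show "z \<in> range star_curve" by simp
  qed
qed

lemma star_curve_param: "c11_boundary_param star_body star_curve (2 * L0_const)"
  unfolding c11_boundary_param_def
proof (intro conjI allI)
  have vd: "vector_derivative star_curve (at s) = (cos (angle s), sin (angle s))" for s
    by (rule vector_derivative_at[OF star_curve_deriv])
  show "2 * L0_const > 0" using L0_pos by simp
  show "star_curve (s + 2 * L0_const) = star_curve s" for s by (rule star_curve_periodic)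
  show "inj_on star_curve {0..<2 * L0_const}"
  proof (rule linorder_inj_onI)
    fix s u assume su: "s < u" "s \<in> {0..<2 * L0_const}" "u \<in> {0..<2 * L0_const}"
    then have "star_height s (star_curve u) > 0" by (intro star_height_pos) auto
    moreover have "star_height s (star_curve s) = 0" by (simp add: star_height_inner)
    ultimately show "star_curve s \<noteq> star_curve u" by auto
  qed auto
  show "star_curve ` {0..2 * L0_const} = frontier star_body"
    by (simp only: frontier_star_body range_star_curve)
  show "star_curve differentiable (at s)" for s
    using star_curve_deriv by (rule differentiableI_vector)
  show "norm (vector_derivative star_curve (at s)) = 1" for s
    by (simp add: vd norm_prod_def)
  have "(1 * a_const)-lipschitz_on UNIV (\<lambda>s. cos (angle s))" "(1 * a_const)-lipschitz_on UNIV (\<lambda>s. sin (angle s))"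
  proof -
    have "1-lipschitz_on (range angle) cos"
    proof (rule lipschitz_onI)
      show "dist (cos x) (cos y) \<le> 1 * dist x y" for x y :: real
        using field_differentiable_bound[of UNIV cos "\<lambda>x. - sin x" 1 x y]
        by (auto simp: dist_norm intro!: derivative_eq_intros)
    qed simp
    then show "(1 * a_const)-lipschitz_on UNIV (\<lambda>s. cos (angle s))"
      by (rule lipschitz_on_compose2[OF angle_lipschitz])
    have "1-lipschitz_on (range angle) sin"
    proof (rule lipschitz_onI)
      show "dist (sin x) (sin y) \<le> 1 * dist x y" for x y :: real
        using field_differentiable_bound[of UNIV sin cos 1 x y]
        by (auto simp: dist_norm intro!: derivative_eq_intros)
    qed simp
    then show "(1 * a_const)-lipschitz_on UNIV (\<lambda>s. sin (angle s))"
      by (rule lipschitz_on_compose2[OF angle_lipschitz])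
  qed
  from lipschitz_on_Pair[OF this]
  show "\<exists>M. M-lipschitz_on UNIV (\<lambda>s. vector_derivative star_curve (at s))"
    unfolding vd by blast
qed

lemma classK_star_body: "classK star_body"
  unfolding classK_def
  using compact_star_body convex_star_body interior_star_body star_curve_param by blast

section \<open>Inradius and energy of the extremal body\<close>

lemma sqrt_cos_int_bound:
  assumes \<beta>: "0 \<le> \<beta>" "\<beta> \<le> pi/2"
  shows "sqrt (cos \<beta>) * sqrt_cos_int \<beta> \<le> sin \<beta>"
proof -
  define k where "k b = sin b - sqrt (cos \<beta>) * sqrt_cos_int b" for b
  have "k 0 \<le> k \<beta>"
  proof (rule DERIV_nonneg_imp_nondecreasing[OF \<beta>(1)])
    fix b assume b: "0 \<le> b" "b \<le> \<beta>"
    have c: "0 \<le> cos \<beta>" "cos \<beta> \<le> cos b"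
      using b \<beta> by (auto intro!: cos_ge_zero cos_monotone_0_pi_le)
    have "(k has_real_derivative (cos b - sqrt (cos \<beta>) * sqrt \<bar>cos b\<bar>)) (at b)"
      unfolding k_def by (auto intro!: derivative_eq_intros sqrt_cos_int(2))
    \<comment> \<open>Since cos \<beta> \<le> cos b, replacing one factor sqrt (cos b) of cos b by
      sqrt (cos \<beta>) does not increase the product.\<close>
    moreover have "sqrt (cos \<beta>) * sqrt (cos b) \<le> sqrt (cos b) * sqrt (cos b)"
      using c by (intro mult_right_mono) auto
    then have "cos b - sqrt (cos \<beta>) * sqrt \<bar>cos b\<bar> \<ge> 0" using c by simp
    ultimately show "\<exists>y. (k has_real_derivative y) (at b) \<and> 0 \<le> y" by blast
  qed
  then show ?thesis by (simp add: k_def sqrt_cos_int)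
qed

text \<open>This puts the unit disk inside the body. The squared distance from the origin starts at
  1 and increases over the first quarter of the curve; reflection and half-period shift handle the
  rest.\<close>

lemma star_curve_norm: "star_x s * star_x s + star_y s * star_y s \<ge> 1"
proof (induction s rule: mod_L0_induct)
  case (base s)
  define D where "D s = star_x s * star_x s + star_y s * star_y s" for s
  have half: "D s \<ge> 1" if s: "0 \<le> s" "s \<le> L0_const / 2" for s
  proof -
    have "D 0 \<le> D s"
    proof (rule DERIV_nonneg_imp_nondecreasing[OF s(1)])
      fix u assume u: "0 \<le> u" "u \<le> s"
      have uI: "u \<in> {0..L0_const}" using u s L0_pos by auto
      have "angle (L0_const / 2) = pi / 2" using angle_reflect[of "L0_const / 2"] by simp
      moreover have "angle u \<le> angle (L0_const / 2)"
        using u s by (simp add: angle_le_iff arclen_angle)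
      ultimately have "angle u \<le> pi/2" by simp
      \<comment> \<open>In terms of \<beta>, with S = \<open>sqrt_cos_int\<close> and v^2 = cos
        \<beta>, half the derivative is (2 v sin \<beta> - v^2 S(\<beta>)) / a, and
        \<open>sqrt_cos_int_bound\<close> says v S(\<beta>) \<le> sin \<beta>.\<close>
      define \<beta> where "\<beta> = pi/2 - angle u"
      have \<beta>: "0 \<le> \<beta>" "\<beta> \<le> pi/2" using angle_range[OF uI] \<open>angle u \<le> pi/2\<close> by (auto simp: \<beta>_def)
      have sc: "cos \<beta> = sin (angle u)" "sin \<beta> = cos (angle u)" by (simp_all add: \<beta>_def cos_diff sin_diff)
      have c0: "cos \<beta> \<ge> 0" "sin \<beta> \<ge> 0" using \<beta> by (auto intro: cos_ge_zero sin_ge_zero)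
      define v where "v = sqrt (cos \<beta>)"
      have v: "v \<ge> 0" "cos \<beta> = v * v" using c0 by (auto simp: v_def)
      have y: "star_y u = - sqrt_cos_int \<beta> / a_const"
        using star_y_eq[OF uI] sqrt_cos_int_minus[of \<beta>] by (simp add: \<beta>_def)
      have x: "star_x u = 2 / a_const * v" using star_x_eq[OF uI] by (simp add: v_def sc)
      have "v * (v * sqrt_cos_int \<beta>) \<le> v * sin \<beta>"
        by (rule mult_left_mono[OF sqrt_cos_int_bound[OF \<beta>, folded v_def] v(1)])
      moreover have "0 \<le> v * sin \<beta>" using v(1) c0(2) by simp
      ultimately have "(2 * (v * sin \<beta>) - v * (v * sqrt_cos_int \<beta>)) / a_const \<ge> 0"
        using a_const_pos by simp
      then have "star_x u * cos (angle u) + star_y u * sin (angle u) \<ge> 0"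
        unfolding x y sc(1)[symmetric] sc(2)[symmetric] v(2) using a_const_pos by (simp add: field_simps)
      moreover have "(D has_real_derivative 2 * (star_x u * cos (angle u) + star_y u * sin (angle u))) (at u)"
        unfolding D_def by (auto intro!: derivative_eq_intros star_x_deriv star_y_deriv)
      ultimately show "\<exists>y. (D has_real_derivative y) (at u) \<and> 0 \<le> y"
        by (intro exI[of _ "2 * (star_x u * cos (angle u) + star_y u * sin (angle u))"]) auto
    qed
    then show ?thesis by (simp add: D_def star_curve_0)
  qed
  have "D (L0_const - s) = D s" by (simp add: D_def star_reflect[OF base])
  then have "D s \<ge> 1" using half[of s] half[of "L0_const - s"] base by (cases "s \<le> L0_const / 2") auto
  then show ?case by (simp add: D_def)
qed (simp add: star_shift)

lemma inradius_star_body: "inradius star_body = 1"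
  unfolding inradius_def
proof (rule cSup_eq_maximum)
  have cl: "closed star_body" using compact_star_body by (rule compact_imp_closed)
  have "0 = (1/2) *\<^sub>R star_curve 0 + (1/2) *\<^sub>R star_curve (0 + L0_const)"
    by (simp only: star_curve_shift) simp
  also have "\<dots> \<in> star_body"
    by (rule convexD[OF convex_star_body star_curve_in_body star_curve_in_body]) auto
  finally have "0 \<in> star_body" .
  moreover have "1 \<le> infdist 0 (frontier star_body)"
  proof -
    have "1 \<le> dist 0 (star_curve s)" for s
      using star_curve_norm[of s] by (simp add: star_curve_def norm_prod_def power2_eq_square)
    then show ?thesis
      unfolding infdist_def frontier_star_body by (auto intro!: cINF_greatest)
  qed
  ultimately have "cball 0 1 \<subseteq> star_body" by (rule cball_subset_of_infdist_frontier[OF cl])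
  then show "1 \<in> {r. 0 \<le> r \<and> (\<exists>c. cball c r \<subseteq> star_body)}"
    by (intro CollectI conjI exI[of _ 0]) auto
next
  fix r assume "r \<in> {r. 0 \<le> r \<and> (\<exists>c. cball c r \<subseteq> star_body)}"
  then obtain c where r: "0 \<le> r" "cball c r \<subseteq> star_body" by auto
  \<comment> \<open>The tangent lines at 0 and \<open>L0_const\<close> are the horizontal lines at
    heights -1 and 1.\<close>
  have strip: "-1 \<le> snd z \<and> snd z \<le> 1" if "z \<in> star_body" for z
  proof -
    have h: "star_height s z \<ge> 0" for s
      using star_height_hull[of z s] that by (auto simp: star_body_def star_height_inner)
    have "star_y L0_const = 1" using star_shift(2)[of 0] by (simp add: star_curve_0)
    then show ?thesis
      using h[of 0] h[of L0_const] by (simp add: star_height_def angle_0 angle_L0 star_curve_0)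
  qed
  have "c + (0, r) \<in> cball c r" "c - (0, r) \<in> cball c r"
    using r(1) by (auto simp: dist_norm norm_prod_def)
  then have "snd (c + (0, r)) \<le> 1" "-1 \<le> snd (c - (0, r))" using strip r(2) by blast+
  then show "r \<le> 1" by simp
qed

text \<open>The first identity is the curvature relation \<open>2 \<theta>' = a\<^sup>2 \<bar>x\<bar>\<close> in integrated form.\<close>
lemma star_curve_invariant:
  "star_x s * \<bar>star_x s\<bar> = 4 / a_const\<^sup>2 * sin (angle s)"
  "cos (angle s) = 0 \<Longrightarrow> star_y s = 0"
proof (induction s rule: mod_L0_induct)
  case (base s)
  {
    case 1
    have "sin (angle s) \<ge> 0" using angle_range[OF base] by (intro sin_ge_zero) auto
    then show ?case using star_x_eq[OF base] a_const_pos by (simp add: abs_mult power2_eq_square)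
  next
    case 2
    have "0 \<le> angle s" "angle s \<le> pi" using angle_range[OF base] by auto
    then have "angle s = pi/2" using 2 cos_monotone_0_pi[of "angle s" "pi/2"] cos_monotone_0_pi[of "pi/2" "angle s"]
      by (cases "angle s" "pi/2" rule: linorder_cases) auto
    then have "star_y s = sqrt_cos_int (pi/2 - pi/2) / a_const"
      by (simp only: star_y_eq[OF base])
    then show ?case by (simp add: sqrt_cos_int)
  }
qed (simp_all add: star_shift angle_shift)

text \<open>The function x |x| is differentiable also at 0. This lets the invariant of the extremal
  curve be differentiated across the axis x = 0 without a case distinction on signs.\<close>

lemma has_real_derivative_mult_abs:
  fixes f :: "real \<Rightarrow> real"
  assumes f: "(f has_real_derivative d) (at s)"
  shows "((\<lambda>u. f u * \<bar>f u\<bar>) has_real_derivative 2 * \<bar>f s\<bar> * d) (at s)"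
proof -
  have "((\<lambda>x::real. x * \<bar>x\<bar>) has_real_derivative 2 * \<bar>x\<bar>) (at x)" for x
  proof (cases "x = 0")
    case True
    have "(\<lambda>h::real. \<bar>h\<bar>) \<midarrow>0\<rightarrow> 0" by (rule tendsto_rabs_zero) simp
    then have "(\<lambda>h::real. h * \<bar>h\<bar> / h) \<midarrow>0\<rightarrow> 0"
      by (rule Lim_transform_eventually) (auto simp: eventually_at_filter)
    then show ?thesis by (simp add: DERIV_def True)
  next
    case False
    show ?thesis
    proof (cases "x > 0")
      case True
      have "((\<lambda>x::real. x * x) has_real_derivative 2 * \<bar>x\<bar>) (at x)"
        using True by (auto intro!: derivative_eq_intros)
      then show ?thesis
        by (rule has_field_derivative_transform_within_open[where S="{0<..}"]) (use True in auto)
    next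
      case neg: False
      have "((\<lambda>x::real. - (x * x)) has_real_derivative 2 * \<bar>x\<bar>) (at x)"
        using neg by (auto intro!: derivative_eq_intros)
      then show ?thesis
        by (rule has_field_derivative_transform_within_open[where S="{..<0}"]) (use neg False in auto)
    qed
  qed
  from DERIV_chain2[where f="\<lambda>x. x * \<bar>x\<bar>", OF this f] show ?thesis by simp
qed

text \<open>No change of parameter between \<gamma> and \<open>star_curve\<close> is constructed.
  Points and tangent directions of the two are matched pointwise; the invariant then holds along
  \<gamma> and can be differentiated there.\<close>

lemma star_body_energy:
  assumes c11: "c11_boundary_param star_body \<gamma> L"
  shows "elastic_energy \<gamma> L = 2 * a_const\<^sup>2"
proof -
  have L: "L > 0" using c11 by (simp add: c11_boundary_param_def)
  obtain \<Theta> \<sigma> K where \<sigma>: "\<sigma> \<in> {1, -1 :: real}" and lip: "K-lipschitz_on UNIV \<Theta>"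
    and per: "\<And>s. \<Theta> (s + L) = \<Theta> s + 2 * pi"
    and dg: "\<And>s. (\<gamma> has_vector_derivative (cos (\<Theta> s), \<sigma> * sin (\<Theta> s))) (at s)"
    and sup: "\<And>s z. z \<in> star_body \<Longrightarrow>
       \<sigma> * cos (\<Theta> s) * (snd z - snd (\<gamma> s)) - sin (\<Theta> s) * (fst z - fst (\<gamma> s)) \<ge> 0"
    using tangent_angle[OF convex_star_body compact_star_body interior_star_body c11] by metis
  have \<sigma>2: "\<sigma> * \<sigma> = 1" using \<sigma> by auto
  define X where "X s = fst (\<gamma> s)" for s
  have dX: "(X has_real_derivative cos (\<Theta> s)) (at s)" for s
    unfolding X_def by (rule has_vector_derivative_components(1)[OF dg])
  have rng: "range \<gamma> = range star_curve"
    using c11_range[OF c11] frontier_star_body by simp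
  have tangent: "\<exists>t. \<gamma> s = star_curve t \<and> sin (\<Theta> s) = sin (angle t) \<and> \<sigma> * cos (\<Theta> s) = cos (angle t)" for s
  proof -
    obtain t where t: "\<gamma> s = star_curve t" using rng by blast
    \<comment> \<open>\<open>U\<close> measures points of \<open>star_curve\<close> against the
      support line of \<gamma> at s; it vanishes and is minimal at t, so the tangents are
      parallel.\<close>
    define U where "U u = \<sigma> * cos (\<Theta> s) * (star_y u - star_y t) - sin (\<Theta> s) * (star_x u - star_x t)" for u
    have U0: "U u \<ge> 0" for u
      using sup[OF star_curve_in_body[of u], of s] by (simp add: t U_def star_curve_def)
    have "(U has_real_derivative (\<sigma> * cos (\<Theta> s) * sin (angle t) - sin (\<Theta> s) * cos (angle t))) (at t)"
      unfolding U_def by (auto intro!: derivative_eq_intros star_x_deriv star_y_deriv)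
    then have par: "\<sigma> * cos (\<Theta> s) * sin (angle t) - sin (\<Theta> s) * cos (angle t) = 0"
      by (rule DERIV_local_min[where d=1]) (use U0 in \<open>auto simp: U_def[of t]\<close>)
    \<comment> \<open>\<kappa> is the cosine of the angle between the two normals, hence 1 or -1 by
      parallelism; the point half a period after t rules out -1.\<close>
    define \<kappa> where "\<kappa> = sin (\<Theta> s) * sin (angle t) + \<sigma> * cos (\<Theta> s) * cos (angle t)"
    have sc: "(sin (\<Theta> s))\<^sup>2 + (cos (\<Theta> s))\<^sup>2 = 1" "(sin (angle t))\<^sup>2 + (cos (angle t))\<^sup>2 = 1" by simp_all
    have s1: "sin (\<Theta> s) = \<kappa> * sin (angle t)" unfolding \<kappa>_def using par sc(2) by algebra
    have c1: "\<sigma> * cos (\<Theta> s) = \<kappa> * cos (angle t)" unfolding \<kappa>_def using par sc(2) by algebra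
    have "\<kappa>\<^sup>2 = 1" using s1 c1 sc \<sigma>2 by algebra
    moreover have "U (t + L0_const) = \<kappa> * star_height t (star_curve (t + L0_const))"
      unfolding U_def c1 s1 star_height_def star_curve_def by (simp add: algebra_simps)
    then have "\<kappa> \<ge> 0" using U0[of "t + L0_const"] star_height_shift_pos[of t] by (simp add: zero_le_mult_iff)
    ultimately have "\<kappa> = 1" by (simp add: power2_eq_1_iff)
    then show ?thesis using t s1 c1 by auto
  qed
  have inv: "X s * \<bar>X s\<bar> = 4 / a_const\<^sup>2 * sin (\<Theta> s)" for s
  proof -
    obtain t where t: "\<gamma> s = star_curve t" "sin (\<Theta> s) = sin (angle t)" using tangent by blast
    then show ?thesis using star_curve_invariant(1)[of t] by (simp add: X_def star_curve_def)
  qed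
  have Xabs: "\<bar>X s\<bar> = 2 / a_const * sqrt \<bar>sin (\<Theta> s)\<bar>" for s
  proof (rule power2_eq_imp_eq)
    have "\<bar>X s\<bar>\<^sup>2 = \<bar>X s * \<bar>X s\<bar>\<bar>" by (simp add: abs_mult power2_eq_square)
    also have "\<dots> = 4 / a_const\<^sup>2 * \<bar>sin (\<Theta> s)\<bar>" unfolding inv by (simp add: abs_mult)
    finally show "\<bar>X s\<bar>\<^sup>2 = (2 / a_const * sqrt \<bar>sin (\<Theta> s)\<bar>)\<^sup>2"
      by (simp add: power_mult_distrib power_divide)
  qed (use a_const_pos in auto)
  \<comment> \<open>Comparing derivatives will require division by cos \<Theta>. Its zeros lie over
    the two points (2/a, 0) and (-2/a, 0), so injectivity of \<gamma> leaves only finitely many in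
    one period.\<close>
  let ?Z = "{s \<in> {0..L}. cos (\<Theta> s) = 0}"
  have "\<gamma> ` ?Z \<subseteq> {(2 / a_const, 0), (- (2 / a_const), 0)}"
  proof (rule image_subsetI)
    fix s assume "s \<in> ?Z"
    then have c: "cos (\<Theta> s) = 0" by simp
    obtain t where t: "\<gamma> s = star_curve t" "\<sigma> * cos (\<Theta> s) = cos (angle t)" using tangent by blast
    have "snd (\<gamma> s) = 0" using star_curve_invariant(2)[of t] t c by (simp add: star_curve_def)
    moreover have "(sin (\<Theta> s))\<^sup>2 = 1" using sin_cos_squared_add[of "\<Theta> s"] c by simp
    then have "\<bar>sin (\<Theta> s)\<bar> = 1" by (auto simp: power2_eq_1_iff)
    then have "\<bar>fst (\<gamma> s)\<bar> = 2 / a_const" using Xabs[of s] by (simp add: X_def)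
    ultimately show "\<gamma> s \<in> {(2 / a_const, 0), (- (2 / a_const), 0)}"
      by (cases "\<gamma> s") (auto simp: abs_if split: if_splits)
  qed
  then have "finite (\<gamma> ` ?Z)" by (rule finite_subset) simp
  then have "finite (\<gamma> ` (?Z \<inter> {0..<L}))" by (rule finite_subset[OF image_mono[OF Int_lower1]])
  moreover have "inj_on \<gamma> (?Z \<inter> {0..<L})"
    using c11 by (auto simp: c11_boundary_param_def intro: inj_on_subset)
  ultimately have "finite (?Z \<inter> {0..<L})" by (rule finite_imageD)
  moreover have "?Z \<subseteq> insert L (?Z \<inter> {0..<L})" by auto
  ultimately have Zneg: "negligible ?Z" by (meson finite_insert negligible_finite rev_finite_subset)
  obtain N where N: "negligible N"
    "\<And>x. x \<notin> N \<Longrightarrow> (\<Theta> has_real_derivative deriv \<Theta> x) (at x)"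
    using lipschitz_ae_derivative[OF lip] by metis
  define Q where "Q t = sqrt_cos_int (t - pi/2)" for t
  have dQ: "(Q has_real_derivative sqrt \<bar>sin t\<bar>) (at t)" for t
    unfolding Q_def using DERIV_shift[of sqrt_cos_int _ t "- (pi/2)"] sqrt_cos_int(2)[of "t - pi/2"]
    by (simp add: cos_diff)
  have I: "((\<lambda>s. sqrt \<bar>sin (\<Theta> s)\<bar> * deriv \<Theta> s) has_integral (Q (\<Theta> L) - Q (\<Theta> 0))) {0..L}"
    by (rule has_integral_lipschitz_chain[OF lip dQ, of 1]) (use L in auto)
  have "((\<lambda>s. (deriv \<Theta> s)\<^sup>2) has_integral (a_const * (Q (\<Theta> L) - Q (\<Theta> 0)))) {0..L}"
  proof (rule has_integral_spike[OF negligible_Un[OF N(1) Zneg] _ has_integral_mult_right[OF I]])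
    fix s assume s: "s \<in> {0..L} - (N \<union> ?Z)"
    then have d: "(\<Theta> has_real_derivative deriv \<Theta> s) (at s)" and c: "cos (\<Theta> s) \<noteq> 0" using N(2) by auto
    have d1: "((\<lambda>u. 4 / a_const\<^sup>2 * sin (\<Theta> u)) has_real_derivative 4 / a_const\<^sup>2 * (cos (\<Theta> s) * deriv \<Theta> s)) (at s)"
      by (rule DERIV_cmult[OF DERIV_chain2[where f=sin and g=\<Theta>, OF DERIV_sin d]])
    have d2: "((\<lambda>u. X u * \<bar>X u\<bar>) has_real_derivative 2 * \<bar>X s\<bar> * cos (\<Theta> s)) (at s)"
      using has_real_derivative_mult_abs[OF dX] .
    have "4 / a_const\<^sup>2 * (cos (\<Theta> s) * deriv \<Theta> s) = 2 * \<bar>X s\<bar> * cos (\<Theta> s)"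
      using DERIV_unique[OF d1] d2 unfolding inv by blast
    then have "deriv \<Theta> s = a_const\<^sup>2 / 2 * \<bar>X s\<bar>"
      using c a_const_pos by (simp add: field_simps)
    also have "\<dots> = a_const * sqrt \<bar>sin (\<Theta> s)\<bar>"
      unfolding Xabs using a_const_pos by (simp add: power2_eq_square)
    finally show "(deriv \<Theta> s)\<^sup>2 = a_const * (sqrt \<bar>sin (\<Theta> s)\<bar> * deriv \<Theta> s)"
      by (simp add: power2_eq_square)
  qed
  then have "elastic_energy \<gamma> L = 1/2 * (a_const * (Q (\<Theta> L) - Q (\<Theta> 0)))"
    unfolding elastic_energy_angle[OF lip \<sigma> dg] by (simp add: integral_unique)
  moreover have "Q (\<Theta> L) - Q (\<Theta> 0) = 4 * a_const"
  proof -
    \<comment> \<open>Each half-turn contributes 2 a because sqrt |sin| has period pi, and \<Theta>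
      makes exactly two of them.\<close>
    have half: "Q (t + pi) = Q t + 2 * a_const" for t
    proof -
      have "((\<lambda>t. Q (t + pi) - Q t) has_real_derivative 0) (at t)" for t
        using DERIV_diff[OF iffD1[OF DERIV_shift dQ[of "t + pi"]] dQ[of t]] by simp
      then have "Q (t + pi) - Q t = Q (0 + pi) - Q 0" by (rule DERIV_isconst_all[rule_format])
      then show ?thesis by (simp add: Q_def sqrt_cos_int_minus sqrt_cos_int_half_pi)
    qed
    have "\<Theta> L = \<Theta> 0 + pi + pi" using per[of 0] by simp
    then show ?thesis by (simp only: half)
  qed
  ultimately show ?thesis by (simp add: power2_eq_square)
qed

theorem theorem1p1:
  shows "(\<forall>\<Omega> \<gamma> L. classK \<Omega> \<longrightarrow> c11_boundary_param \<Omega> \<gamma> L \<longrightarrow>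
            elastic_energy \<gamma> L * inradius \<Omega> \<ge> 2 * a_const\<^sup>2)
       \<and> (\<exists>\<theta>. theta_sol \<theta>)
       \<and> (\<forall>\<theta>. theta_sol \<theta> \<longrightarrow>
            classK (Omega_star \<theta>) \<and> inradius (Omega_star \<theta>) = 1 \<and>
            (\<forall>\<gamma> L. c11_boundary_param (Omega_star \<theta>) \<gamma> L \<longrightarrow>
               elastic_energy \<gamma> L = 2 * a_const\<^sup>2))"
proof -
  have "Omega_star \<theta> = star_body" if "theta_sol \<theta>" for \<theta>
    using Omega_star_eq[OF that] by (simp add: star_body_def)
  then show ?thesis
    using energy_inradius_lower_bound theta_sol_angle classK_star_body inradius_star_body star_body_energy
    by metis
qed

end
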